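(* For every even positive integer $d$ and every integer $k\ge 1$, the following holds. Given a graph $G$, a finite family $\mathcal H=\{H_j\}_{j\in J}$ of connected non-null subgraphs of $G$, a weight function $\mathfrak w:J\to\mathbb Q_+$, and a tree decomposition $\mathcal T=(T,\{X_t\}_{t\in V(T)})$ of $G$ with independence number at most $k$, the Maximum Weight Distance-$d$ Packing problem can be solved in time $\mathcal O\big((|V(G)|+|V(T)|)\cdot|E(G)| + |J|\cdot|V(G)|\cdot((|J|+|V(T)|+|V(G)|)+|J|^{k+1}\cdot|V(T)|)\big)$.
   Context: For sets $A,B\subseteq V(G)$, $\mathsf{dist}_G(A,B)$ is the minimum distance in $G$ between a vertex of $A$ and a vertex of $B$; the distance between two subgraphs is the distance between their vertex sets. A distance-$d$ $\mathcal H$-packing is a subfamily $\{H_i\}_{i\in I}$, $I\subseteq J$, of subgraphs at pairwise distance at least $d$ in $G$; its weight is $\sum_{i\in I}\mathfrak w_i$. The Maximum Weight Distance-$d$ Packing problem asks for a distance-$d$ $\mathcal H$-packing in $G$ of maximum weight. A tree decomposition of $G$ is a pair $(T,\{X_t\}_{t\in V(T)})$ with $T$ a tree and bags $X_t\subseteq V(G)$ such that every vertex lies in some bag, every edge has both endpoints in some bag, and for every vertex the nodes whose bags contain it induce a connected subtree of $T$; its independence number is $\max_t\alpha(G[X_t])$. *)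

theory Defs
  imports Complex_Main "HOL-Library.Extended_Nat"
begin

section \<open>Finite simple graphs\<close>

record 'a graph =
  verts :: "'a set"
  edges :: "'a set set"

definition fin_graph :: "'a graph \<Rightarrow> bool" where
  "fin_graph G \<longleftrightarrow> finite (verts G) \<and> (\<forall>e\<in>edges G. e \<subseteq> verts G \<and> card e = 2)"

definition subgraph :: "'a graph \<Rightarrow> 'a graph \<Rightarrow> bool" where
  "subgraph H G \<longleftrightarrow> fin_graph H \<and> verts H \<subseteq> verts G \<and> edges H \<subseteq> edges G"

definition induced :: "'a graph \<Rightarrow> 'a set \<Rightarrow> 'a graph" where
  "induced G S = \<lparr>verts = verts G \<inter> S, edges = {e \<in> edges G. e \<subseteq> S}\<rparr>"

definition walk :: "'a graph \<Rightarrow> 'a list \<Rightarrow> bool" where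
  "walk G p \<longleftrightarrow> p \<noteq> [] \<and> set p \<subseteq> verts G \<and>
     (\<forall>i. Suc i < length p \<longrightarrow> {p ! i, p ! Suc i} \<in> edges G)"

text \<open>The null graph counts as connected here; non-nullness is always required separately.\<close>

definition connected_graph :: "'a graph \<Rightarrow> bool" where
  "connected_graph G \<longleftrightarrow>
     (\<forall>u\<in>verts G. \<forall>v\<in>verts G. \<exists>p. walk G p \<and> hd p = u \<and> last p = v)"

definition is_cycle :: "'a graph \<Rightarrow> 'a list \<Rightarrow> bool" where
  "is_cycle G p \<longleftrightarrow> walk G p \<and> distinct p \<and> 3 \<le> length p \<and> {last p, hd p} \<in> edges G"

definition is_tree :: "'a graph \<Rightarrow> bool" where
  "is_tree T \<longleftrightarrow> fin_graph T \<and> verts T \<noteq> {} \<and> connected_graph T \<and> (\<nexists>p. is_cycle T p)"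

text \<open>Distances are infinite if there is no connecting walk (infimum of the empty set).\<close>

definition graph_dist :: "'a graph \<Rightarrow> 'a \<Rightarrow> 'a \<Rightarrow> enat" where
  "graph_dist G u v = (INF p \<in> {p. walk G p \<and> hd p = u \<and> last p = v}. enat (length p - 1))"

definition set_dist :: "'a graph \<Rightarrow> 'a set \<Rightarrow> 'a set \<Rightarrow> enat" where
  "set_dist G A B = (INF u\<in>A. INF v\<in>B. graph_dist G u v)"

definition independent_set :: "'a graph \<Rightarrow> 'a set \<Rightarrow> bool" where
  "independent_set G S \<longleftrightarrow> S \<subseteq> verts G \<and> (\<forall>u\<in>S. \<forall>v\<in>S. {u, v} \<notin> edges G)"

definition independence_number :: "'a graph \<Rightarrow> nat" where
  "independence_number G = Max (card ` {S. independent_set G S})"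

section \<open>Tree decompositions\<close>

definition tree_decomposition :: "'a graph \<Rightarrow> 'b graph \<Rightarrow> ('b \<Rightarrow> 'a set) \<Rightarrow> bool" where
  "tree_decomposition G T X \<longleftrightarrow>
     is_tree T \<and>
     (\<forall>t\<in>verts T. X t \<subseteq> verts G) \<and>
     (\<forall>v\<in>verts G. \<exists>t\<in>verts T. v \<in> X t) \<and>
     (\<forall>e\<in>edges G. \<exists>t\<in>verts T. e \<subseteq> X t) \<and>
     (\<forall>v\<in>verts G. connected_graph (induced T {t \<in> verts T. v \<in> X t}))"

definition td_independence_number :: "'a graph \<Rightarrow> 'b graph \<Rightarrow> ('b \<Rightarrow> 'a set) \<Rightarrow> nat" where
  "td_independence_number G T X = Max ((\<lambda>t. independence_number (induced G (X t))) ` verts T)"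

section \<open>Distance packings\<close>

definition distance_packing ::
  "nat \<Rightarrow> 'a graph \<Rightarrow> 'j set \<Rightarrow> ('j \<Rightarrow> 'a graph) \<Rightarrow> 'j set \<Rightarrow> bool" where
  "distance_packing d G J H I \<longleftrightarrow>
     I \<subseteq> J \<and>
     (\<forall>i\<in>I. \<forall>j\<in>I. i \<noteq> j \<longrightarrow> enat d \<le> set_dist G (verts (H i)) (verts (H j)))"

definition max_weight_distance_packing ::
  "nat \<Rightarrow> 'a graph \<Rightarrow> 'j set \<Rightarrow> ('j \<Rightarrow> 'a graph) \<Rightarrow> ('j \<Rightarrow> rat) \<Rightarrow> 'j set \<Rightarrow> bool" where
  "max_weight_distance_packing d G J H w I \<longleftrightarrow>
     distance_packing d G J H I \<and>
     (\<forall>I'. distance_packing d G J H I' \<longrightarrow> sum w I' \<le> sum w I)"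

section \<open>Machine model\<close>

text \<open>
  A random access machine with uniform cost, programmed in a structured language. Memory has two
  separate sorts: natural numbers, which also serve as addresses, and weights (rationals). Each sort
  has registers and arrays, selected by names occurring literally in the program, so a program uses
  only finitely many of them. On both sorts only addition, subtraction (truncated on naturals) and
  comparison are available; there is no multiplication and no conversion between the sorts.
\<close>

record state =
  nvar :: "string \<Rightarrow> nat"
  narr :: "string \<Rightarrow> nat \<Rightarrow> nat"
  wvar :: "string \<Rightarrow> rat"
  warr :: "string \<Rightarrow> nat \<Rightarrow> rat"

datatype nexp =
    NConst nat
  | NVar string
  | NArr string nexp
  | NPlus nexp nexp
  | NMinus nexp nexp

datatype wexp =
    WConst rat
  | WVar string
  | WArr string nexp
  | WPlus wexp wexp
  | WMinus wexp wexp

datatype bexp =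
    NLess nexp nexp
  | WLess wexp wexp
  | BNot bexp
  | BAnd bexp bexp

fun nval :: "nexp \<Rightarrow> state \<Rightarrow> nat" where
  "nval (NConst n) s = n"
| "nval (NVar x) s = nvar s x"
| "nval (NArr a i) s = narr s a (nval i s)"
| "nval (NPlus e f) s = nval e s + nval f s"
| "nval (NMinus e f) s = nval e s - nval f s"

fun wval :: "wexp \<Rightarrow> state \<Rightarrow> rat" where
  "wval (WConst q) s = q"
| "wval (WVar x) s = wvar s x"
| "wval (WArr a i) s = warr s a (nval i s)"
| "wval (WPlus e f) s = wval e s + wval f s"
| "wval (WMinus e f) s = wval e s - wval f s"

fun bval :: "bexp \<Rightarrow> state \<Rightarrow> bool" where
  "bval (NLess e f) s \<longleftrightarrow> nval e s < nval f s"
| "bval (WLess e f) s \<longleftrightarrow> wval e s < wval f s"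
| "bval (BNot b) s \<longleftrightarrow> \<not> bval b s"
| "bval (BAnd b c) s \<longleftrightarrow> bval b s \<and> bval c s"

datatype com =
    Skip
  | NAssign string nexp
  | NStore string nexp nexp
  | WAssign string wexp
  | WStore string nexp wexp
  | Seq com com
  | Cond bexp com com
  | While bexp com

text \<open>
  \<open>exec c s t s'\<close>: started in \<open>s\<close>, \<open>c\<close> terminates in \<open>s'\<close> after \<open>t\<close> steps. Every assignment and every
  test costs one step. The expressions in a fixed program have bounded size, so charging for each
  elementary operation in them would change running times only by a constant factor.
\<close>

inductive exec :: "com \<Rightarrow> state \<Rightarrow> nat \<Rightarrow> state \<Rightarrow> bool" where
  Skip: "exec Skip s 1 s"
| NAssign: "exec (NAssign x e) s 1 (s\<lparr>nvar := (nvar s)(x := nval e s)\<rparr>)"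
| NStore: "exec (NStore a i e) s 1
     (s\<lparr>narr := (narr s)(a := (narr s a)(nval i s := nval e s))\<rparr>)"
| WAssign: "exec (WAssign x e) s 1 (s\<lparr>wvar := (wvar s)(x := wval e s)\<rparr>)"
| WStore: "exec (WStore a i e) s 1
     (s\<lparr>warr := (warr s)(a := (warr s a)(nval i s := wval e s))\<rparr>)"
| Seq: "exec c1 s t1 s1 \<Longrightarrow> exec c2 s1 t2 s2 \<Longrightarrow> exec (Seq c1 c2) s (t1 + t2) s2"
| CondTrue: "bval b s \<Longrightarrow> exec c1 s t s' \<Longrightarrow> exec (Cond b c1 c2) s (1 + t) s'"
| CondFalse: "\<not> bval b s \<Longrightarrow> exec c2 s t s' \<Longrightarrow> exec (Cond b c1 c2) s (1 + t) s'"
| WhileFalse: "\<not> bval b s \<Longrightarrow> exec (While b c) s 1 s"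
| WhileTrue: "bval b s \<Longrightarrow> exec c s t1 s1 \<Longrightarrow> exec (While b c) s1 t2 s2 \<Longrightarrow>
     exec (While b c) s (1 + t1 + t2) s2"

inductive_cases SkipE: "exec Skip s t s'"
inductive_cases NAssignE: "exec (NAssign x e) s t s'"
inductive_cases NStoreE: "exec (NStore a i e) s t s'"
inductive_cases WAssignE: "exec (WAssign x e) s t s'"
inductive_cases WStoreE: "exec (WStore a i e) s t s'"
inductive_cases SeqE: "exec (Seq c1 c2) s t s'"
inductive_cases CondE: "exec (Cond b c1 c2) s t s'"
inductive_cases WhileE: "exec (While b c) s t s'"

lemma exec_deterministic:
  "exec c s t s' \<Longrightarrow> exec c s u s'' \<Longrightarrow> u = t \<and> s'' = s'"
proof (induction arbitrary: u s'' rule: exec.induct)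
  case Skip
  then show ?case by (rule SkipE) simp
next
  case NAssign
  then show ?case by (rule NAssignE) simp
next
  case NStore
  then show ?case by (rule NStoreE) simp
next
  case WAssign
  then show ?case by (rule WAssignE) simp
next
  case WStore
  then show ?case by (rule WStoreE) simp
next
  case (Seq c1 s t1 s1 c2 t2 s2)
  from Seq.prems show ?case
  proof (rule SeqE)
    fix r1 q r2
    assume u: "u = r1 + r2" and 1: "exec c1 s r1 q" and 2: "exec c2 q r2 s''"
    note eq1 = Seq.IH(1)[OF 1]
    from 2 eq1 have "exec c2 s1 r2 s''" by simp
    from Seq.IH(2)[OF this] eq1 u show ?thesis by simp
  qed
next
  case (CondTrue b s c1 t s' c2)
  from CondTrue.prems show ?case
  proof (rule CondE)
    fix r
    assume u: "u = Suc r" and 1: "exec c1 s r s''"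
    from CondTrue.IH[OF 1] u show ?thesis by simp
  qed (simp add: CondTrue.hyps)
next
  case (CondFalse b s c2 t s' c1)
  from CondFalse.prems show ?case
  proof (rule CondE)
    fix r
    assume u: "u = Suc r" and 1: "exec c2 s r s''"
    from CondFalse.IH[OF 1] u show ?thesis by simp
  qed (simp add: CondFalse.hyps)
next
  case WhileFalse
  from WhileFalse.prems show ?case by (rule WhileE) (simp_all add: WhileFalse.hyps)
next
  case (WhileTrue b s c t1 s1 t2 s2)
  from WhileTrue.prems show ?case
  proof (rule WhileE)
    fix r1 q r2
    assume u: "u = Suc (r1 + r2)" and 1: "exec c s r1 q" and 2: "exec (While b c) q r2 s''"
    note eq1 = WhileTrue.IH(1)[OF 1]
    from 2 eq1 have "exec (While b c) s1 r2 s''" by simp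
    from WhileTrue.IH(2)[OF this] eq1 u show ?thesis by simp
  qed (simp add: WhileTrue.hyps)
qed

section \<open>Encoding of instances\<close>

text \<open>
  The sets \<open>F 0, \<dots>, F (n - 1)\<close> are stored one after the other, without repetitions and each in
  arbitrary order, in \<open>dat\<close>; the block of \<open>F i\<close> occupies the positions from \<open>off i\<close> up to (excluding)
  \<open>off (Suc i)\<close>.
\<close>

definition stores_blocks ::
  "nat \<Rightarrow> (nat \<Rightarrow> nat) \<Rightarrow> (nat \<Rightarrow> 'a) \<Rightarrow> (nat \<Rightarrow> 'a set) \<Rightarrow> bool" where
  "stores_blocks n off dat F \<longleftrightarrow>
     off 0 = 0 \<and>
     (\<forall>i<n. off i \<le> off (Suc i) \<and> bij_betw dat {off i..<off (Suc i)} (F i))"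

definition neighbours :: "'a graph \<Rightarrow> 'a \<Rightarrow> 'a set" where
  "neighbours G v = {u. {u, v} \<in> edges G}"

text \<open>
  Vertices, indices of the family and nodes of the tree are numbered from 0. \<open>G\<close> and \<open>T\<close> are given
  by adjacency lists, each bag by a list of vertices, each \<open>H j\<close> by a list of vertices and a list of
  edges. All memory not mentioned is arbitrary.
\<close>

definition encodes_instance ::
  "state \<Rightarrow> nat graph \<Rightarrow> nat set \<Rightarrow> (nat \<Rightarrow> nat graph) \<Rightarrow> (nat \<Rightarrow> rat) \<Rightarrow>
   nat graph \<Rightarrow> (nat \<Rightarrow> nat set) \<Rightarrow> bool" where
  "encodes_instance s G J H w T X \<longleftrightarrow>
     verts G = {..<nvar s ''nV''} \<and>
     J = {..<nvar s ''nJ''} \<and>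
     verts T = {..<nvar s ''nT''} \<and>
     stores_blocks (nvar s ''nV'') (narr s ''G_off'') (narr s ''G_adj'') (neighbours G) \<and>
     stores_blocks (nvar s ''nT'') (narr s ''T_off'') (narr s ''T_adj'') (neighbours T) \<and>
     stores_blocks (nvar s ''nT'') (narr s ''X_off'') (narr s ''X_dat'') X \<and>
     stores_blocks (nvar s ''nJ'') (narr s ''HV_off'') (narr s ''HV_dat'') (\<lambda>j. verts (H j)) \<and>
     stores_blocks (nvar s ''nJ'') (narr s ''HE_off'')
       (\<lambda>i. {narr s ''HE_fst'' i, narr s ''HE_snd'' i}) (\<lambda>j. edges (H j)) \<and>
     (\<forall>j\<in>J. warr s ''w'' j = w j)"

definition output_set :: "state \<Rightarrow> nat set \<Rightarrow> nat set" where
  "output_set s J = {j \<in> J. narr s ''sel'' j = 1}"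

end

theory Submission
  imports Defs "HOL-Library.Nat_Bijection"
begin

text \<open>
  Write \<open>d = 2 r + 2\<close> and let \<open>B j\<close> be the ball of radius \<open>r\<close> around \<open>H j\<close>. Two members of the family
  are at distance less than \<open>d\<close> iff their balls intersect or are joined by an edge. Hence the sets
  \<open>{j. B j meets X t}\<close> form a tree decomposition of the conflict graph on \<open>J\<close>: balls of connected
  subgraphs are connected, so they occupy connected parts of \<open>T\<close>. Picking a vertex of \<open>B j \<inter> X t\<close> for
  every \<open>j\<close> shows that a conflict-free set inside such a bag has at most \<open>k\<close> elements. A maximum weight
  conflict-free set is therefore found by dynamic programming over the at most \<open>(|J| + 1) ^ k\<close>
  subsets of \<open>J\<close> with at most \<open>k\<close> elements: bags are eliminated in reverse search order, each
  sending to its parent the best value for every trace on the parent.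
\<close>

section \<open>Programs with time bounds\<close>

text \<open>Two obstacles shape the construction. The machine can neither multiply nor divide, so
  two-dimensional arrays are addressed through tables of multiples built by repeated addition, and
  decoding the number of a subset needs a table of quotients. The time bound leaves about
  \<open>|J|^2 * |V(G)|\<close> steps per bag and subset, in general too few to compare a subset
  with every subset in the parent bag. A message is therefore stored at an address computed from its
  trace, with one power of two as a tag for the bag and a sum of powers of two as a code of the
  trace. Such addresses are exponentially large, but an access costs one step and the array is never
  traversed, so its size does not matter.\<close>

abbreviation "n0 \<equiv> NConst 0"

abbreviation "n1 \<equiv> NConst 1"

abbreviation setn :: "state \<Rightarrow> string \<Rightarrow> nat \<Rightarrow> state" where
  "setn s x i \<equiv> s\<lparr>nvar := (nvar s)(x := i)\<rparr>"

text \<open>Termination is part of the claim. As \<open>exec\<close> is deterministic, the run that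
  exists is the only one, so the existential form loses nothing.\<close>

definition runs :: "com \<Rightarrow> state \<Rightarrow> nat \<Rightarrow> (state \<Rightarrow> bool) \<Rightarrow> bool" where
  "runs c s t Q \<longleftrightarrow> (\<exists>t' s'. exec c s t' s' \<and> t' \<le> t \<and> Q s')"

fun nvars_of :: "com \<Rightarrow> string set" where
  "nvars_of (NAssign x e) = {x}"
| "nvars_of (Seq c1 c2) = nvars_of c1 \<union> nvars_of c2"
| "nvars_of (Cond b c1 c2) = nvars_of c1 \<union> nvars_of c2"
| "nvars_of (While b c) = nvars_of c"
| "nvars_of _ = {}"

fun narrs_of :: "com \<Rightarrow> string set" where
  "narrs_of (NStore a i e) = {a}"
| "narrs_of (Seq c1 c2) = narrs_of c1 \<union> narrs_of c2"
| "narrs_of (Cond b c1 c2) = narrs_of c1 \<union> narrs_of c2"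
| "narrs_of (While b c) = narrs_of c"
| "narrs_of _ = {}"

fun wvars_of :: "com \<Rightarrow> string set" where
  "wvars_of (WAssign x e) = {x}"
| "wvars_of (Seq c1 c2) = wvars_of c1 \<union> wvars_of c2"
| "wvars_of (Cond b c1 c2) = wvars_of c1 \<union> wvars_of c2"
| "wvars_of (While b c) = wvars_of c"
| "wvars_of _ = {}"

fun warrs_of :: "com \<Rightarrow> string set" where
  "warrs_of (WStore a i e) = {a}"
| "warrs_of (Seq c1 c2) = warrs_of c1 \<union> warrs_of c2"
| "warrs_of (Cond b c1 c2) = warrs_of c1 \<union> warrs_of c2"
| "warrs_of (While b c) = warrs_of c"
| "warrs_of _ = {}"

text \<open>Packs the four write sets so that one equation per program, split by
  \<open>prod.inject\<close>, yields four simplification rules at once.\<close>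

definition mods :: "com \<Rightarrow> string set \<times> string set \<times> string set \<times> string set" where
  "mods c = (nvars_of c, narrs_of c, wvars_of c, warrs_of c)"

definition framed :: "com \<Rightarrow> state \<Rightarrow> state \<Rightarrow> bool" where
  "framed c s s' \<longleftrightarrow>
     (\<forall>x. x \<notin> nvars_of c \<longrightarrow> nvar s' x = nvar s x) \<and>
     (\<forall>a. a \<notin> narrs_of c \<longrightarrow> narr s' a = narr s a) \<and>
     (\<forall>x. x \<notin> wvars_of c \<longrightarrow> wvar s' x = wvar s x) \<and>
     (\<forall>a. a \<notin> warrs_of c \<longrightarrow> warr s' a = warr s a)"

lemma framed_refl: "framed c s s"
  by (simp add: framed_def)

lemma framed_trans: "framed c s s' \<Longrightarrow> framed c s' s'' \<Longrightarrow> framed c s s''"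
  by (simp add: framed_def)

lemma exec_framed: "exec c s t s' \<Longrightarrow> framed c s s'"
  by (induction rule: exec.induct) (auto simp: framed_def)

text \<open>The consequence rule also hands out \<open>framed c s s'\<close>. Postconditions thus
  describe only what a program computes; what it leaves alone follows from the syntactic write
  sets.\<close>

lemma runs_mono:
  assumes "runs c s t Q" "t \<le> t'" "\<And>s'. framed c s s' \<Longrightarrow> Q s' \<Longrightarrow> Q' s'"
  shows "runs c s t' Q'"
  using assms unfolding runs_def by (meson exec_framed le_trans)

lemma runs_Skip: "Q s \<Longrightarrow> 1 \<le> t \<Longrightarrow> runs Skip s t Q"
  unfolding runs_def using exec.Skip by blast

lemma runs_NAssign:
  "Q (setn s x (nval e s)) \<Longrightarrow> 1 \<le> t \<Longrightarrow> runs (NAssign x e) s t Q"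
  unfolding runs_def using exec.NAssign by blast

lemma runs_NStore:
  "Q (s\<lparr>narr := (narr s)(a := (narr s a)(nval i s := nval e s))\<rparr>) \<Longrightarrow> 1 \<le> t \<Longrightarrow>
   runs (NStore a i e) s t Q"
  unfolding runs_def using exec.NStore by blast

lemma runs_WAssign:
  "Q (s\<lparr>wvar := (wvar s)(x := wval e s)\<rparr>) \<Longrightarrow> 1 \<le> t \<Longrightarrow> runs (WAssign x e) s t Q"
  unfolding runs_def using exec.WAssign by blast

lemma runs_WStore:
  "Q (s\<lparr>warr := (warr s)(a := (warr s a)(nval i s := wval e s))\<rparr>) \<Longrightarrow> 1 \<le> t \<Longrightarrow>
   runs (WStore a i e) s t Q"
  unfolding runs_def using exec.WStore by blast

lemma runs_Seq:
  assumes "runs c1 s t1 R" "\<And>s1. framed c1 s s1 \<Longrightarrow> R s1 \<Longrightarrow> runs c2 s1 t2 Q" "t1 + t2 \<le> t"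
  shows "runs (Seq c1 c2) s t Q"
proof -
  from assms(1) obtain u1 s1 where 1: "exec c1 s u1 s1" "u1 \<le> t1" "R s1"
    unfolding runs_def by blast
  with assms(2) exec_framed obtain u2 s2 where 2: "exec c2 s1 u2 s2" "u2 \<le> t2" "Q s2"
    unfolding runs_def by blast
  from exec.Seq[OF 1(1) 2(1)] 1 2 assms(3) show ?thesis
    unfolding runs_def by (meson add_mono le_trans)
qed

lemma runs_Cond:
  assumes "bval b s \<Longrightarrow> runs c1 s u Q" "\<not> bval b s \<Longrightarrow> runs c2 s u Q" "1 + u \<le> t"
  shows "runs (Cond b c1 c2) s t Q"
proof (cases "bval b s")
  case True
  with assms(1) obtain u1 s1 where 1: "exec c1 s u1 s1" "u1 \<le> u" "Q s1"
    unfolding runs_def by blast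
  with exec.CondTrue[OF True 1(1)] show ?thesis
    unfolding runs_def using assms(3) by fastforce
next
  case False
  with assms(2) obtain u1 s1 where 1: "exec c2 s u1 s1" "u1 \<le> u" "Q s1"
    unfolding runs_def by blast
  with exec.CondFalse[OF False 1(1)] show ?thesis
    unfolding runs_def using assms(3) by fastforce
qed

text \<open>\<open>P\<close> is a potential: an iteration may cost any \<open>u\<close> as long as
  \<open>P\<close> drops by \<open>u\<close> plus one for the test, so iterations of uneven cost are
  charged individually. The final \<open>+ 1\<close> is the failing test. The amortised analysis of
  the tree search rests on this freedom.\<close>

lemma runs_While:
  fixes P :: "state \<Rightarrow> nat"
  assumes "I s"
    and body: "\<And>s'. I s' \<Longrightarrow> framed c s s' \<Longrightarrow> bval b s' \<Longrightarrow>
      \<exists>u. runs c s' u (\<lambda>s''. I s'' \<and> P s'' + u + 1 \<le> P s')"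
  shows "runs (While b c) s (P s + 1) (\<lambda>s'. I s' \<and> \<not> bval b s')"
proof -
  have "runs (While b c) s' (P s' + 1) (\<lambda>s'. I s' \<and> \<not> bval b s')"
    if "I s'" "framed c s s'" for s'
    using that
  proof (induction "P s'" arbitrary: s' rule: less_induct)
    case less
    show ?case
    proof (cases "bval b s'")
      case True
      from body[OF less.prems True] obtain u u1 s1
        where 1: "exec c s' u1 s1" "u1 \<le> u" "I s1" "P s1 + u + 1 \<le> P s'"
        unfolding runs_def by blast
      have "framed c s s1"
        using less.prems(2) exec_framed[OF 1(1)] by (rule framed_trans)
      with less.hyps[of s1] 1 obtain u2 s2
        where 2: "exec (While b c) s1 u2 s2" "u2 \<le> P s1 + 1" "I s2" "\<not> bval b s2"
        unfolding runs_def by auto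
      from exec.WhileTrue[OF True 1(1) 2(1)] 1 2 show ?thesis
        unfolding runs_def by fastforce
    next
      case False
      from exec.WhileFalse[OF False] less.prems False show ?thesis
        unfolding runs_def by fastforce
    qed
  qed
  from this[OF assms(1) framed_refl] show ?thesis .
qed

section \<open>Counting loops and the tables they fill\<close>

definition For :: "string \<Rightarrow> nexp \<Rightarrow> nexp \<Rightarrow> com \<Rightarrow> com" where
  "For x lo hi c = Seq (NAssign x lo)
     (While (NLess (NVar x) hi) (Seq c (NAssign x (NPlus (NVar x) n1))))"

lemma mods_For [unfolded mods_def prod.inject, simp]:
  "mods (For x lo hi c) = (insert x (nvars_of c), narrs_of c, wvars_of c, warrs_of c)"
  by (auto simp: mods_def For_def)

text \<open>The bound \<open>hi\<close> is evaluated again before each iteration, so it has to keep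
  the value \<open>h\<close> along the loop. An iteration costs \<open>u\<close> plus increment and
  test; the remaining 2 are the initial assignment and the last test.\<close>

lemma runs_For:
  assumes lo: "nval lo s = l" and lh: "l \<le> h"
    and init: "I l (setn s x l)"
    and x: "x \<notin> nvars_of c"
    and hi: "\<And>i s'. I i s' \<Longrightarrow> nvar s' x = i \<Longrightarrow> framed (For x lo hi c) s s' \<Longrightarrow> nval hi s' = h"
    and body: "\<And>i s'. l \<le> i \<Longrightarrow> i < h \<Longrightarrow> I i s' \<Longrightarrow> nvar s' x = i \<Longrightarrow>
        framed (For x lo hi c) s s' \<Longrightarrow>
        runs c s' u (\<lambda>s''. I (Suc i) (setn s'' x (Suc i)))"
    and t: "(h - l) * (u + 2) + 2 \<le> t"
  shows "runs (For x lo hi c) s t (I h)"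
proof -
  let ?F = "For x lo hi c"
  let ?s = "setn s x l"
  let ?b = "NLess (NVar x) hi"
  let ?c = "Seq c (NAssign x (NPlus (NVar x) n1))"
  let ?I = "\<lambda>s'. \<exists>i. l \<le> i \<and> i \<le> h \<and> I i s' \<and> nvar s' x = i \<and> framed ?F s s'"
  let ?P = "\<lambda>s'. (h - nvar s' x) * (u + 2)"
  have "runs (While ?b ?c) ?s (?P ?s + 1) (\<lambda>s'. ?I s' \<and> \<not> bval ?b s')"
  proof (rule runs_While)
    show "?I ?s" using lh init by (auto simp: framed_def)
  next
    fix s' assume "?I s'" "bval ?b s'"
    then obtain i where i: "l \<le> i" "i \<le> h" "I i s'" "nvar s' x = i" "framed ?F s s'" by blast
    from hi[OF i(3-5)] \<open>bval ?b s'\<close> i(4) have "i < h" by simp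
    have "runs ?c s' (u + 1) (\<lambda>s''. ?I s'' \<and> ?P s'' + (u + 1) + 1 \<le> ?P s')"
    proof (rule runs_Seq[OF body[OF i(1) \<open>i < h\<close> i(3-5)]])
      fix s1 assume s1: "framed c s' s1" "I (Suc i) (setn s1 x (Suc i))"
      from s1(1) x i(4) have "nvar s1 x = i" by (simp add: framed_def)
      moreover have "h - i = Suc (h - Suc i)" using \<open>i < h\<close> by simp
      ultimately show "runs (NAssign x (NPlus (NVar x) n1)) s1 1
          (\<lambda>s''. ?I s'' \<and> ?P s'' + (u + 1) + 1 \<le> ?P s')"
        using s1 i \<open>i < h\<close>
        by (intro runs_NAssign) (auto simp: framed_def intro!: exI[of _ "Suc i"])
    qed simp
    then show "\<exists>u. runs ?c s' u (\<lambda>s''. ?I s'' \<and> ?P s'' + u + 1 \<le> ?P s')" by blast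
  qed
  then have "runs (While ?b ?c) ?s ((h - l) * (u + 2) + 1) (I h)"
  proof (rule runs_mono)
    fix s' assume "?I s' \<and> \<not> bval ?b s'"
    then obtain i where i: "l \<le> i" "i \<le> h" "I i s'" "nvar s' x = i" "framed ?F s s'"
      "\<not> bval ?b s'" by blast
    from hi[OF i(3-5)] i have "i = h" by simp
    with i show "I h s'" by simp
  qed simp
  then show ?thesis unfolding For_def
    using t lo by (intro runs_Seq[OF runs_NAssign[where Q = "\<lambda>s'. s' = ?s"]]) auto
qed

definition SumL :: "nexp \<Rightarrow> nexp \<Rightarrow> nexp \<Rightarrow> bexp \<Rightarrow> nexp \<Rightarrow> com" where
  "SumL init lo hi b e = Seq (NAssign ''acc'' init)
     (For ''z'' lo hi (Cond b (NAssign ''acc'' (NPlus (NVar ''acc'') e)) Skip))"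

lemma mods_SumL [unfolded mods_def prod.inject, simp]:
  "mods (SumL init lo hi b e) = ({''acc'', ''z''}, {}, {}, {})"
  by (auto simp: mods_def SumL_def)

text \<open>A variant of \<open>framed\<close> relative to explicit sets of names instead of a
  program. It lets the rules for loops state what expressions evaluate to without mentioning the
  loop itself.\<close>

definition eq_off :: "string set \<Rightarrow> string set \<Rightarrow> string set \<Rightarrow> string set \<Rightarrow> state \<Rightarrow> state \<Rightarrow> bool" where
  "eq_off X A Y B s s' \<longleftrightarrow>
     (\<forall>x. x \<notin> X \<longrightarrow> nvar s' x = nvar s x) \<and> (\<forall>a. a \<notin> A \<longrightarrow> narr s' a = narr s a) \<and>
     (\<forall>x. x \<notin> Y \<longrightarrow> wvar s' x = wvar s x) \<and> (\<forall>a. a \<notin> B \<longrightarrow> warr s' a = warr s a)"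

lemma runs_SumL:
  assumes "nval init s = v"
    and ev: "\<And>s'. eq_off {''acc'', ''z''} {} {} {} s s' \<Longrightarrow> nval hi s' = h"
      "\<And>s'. eq_off {''acc'', ''z''} {} {} {} s s' \<Longrightarrow> nval lo s' = l"
      "\<And>s'. eq_off {''acc'', ''z''} {} {} {} s s' \<Longrightarrow> l \<le> nvar s' ''z'' \<Longrightarrow> nvar s' ''z'' < h \<Longrightarrow>
          bval b s' = P (nvar s' ''z'')"
      "\<And>s'. eq_off {''acc'', ''z''} {} {} {} s s' \<Longrightarrow> l \<le> nvar s' ''z'' \<Longrightarrow> nvar s' ''z'' < h \<Longrightarrow>
          P (nvar s' ''z'') \<Longrightarrow> nval e s' = f (nvar s' ''z'')"
    and "l \<le> h" "(h - l) * 4 + 3 \<le> t"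
  shows "runs (SumL init lo hi b e) s t
    (\<lambda>s'. nvar s' ''acc'' = v + (\<Sum>z\<in>{l..<h}. if P z then f z else 0))"
  unfolding SumL_def
proof (rule runs_Seq[where R = "\<lambda>s'. s' = setn s ''acc'' v"])
  show "runs (NAssign ''acc'' init) s 1 (\<lambda>s'. s' = setn s ''acc'' v)"
    using assms(1) by (intro runs_NAssign) auto
  show "1 + ((h - l) * 4 + 2) \<le> t" using assms(7) by simp
  fix s1 assume s1: "s1 = setn s ''acc'' v"
  let ?F = "For ''z'' lo hi (Cond b (NAssign ''acc'' (NPlus (NVar ''acc'') e)) Skip)"
  have eq: "eq_off {''acc'', ''z''} {} {} {} s s'" if "framed ?F s1 s'" for s'
    using that s1 by (simp add: framed_def eq_off_def)
  show "runs ?F s1 ((h - l) * 4 + 2)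
      (\<lambda>s'. nvar s' ''acc'' = v + (\<Sum>z\<in>{l..<h}. if P z then f z else 0))"
  proof (rule runs_For[where u = 2 and l = l and h = h and
        I = "\<lambda>i s'. nvar s' ''acc'' = v + (\<Sum>z\<in>{l..<i}. if P z then f z else 0)"])
    show "nval lo s1 = l" using ev(2)[of s1] s1 by (simp add: eq_off_def)
  next
    fix i s' assume "framed ?F s1 s'"
    then show "nval hi s' = h" using ev(1) eq by blast
  next
    fix i s' assume i: "l \<le> i" "i < h" and z: "nvar s' ''z'' = i" and "framed ?F s1 s'"
      and acc: "nvar s' ''acc'' = v + (\<Sum>z\<in>{l..<i}. if P z then f z else 0)"
    note eq = eq[OF \<open>framed ?F s1 s'\<close>]
    have b: "bval b s' = P i" using ev(3)[OF eq] i z by simp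
    have e: "P i \<Longrightarrow> nval e s' = f i" using ev(4)[OF eq] i z by simp
    show "runs (Cond b (NAssign ''acc'' (NPlus (NVar ''acc'') e)) Skip) s' 2
       (\<lambda>s''. nvar (setn s'' ''z'' (Suc i)) ''acc''
            = v + (\<Sum>z\<in>{l..<Suc i}. if P z then f z else 0))"
      by (rule runs_Cond[where u = 1]; (rule runs_NAssign runs_Skip)?) (use i b e acc in auto)
  qed (use assms s1 in auto)
qed

lemma row_col_inj:
  fixes i j i' j' C :: nat
  assumes "i * C + j = i' * C + j'" "j < C" "j' < C"
  shows "i = i' \<and> j = j'"
proof -
  have "(i * C + j) div C = i" "(i' * C + j') div C = i'" using assms(2,3) by auto
  with assms(1) have "i = i'" by metis
  with assms(1) show ?thesis by simp
qed

definition Grid :: "nexp \<Rightarrow> nexp \<Rightarrow> com \<Rightarrow> com" where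
  "Grid rows cols c = For ''x'' n0 rows (For ''y'' n0 cols c)"

lemma mods_Grid [unfolded mods_def prod.inject, simp]:
  "mods (Grid rows cols c) = ({''x'', ''y''} \<union> nvars_of c, narrs_of c, wvars_of c, warrs_of c)"
  by (auto simp: mods_def Grid_def)

text \<open>\<open>get\<close> stands for one array of either sort, so numbers and weights share the
  rule. The row stride \<open>D\<close> may exceed the number \<open>C\<close> of columns;
  \<open>C \<le> D\<close> keeps the cells of different rows apart.\<close>

lemma runs_Grid:
  fixes get :: "state \<Rightarrow> nat \<Rightarrow> 'v"
  assumes get: "\<And>s f. get (s\<lparr>nvar := f\<rparr>) = get s"
    and xy: "''x'' \<notin> nvars_of c" "''y'' \<notin> nvars_of c"
    and rows: "\<And>s'. framed (Grid rows cols c) s s' \<Longrightarrow> nval rows s' = R"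
    and cols: "\<And>s'. framed (Grid rows cols c) s s' \<Longrightarrow> nval cols s' = C"
    and cell: "\<And>s' i j. framed (Grid rows cols c) s s' \<Longrightarrow> nvar s' ''x'' = i \<Longrightarrow> nvar s' ''y'' = j \<Longrightarrow>
          i < R \<Longrightarrow> j < C \<Longrightarrow> runs c s' u (\<lambda>s''. get s'' = (get s')(i * D + j := val i j))"
    and "C \<le> D" and t: "R * (C * (u + 2) + 4) + 2 \<le> t"
  shows "runs (Grid rows cols c) s t (\<lambda>s'. \<forall>i<R. \<forall>j<C. get s' (i * D + j) = val i j)"
  unfolding Grid_def
proof (rule runs_For[where l = 0 and h = R and u = "C * (u + 2) + 2" and
      I = "\<lambda>r s'. \<forall>i<r. \<forall>j<C. get s' (i * D + j) = val i j"])
  let ?G = "For ''x'' n0 rows (For ''y'' n0 cols c)"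
  let ?F = "For ''y'' n0 cols c"
  show "\<And>i s'. framed ?G s s' \<Longrightarrow> nval rows s' = R"
    using rows by (simp add: Grid_def)
  fix i s' assume i: "i < R" and x: "nvar s' ''x'' = i" and fr: "framed ?G s s'"
    and IH: "\<forall>i'<i. \<forall>j<C. get s' (i' * D + j) = val i' j"
  have fr': "framed (Grid rows cols c) s s''" if "framed ?F s' s''" for s''
    using fr that by (simp add: framed_def Grid_def)
  have "runs ?F s' (C * (u + 2) + 2) (\<lambda>s''. (\<forall>j<C. get s'' (i * D + j) = val i j) \<and>
      (\<forall>i'<i. \<forall>j<C. get s'' (i' * D + j) = val i' j))"
  proof (rule runs_For[where l = 0 and h = C and u = u and
        I = "\<lambda>q s''. (\<forall>j<q. get s'' (i * D + j) = val i j) \<and>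
          (\<forall>i'<i. \<forall>j<C. get s'' (i' * D + j) = val i' j)"])
    show "\<And>i s''. framed ?F s' s'' \<Longrightarrow> nval cols s'' = C"
      using cols fr' by blast
    fix j s1 assume j: "j < C" and y: "nvar s1 ''y'' = j" and fr1: "framed ?F s' s1"
      and IH1: "(\<forall>j'<j. get s1 (i * D + j') = val i j') \<and> (\<forall>i'<i. \<forall>j'<C. get s1 (i' * D + j') = val i' j')"
    have x1: "nvar s1 ''x'' = i" using fr1 x xy by (simp add: framed_def)
    have ne: "i' * D + j' \<noteq> i * D + j" if "i' < i" "j' < C" for i' j'
      using row_col_inj[of i D j i' j'] that j \<open>C \<le> D\<close> by auto
    show "runs c s1 u (\<lambda>s''. (\<forall>j'<Suc j. get (setn s'' ''y'' (Suc j)) (i * D + j') = val i j') \<and>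
        (\<forall>i'<i. \<forall>j'<C. get (setn s'' ''y'' (Suc j)) (i' * D + j') = val i' j'))"
      by (rule runs_mono[OF cell[OF fr'[OF fr1] x1 y i j] order.refl])
        (use IH1 ne in \<open>auto simp: get less_Suc_eq\<close>)
  qed (use IH xy in \<open>simp_all add: get\<close>)
  then show "runs ?F s' (C * (u + 2) + 2)
      (\<lambda>s''. \<forall>i'<Suc i. \<forall>j<C. get (setn s'' ''x'' (Suc i)) (i' * D + j) = val i' j)"
    by (rule runs_mono) (auto simp: get less_Suc_eq)
qed (use xy t in \<open>simp_all add: algebra_simps\<close>)

text \<open>\<open>Tab\<close> fills the cells \<open>base x + y\<close> of an array with sums over a third index \<open>z\<close>; with
  \<open>e = NConst 1\<close> a cell is positive iff the condition \<open>b\<close> holds for some \<open>z\<close>.\<close>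

definition Tab :: "string \<Rightarrow> string \<Rightarrow> nexp \<Rightarrow> nexp \<Rightarrow> nexp \<Rightarrow> nexp \<Rightarrow> nexp \<Rightarrow> bexp \<Rightarrow> nexp \<Rightarrow> com" where
  "Tab A base rows cols init lo hi b e =
     Grid rows cols (Seq (SumL init lo hi b e)
         (NStore A (NPlus (NArr base (NVar ''x'')) (NVar ''y'')) (NVar ''acc'')))"

lemma mods_Tab [unfolded mods_def prod.inject, simp]:
  "mods (Tab A base rows cols init lo hi b e) = ({''x'', ''y'', ''z'', ''acc''}, {A}, {}, {})"
  by (auto simp: mods_def Tab_def)

abbreviation tab_eq :: "string \<Rightarrow> state \<Rightarrow> state \<Rightarrow> bool" where
  "tab_eq A \<equiv> eq_off {''x'', ''y'', ''z'', ''acc''} {A} {} {}"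

text \<open>\<open>base\<close> has to hold the multiples of \<open>D\<close>, since an expression
  cannot form \<open>i * D\<close>. \<open>L\<close> bounds the inner range uniformly; each inner
  index costs 4: loop test, conditional, its branch, increment.\<close>

lemma runs_Tab:
  assumes rows: "\<And>s'. tab_eq A s s' \<Longrightarrow> nval rows s' = R"
    and cols: "\<And>s'. tab_eq A s s' \<Longrightarrow> nval cols s' = C"
    and base: "\<And>i. i < R \<Longrightarrow> narr s base i = i * D" "base \<noteq> A" "C \<le> D"
    and cell: "\<And>s' i j. tab_eq A s s' \<Longrightarrow> nvar s' ''x'' = i \<Longrightarrow> nvar s' ''y'' = j \<Longrightarrow> i < R \<Longrightarrow> j < C \<Longrightarrow>
          nval init s' = v i j \<and> nval lo s' = l i j \<and> nval hi s' = h i j"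
    and cond: "\<And>s' i j z. tab_eq A s s' \<Longrightarrow> nvar s' ''x'' = i \<Longrightarrow> nvar s' ''y'' = j \<Longrightarrow> i < R \<Longrightarrow> j < C \<Longrightarrow>
          nvar s' ''z'' = z \<Longrightarrow> l i j \<le> z \<Longrightarrow> z < h i j \<Longrightarrow>
          bval b s' = P i j z \<and> (P i j z \<longrightarrow> nval e s' = f i j z)"
    and lh: "\<And>i j. i < R \<Longrightarrow> j < C \<Longrightarrow> l i j \<le> h i j \<and> h i j - l i j \<le> L"
    and t: "R * (C * (L * 4 + 6) + 4) + 2 \<le> t"
  shows "runs (Tab A base rows cols init lo hi b e) s t
    (\<lambda>s'. \<forall>i<R. \<forall>j<C. narr s' A (i * D + j)
        = v i j + (\<Sum>z\<in>{l i j..<h i j}. if P i j z then f i j z else 0))"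
  unfolding Tab_def
proof (rule runs_Grid[where get = "\<lambda>s. narr s A" and R = R and C = C and D = D and u = "L * 4 + 4"])
  let ?V = "\<lambda>i j. v i j + (\<Sum>z\<in>{l i j..<h i j}. if P i j z then f i j z else 0)"
  let ?B = "Seq (SumL init lo hi b e)
         (NStore A (NPlus (NArr base (NVar ''x'')) (NVar ''y'')) (NVar ''acc''))"
  have eq: "tab_eq A s s'" if "framed (Grid rows cols ?B) s s'" for s'
    using that by (simp add: framed_def eq_off_def)
  show "\<And>s'. framed (Grid rows cols ?B) s s' \<Longrightarrow> nval rows s' = R"
    "\<And>s'. framed (Grid rows cols ?B) s s' \<Longrightarrow> nval cols s' = C"
    using eq rows cols by blast+
  fix s1 i j assume x1: "nvar s1 ''x'' = i" "nvar s1 ''y'' = j" and ij: "i < R" "j < C"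
    and fr: "framed (Grid rows cols ?B) s s1"
  note eq1 = eq[OF fr]
  note c1 = cell[OF eq1 x1 ij]
  show "runs ?B s1 (L * 4 + 4) (\<lambda>s''. narr s'' A = (narr s1 A)(i * D + j := ?V i j))"
  proof (rule runs_Seq[OF runs_SumL[where h = "h i j" and l = "l i j" and P = "P i j"
        and f = "f i j" and v = "v i j" and t = "L * 4 + 3"]])
    show "nval init s1 = v i j" using c1 by simp
    fix s2 assume eq2: "eq_off {''acc'', ''z''} {} {} {} s1 s2"
    then have e2: "tab_eq A s s2" using eq1 by (simp add: eq_off_def)
    have x2: "nvar s2 ''x'' = i" "nvar s2 ''y'' = j" using eq2 x1 by (simp_all add: eq_off_def)
    show "nval hi s2 = h i j" "nval lo s2 = l i j"
      using cell[OF e2 x2 ij] by simp_all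
    assume z: "l i j \<le> nvar s2 ''z''" "nvar s2 ''z'' < h i j"
    show "bval b s2 = P i j (nvar s2 ''z'')"
      using cond[OF e2 x2 ij refl z] by simp
    assume "P i j (nvar s2 ''z'')"
    then show "nval e s2 = f i j (nvar s2 ''z'')"
      using cond[OF e2 x2 ij refl z] by simp
  next
    show "l i j \<le> h i j" using lh[OF ij] by simp
    show "(h i j - l i j) * 4 + 3 \<le> L * 4 + 3" using lh[OF ij] by simp
    show "L * 4 + 3 + 1 \<le> L * 4 + 4" by simp
  next
    fix s2 assume fr2: "framed (SumL init lo hi b e) s1 s2" and acc: "nvar s2 ''acc'' = ?V i j"
    have n2: "narr s2 = narr s1" "nvar s2 ''x'' = i" "nvar s2 ''y'' = j"
      using fr2 x1 by (auto simp: framed_def)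
    have "narr s1 base = narr s base" using eq1 base by (simp add: eq_off_def)
    then have "narr s1 base i = i * D" using base ij by simp
    then show "runs (NStore A (NPlus (NArr base (NVar ''x'')) (NVar ''y'')) (NVar ''acc'')) s2 1
        (\<lambda>s''. narr s'' A = (narr s1 A)(i * D + j := ?V i j))"
      using n2 acc by (intro runs_NStore) auto
  qed
qed (use t base in \<open>simp_all add: algebra_simps\<close>)

lemma sum_indicator_pos:
  fixes h :: nat
  shows "0 < (\<Sum>z = l..<h. if P z then 1 else 0 :: nat) \<longleftrightarrow>
      (\<exists>z. l \<le> z \<and> z < h \<and> P z)" (is "0 < ?S \<longleftrightarrow> _")
proof
  assume "0 < ?S"
  then have "?S \<noteq> 0" by (rule less_imp_neq[symmetric])
  then obtain z where z: "z \<in> {l..<h}" "(if P z then 1 else 0 :: nat) \<noteq> 0"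
    by (rule sum.not_neutral_contains_not_neutral)
  have "P z" by (rule ccontr) (use z(2) in simp)
  with z(1) show "\<exists>z. l \<le> z \<and> z < h \<and> P z" by (intro exI[of _ z]) simp
next
  assume "\<exists>z. l \<le> z \<and> z < h \<and> P z"
  then obtain z where "z \<in> {l..<h}" "P z" by auto
  then have "(if P z then 1 else 0) \<le> ?S"
    by (intro member_le_sum) simp_all
  with \<open>P z\<close> show "0 < ?S" by simp
qed

text \<open>Truth is stored as positivity: a cell counts witnesses, and the initial value
  \<open>v i j\<close> acts as a further disjunct. Predicates are tabulated in this existential
  shape, which is why dependence and non-inclusion of subsets are stored below rather than their
  negations.\<close>

lemma runs_Tab_ex:
  assumes rows: "\<And>s'. tab_eq A s s' \<Longrightarrow> nval rows s' = R"
    and cols: "\<And>s'. tab_eq A s s' \<Longrightarrow> nval cols s' = C"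
    and base: "\<And>i. i < R \<Longrightarrow> narr s base i = i * D" "base \<noteq> A" "C \<le> D"
    and cell: "\<And>s' i j. tab_eq A s s' \<Longrightarrow> nvar s' ''x'' = i \<Longrightarrow> nvar s' ''y'' = j \<Longrightarrow> i < R \<Longrightarrow> j < C \<Longrightarrow>
          nval init s' = v i j \<and> nval lo s' = l i j \<and> nval hi s' = h i j"
    and cond: "\<And>s' i j z. tab_eq A s s' \<Longrightarrow> nvar s' ''x'' = i \<Longrightarrow> nvar s' ''y'' = j \<Longrightarrow> i < R \<Longrightarrow> j < C \<Longrightarrow>
          nvar s' ''z'' = z \<Longrightarrow> l i j \<le> z \<Longrightarrow> z < h i j \<Longrightarrow> bval b s' = P i j z"
    and lh: "\<And>i j. i < R \<Longrightarrow> j < C \<Longrightarrow> l i j \<le> h i j \<and> h i j - l i j \<le> L"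
    and t: "R * (C * (L * 4 + 6) + 4) + 2 \<le> t"
  shows "runs (Tab A base rows cols init lo hi b n1) s t
    (\<lambda>s'. \<forall>i<R. \<forall>j<C. 0 < narr s' A (i * D + j) \<longleftrightarrow>
        0 < v i j \<or> (\<exists>z. l i j \<le> z \<and> z < h i j \<and> P i j z))"
proof -
  have "runs (Tab A base rows cols init lo hi b n1) s t
    (\<lambda>s'. \<forall>i<R. \<forall>j<C. narr s' A (i * D + j) =
      v i j + (\<Sum>z = l i j..<h i j. if P i j z then 1 else 0))"
    by (rule runs_Tab[OF rows cols base cell _ lh t]; (assumption | rule conjI cond impI nval.simps)+)
  then show ?thesis
  proof (rule runs_mono[OF _ order.refl], intro allI impI)
    fix s' i j
    assume "\<forall>i<R. \<forall>j<C. narr s' A (i * D + j) =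
      v i j + (\<Sum>z = l i j..<h i j. if P i j z then 1 else 0)" "i < R" "j < C"
    then have "narr s' A (i * D + j) = v i j + (\<Sum>z = l i j..<h i j. if P i j z then 1 else 0)"
      by blast
    then show "0 < narr s' A (i * D + j) \<longleftrightarrow>
        0 < v i j \<or> (\<exists>z. l i j \<le> z \<and> z < h i j \<and> P i j z)"
      by (simp only: add_gr_0 sum_indicator_pos)
  qed
qed

text \<open>Supplies the missing arithmetic: with a suitable step \<open>e\<close> it produces
  multiples, powers of two and, given a table of multiples, quotients.\<close>

definition IterTab :: "string \<Rightarrow> nexp \<Rightarrow> nexp \<Rightarrow> nexp \<Rightarrow> com" where
  "IterTab A init cnt e = Seq (NAssign ''acc'' init)
     (For ''x'' n0 cnt (Seq (NStore A (NVar ''x'') (NVar ''acc'')) (NAssign ''acc'' e)))"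

lemma mods_IterTab [unfolded mods_def prod.inject, simp]:
  "mods (IterTab A init cnt e) = ({''x'', ''acc''}, {A}, {}, {})"
  by (auto simp: mods_def IterTab_def)

lemma runs_IterTab:
  assumes "nval init s = f 0"
    and cnt: "\<And>s'. eq_off {''x'', ''acc''} {A} {} {} s s' \<Longrightarrow> nval cnt s' = n"
    and e: "\<And>s' i. eq_off {''x'', ''acc''} {A} {} {} s s' \<Longrightarrow> nvar s' ''x'' = i \<Longrightarrow> i < n \<Longrightarrow>
        nvar s' ''acc'' = f i \<Longrightarrow> nval e s' = f (Suc i)"
    and t: "n * 4 + 3 \<le> t"
  shows "runs (IterTab A init cnt e) s t (\<lambda>s'. \<forall>i<n. narr s' A i = f i)"
  unfolding IterTab_def
proof (rule runs_Seq[where R = "\<lambda>s'. s' = setn s ''acc'' (f 0)"])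
  show "runs (NAssign ''acc'' init) s 1 (\<lambda>s'. s' = setn s ''acc'' (f 0))"
    using assms(1) by (intro runs_NAssign) auto
  show "1 + (n * 4 + 2) \<le> t" using t by simp
  fix s1 assume s1: "s1 = setn s ''acc'' (f 0)"
  let ?B = "Seq (NStore A (NVar ''x'') (NVar ''acc'')) (NAssign ''acc'' e)"
  let ?F = "For ''x'' n0 cnt ?B"
  have eq: "eq_off {''x'', ''acc''} {A} {} {} s s'" if "framed ?F s1 s'" for s'
    using that s1 by (simp add: framed_def eq_off_def)
  show "runs ?F s1 (n * 4 + 2) (\<lambda>s'. \<forall>i<n. narr s' A i = f i)"
  proof (rule runs_mono[OF runs_For[where l = 0 and h = n and u = 2 and
        I = "\<lambda>i s'. nvar s' ''acc'' = f i \<and> (\<forall>l<i. narr s' A l = f l)"] order.refl])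
    fix i s' assume "framed ?F s1 s'"
    then show "nval cnt s' = n" using cnt eq by blast
  next
    fix i s' assume i: "i < n" "nvar s' ''x'' = i" "framed ?F s1 s'"
      and I: "nvar s' ''acc'' = f i \<and> (\<forall>l<i. narr s' A l = f l)"
    let ?s = "s'\<lparr>narr := (narr s')(A := (narr s' A)(i := f i))\<rparr>"
    have eq': "eq_off {''x'', ''acc''} {A} {} {} s ?s" using eq[OF i(3)] by (simp add: eq_off_def)
    have "nval e ?s = f (Suc i)" using e[OF eq', of i] i I by simp
    then show "runs ?B s' 2 (\<lambda>s''. nvar (setn s'' ''x'' (Suc i)) ''acc'' = f (Suc i) \<and>
        (\<forall>l<Suc i. narr (setn s'' ''x'' (Suc i)) A l = f l))"
      using i I by (intro runs_Seq[OF runs_NStore[where Q = "\<lambda>s''. s'' = ?s"] runs_NAssign])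
        (auto simp: less_Suc_eq)
  qed (use s1 in auto)
qed

definition WTab :: "string \<Rightarrow> string \<Rightarrow> nexp \<Rightarrow> nexp \<Rightarrow> nexp \<Rightarrow> bexp \<Rightarrow> wexp \<Rightarrow> com" where
  "WTab A base rows cols hi b e =
     Grid rows cols (Seq (WAssign ''acc'' (WConst 0))
       (Seq (For ''z'' n0 hi (Cond b (WAssign ''acc'' (WPlus (WVar ''acc'') e)) Skip))
         (WStore A (NPlus (NArr base (NVar ''x'')) (NVar ''y'')) (WVar ''acc''))))"

lemma mods_WTab [unfolded mods_def prod.inject, simp]:
  "mods (WTab A base rows cols hi b e) = ({''x'', ''y'', ''z''}, {}, {''acc''}, {A})"
  by (auto simp: mods_def WTab_def)

lemma runs_WTab:
  assumes rows: "\<And>s'. eq_off {''x'', ''y'', ''z''} {} {''acc''} {A} s s' \<Longrightarrow> nval rows s' = R"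
    and cols: "\<And>s'. eq_off {''x'', ''y'', ''z''} {} {''acc''} {A} s s' \<Longrightarrow> nval cols s' = C"
    and hi: "\<And>s'. eq_off {''x'', ''y'', ''z''} {} {''acc''} {A} s s' \<Longrightarrow> nval hi s' = L"
    and base: "\<And>i. i < R \<Longrightarrow> narr s base i = i * D" "C \<le> D"
    and cond: "\<And>s' i j z. eq_off {''x'', ''y'', ''z''} {} {''acc''} {A} s s' \<Longrightarrow>
          nvar s' ''x'' = i \<Longrightarrow> nvar s' ''y'' = j \<Longrightarrow> i < R \<Longrightarrow> j < C \<Longrightarrow>
          nvar s' ''z'' = z \<Longrightarrow> z < L \<Longrightarrow>
          bval b s' = P i j z \<and> wval e s' = f i j z"
    and t: "R * (C * (L * 4 + 6) + 4) + 2 \<le> t"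
  shows "runs (WTab A base rows cols hi b e) s t
    (\<lambda>s'. \<forall>i<R. \<forall>j<C. warr s' A (i * D + j) = (\<Sum>z<L. if P i j z then f i j z else 0))"
  unfolding WTab_def
proof (rule runs_Grid[where get = "\<lambda>s. warr s A" and R = R and C = C and D = D and u = "L * 4 + 4"])
  let ?V = "\<lambda>i j. \<Sum>z<L. if P i j z then f i j z else 0"
  let ?F = "For ''z'' n0 hi (Cond b (WAssign ''acc'' (WPlus (WVar ''acc'') e)) Skip)"
  let ?S = "WStore A (NPlus (NArr base (NVar ''x'')) (NVar ''y'')) (WVar ''acc'')"
  let ?B = "Seq (WAssign ''acc'' (WConst 0)) (Seq ?F ?S)"
  let ?eq = "eq_off {''x'', ''y'', ''z''} {} {''acc''} {A}"
  have eq: "?eq s s'" if "framed (Grid rows cols ?B) s s'" for s'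
    using that by (simp add: framed_def eq_off_def)
  show "\<And>s'. framed (Grid rows cols ?B) s s' \<Longrightarrow> nval rows s' = R"
    "\<And>s'. framed (Grid rows cols ?B) s s' \<Longrightarrow> nval cols s' = C"
    using eq rows cols by blast+
  fix s1 i j assume x1: "nvar s1 ''x'' = i" "nvar s1 ''y'' = j" and ij: "i < R" "j < C"
    and fr: "framed (Grid rows cols ?B) s s1"
  note eq1 = eq[OF fr]
  let ?s = "s1\<lparr>wvar := (wvar s1)(''acc'' := 0)\<rparr>"
  have eqF: "?eq s s2 \<and> nvar s2 ''x'' = i \<and> nvar s2 ''y'' = j \<and> warr s2 = warr s1"
    if "framed ?F ?s s2" for s2
  proof (intro conjI)
    show "?eq s s2" "nvar s2 ''x'' = i" "nvar s2 ''y'' = j"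
      using that eq1 x1 by (simp_all add: framed_def eq_off_def)
    show "warr s2 = warr s1" using that by (simp add: framed_def fun_eq_iff)
  qed
  have F: "runs ?F ?s (L * 4 + 2) (\<lambda>s'. wvar s' ''acc'' = ?V i j)"
  proof (rule runs_For[where u = 2 and l = 0 and h = L and
        I = "\<lambda>q s'. wvar s' ''acc'' = (\<Sum>z<q. if P i j z then f i j z else 0)"])
    fix q s' assume "framed ?F ?s s'"
    then show "nval hi s' = L" using hi eqF by blast
  next
    fix q s' assume q: "q < L" "nvar s' ''z'' = q" "framed ?F ?s s'"
      and acc: "wvar s' ''acc'' = (\<Sum>z<q. if P i j z then f i j z else 0)"
    from eqF[OF q(3)] cond[of s' i j q] q ij have *: "bval b s' = P i j q" "wval e s' = f i j q" by blast+
    show "runs (Cond b (WAssign ''acc'' (WPlus (WVar ''acc'') e)) Skip) s' 2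
       (\<lambda>s''. wvar (setn s'' ''z'' (Suc q)) ''acc''
            = (\<Sum>z<Suc q. if P i j z then f i j z else 0))"
      by (rule runs_Cond[where u = 1]; (rule runs_WAssign runs_Skip)?) (use acc * in auto)
  qed auto
  have S: "runs ?S s2 1 (\<lambda>s''. warr s'' A = (warr s1 A)(i * D + j := ?V i j))"
    if "framed ?F ?s s2" "wvar s2 ''acc'' = ?V i j" for s2
  proof -
    note e2 = eqF[OF that(1)]
    then have "narr s2 base i = i * D" using base ij by (simp add: eq_off_def)
    then show ?thesis using e2 that by (intro runs_WStore) auto
  qed
  show "runs ?B s1 (L * 4 + 4) (\<lambda>s''. warr s'' A = (warr s1 A)(i * D + j := ?V i j))"
  proof (rule runs_Seq[OF runs_WAssign[where Q = "\<lambda>s'. s' = ?s" and t = 1]])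
    fix s2 assume "s2 = ?s"
    with runs_Seq[OF F S, of "L * 4 + 3"] show "runs (Seq ?F ?S) s2 (L * 4 + 3)
        (\<lambda>s''. warr s'' A = (warr s1 A)(i * D + j := ?V i j))"
      by simp
  qed simp_all
qed (use t base in \<open>simp_all add: algebra_simps\<close>)

section \<open>Balls, distances and search orders of trees\<close>

fun nball :: "'a graph \<Rightarrow> 'a set \<Rightarrow> nat \<Rightarrow> 'a set" where
  "nball G A 0 = A"
| "nball G A (Suc r) = nball G A r \<union> {v. \<exists>u\<in>nball G A r. {u, v} \<in> edges G}"

lemma walk_single: "walk G [v] \<longleftrightarrow> v \<in> verts G"
  by (simp add: walk_def)

lemma walk_snoc:
  "p \<noteq> [] \<Longrightarrow> walk G (p @ [v]) \<longleftrightarrow> walk G p \<and> v \<in> verts G \<and> {last p, v} \<in> edges G"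
proof -
  assume p: "p \<noteq> []"
  have "(\<forall>i. Suc i < length (p @ [v]) \<longrightarrow> {(p @ [v]) ! i, (p @ [v]) ! Suc i} \<in> edges G) \<longleftrightarrow>
      (\<forall>i. Suc i < length p \<longrightarrow> {p ! i, p ! Suc i} \<in> edges G) \<and> {last p, v} \<in> edges G"
    (is "?L \<longleftrightarrow> ?R")
  proof
    assume L: ?L
    from L[rule_format, of "length p - 1"] p have "{last p, v} \<in> edges G"
      by (simp add: nth_append last_conv_nth)
    moreover have "{p ! i, p ! Suc i} \<in> edges G" if "Suc i < length p" for i
      using L[rule_format, of i] that by (simp add: nth_append)
    ultimately show ?R by blast
  next
    assume R: ?R
    show ?L
    proof (intro allI impI)
      fix i assume "Suc i < length (p @ [v])"
      then consider "Suc i < length p" | "Suc i = length p" by fastforce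
      then show "{(p @ [v]) ! i, (p @ [v]) ! Suc i} \<in> edges G"
      proof cases
        case 2
        then have "p ! i = last p" using p by (simp add: last_conv_nth flip: 2)
        with 2 R show ?thesis by (auto simp: nth_append)
      qed (use R in \<open>auto simp: nth_append\<close>)
    qed
  qed
  then show ?thesis using p by (auto simp: walk_def)
qed

lemma nball_subset_verts:
  assumes "fin_graph G" "A \<subseteq> verts G"
  shows "nball G A r \<subseteq> verts G"
  using assms by (induction r) (auto simp: fin_graph_def)

lemma nball_self: "A \<subseteq> nball G A r"
  by (induction r) auto

text \<open>Lengths of walks count vertices, hence \<open>Suc r\<close> for at most \<open>r\<close>
  edges. The recursion of \<open>nball\<close> matches appending one vertex at the end of a
  walk.\<close>

lemma nball_iff_walk:
  assumes G: "fin_graph G" and A: "A \<subseteq> verts G"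
  shows "v \<in> nball G A r \<longleftrightarrow> (\<exists>p. walk G p \<and> hd p \<in> A \<and> last p = v \<and> length p \<le> Suc r)"
proof
  assume "v \<in> nball G A r"
  then show "\<exists>p. walk G p \<and> hd p \<in> A \<and> last p = v \<and> length p \<le> Suc r"
  proof (induction r arbitrary: v)
    case 0
    then show ?case using A by (intro exI[of _ "[v]"]) (auto simp: walk_single)
  next
    case (Suc r)
    from Suc.prems consider "v \<in> nball G A r" | u where "u \<in> nball G A r" "{u, v} \<in> edges G" by auto
    then show ?case
    proof cases
      case 1
      from Suc.IH[OF this] show ?thesis using le_SucI by blast
    next
      case 2
      from Suc.IH[OF 2(1)] obtain p where p: "walk G p" "hd p \<in> A" "last p = u" "length p \<le> Suc r"
        by blast
      moreover have "p \<noteq> []" using p(1) by (simp add: walk_def)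
      moreover have "v \<in> verts G" using 2(2) G by (auto simp: fin_graph_def)
      ultimately show ?thesis using 2(2)
        by (intro exI[of _ "p @ [v]"]) (simp add: walk_snoc)
    qed
  qed
next
  assume "\<exists>p. walk G p \<and> hd p \<in> A \<and> last p = v \<and> length p \<le> Suc r"
  then obtain p where "walk G p" "hd p \<in> A" "last p = v" "length p \<le> Suc r" by blast
  then show "v \<in> nball G A r"
  proof (induction p arbitrary: v r rule: rev_induct)
    case Nil
    then show ?case by (simp add: walk_def)
  next
    case (snoc x p)
    show ?case
    proof (cases "p = []")
      case True
      with snoc.prems show ?thesis using nball_self[of A G r] by auto
    next
      case False
      with snoc.prems have *: "walk G p" "hd p \<in> A" "{last p, v} \<in> edges G" "length p \<le> r"
        by (auto simp: walk_snoc)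
      moreover from False * obtain r' where r: "r = Suc r'" by (cases r) auto
      ultimately have "last p \<in> nball G A r'" using snoc.IH[of "last p" r'] by simp
      with * r show ?thesis by auto
    qed
  qed
qed

text \<open>A distance of at least \<open>d\<close> excludes walks with at most \<open>d - 1\<close>
  edges, and \<open>0 < d\<close> makes the truncated \<open>d - 1\<close> a true predecessor.
  Unreachable pairs need no separate case because the infimum over the empty set is
  infinite.\<close>

lemma set_dist_ge_iff:
  assumes "fin_graph G" "A \<subseteq> verts G" "0 < d"
  shows "enat d \<le> set_dist G A B \<longleftrightarrow> nball G A (d - 1) \<inter> B = {}"
proof -
  have "enat d \<le> set_dist G A B \<longleftrightarrow>
      (\<forall>p. walk G p \<longrightarrow> hd p \<in> A \<longrightarrow> last p \<in> B \<longrightarrow> d \<le> length p - 1)"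
    by (auto simp: set_dist_def graph_dist_def le_INF_iff)
  also have "\<dots> \<longleftrightarrow> (\<forall>p. walk G p \<longrightarrow> hd p \<in> A \<longrightarrow> last p \<in> B \<longrightarrow> \<not> length p \<le> Suc (d - 1))"
    using assms(3) by (intro iff_allI imp_cong refl) auto
  also have "\<dots> \<longleftrightarrow> (\<forall>v\<in>B. v \<notin> nball G A (d - 1))"
    unfolding nball_iff_walk[OF assms(1,2)] by blast
  finally show ?thesis by blast
qed

lemma nball_add: "nball G A (a + b) = nball G (nball G A a) b"
  by (induction b) auto

lemma nball_UN: "v \<in> nball G A r \<longleftrightarrow> (\<exists>x\<in>A. v \<in> nball G {x} r)"
proof (induction r arbitrary: v)
  case (Suc r)
  have "v \<in> nball G A (Suc r) \<longleftrightarrow> v \<in> nball G A r \<or> (\<exists>u. u \<in> nball G A r \<and> {u, v} \<in> edges G)" by auto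
  also have "\<dots> \<longleftrightarrow> (\<exists>x\<in>A. v \<in> nball G {x} (Suc r))"
    unfolding Suc.IH by auto
  finally show ?case .
qed simp

text \<open>The last edge towards \<open>y\<close> becomes the first edge leaving \<open>y\<close>:
  \<open>nball_add\<close> splits \<open>Suc r\<close> as \<open>r + 1\<close> on one side and as
  \<open>1 + r\<close> on the other.\<close>

lemma nball_sym: "y \<in> nball G {x} r \<longleftrightarrow> x \<in> nball G {y} r"
proof (induction r arbitrary: x y)
  case (Suc r)
  have one: "u \<in> nball G {y} 1 \<longleftrightarrow> y \<in> nball G {u} 1" for u y
    by (auto simp: insert_commute)
  have "y \<in> nball G {x} (Suc r) \<longleftrightarrow> (\<exists>u\<in>nball G {x} r. y \<in> nball G {u} 1)"
    using nball_add[of G "{x}" r 1] nball_UN[of y G "nball G {x} r" 1] by simp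
  also have "\<dots> \<longleftrightarrow> (\<exists>u\<in>nball G {y} 1. x \<in> nball G {u} r)"
    using Suc.IH one by blast
  also have "\<dots> \<longleftrightarrow> x \<in> nball G {y} (Suc r)"
    using nball_add[of G "{y}" 1 r] nball_UN[of x G "nball G {y} 1" r] by simp
  finally show ?case .
qed auto

text \<open>Halving the distance: this is where parity of \<open>d = 2 r + 2\<close> enters.\<close>

lemma nball_meets_iff:
  "nball G A (Suc (2 * r)) \<inter> B \<noteq> {} \<longleftrightarrow>
     (\<exists>x\<in>nball G A r. \<exists>y\<in>nball G B r. x = y \<or> {x, y} \<in> edges G)"
proof -
  \<comment> \<open>The odd radius is cut into \<open>r + 1\<close> steps from \<open>A\<close> and
    \<open>r\<close> steps from \<open>B\<close>. The one surplus step is the possible edge between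
    the two balls.\<close>
  have "Suc (2 * r) = Suc r + r" by simp
  then have "nball G A (Suc (2 * r)) = nball G (nball G A (Suc r)) r" by (metis nball_add)
  then have "nball G A (Suc (2 * r)) \<inter> B \<noteq> {} \<longleftrightarrow>
      (\<exists>v\<in>B. \<exists>x\<in>nball G A (Suc r). v \<in> nball G {x} r)"
    using nball_UN[of _ G "nball G A (Suc r)" r] by blast
  also have "\<dots> \<longleftrightarrow> (\<exists>x\<in>nball G A (Suc r). x \<in> nball G B r)"
    using nball_UN[of _ G B r] nball_sym[of _ G _ r] by blast
  also have "\<dots> \<longleftrightarrow> (\<exists>x\<in>nball G A r. \<exists>y\<in>nball G B r. x = y \<or> {x, y} \<in> edges G)"
    by auto
  finally show ?thesis .
qed

text \<open>Connectedness phrased by cuts, with the crossing edge inside \<open>K\<close>. Unlike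
  walks, this form passes to balls and to sets of tree nodes by a single choice of cut.\<close>

definition linked :: "'a set set \<Rightarrow> 'a set \<Rightarrow> bool" where
  "linked E K \<longleftrightarrow>
     (\<forall>C. K \<inter> C \<noteq> {} \<longrightarrow> K - C \<noteq> {} \<longrightarrow> (\<exists>u\<in>K \<inter> C. \<exists>v\<in>K - C. {u, v} \<in> E))"

lemma walk_crosses:
  assumes "walk G p" "hd p \<in> C" "last p \<notin> C"
  shows "\<exists>u\<in>verts G \<inter> C. \<exists>v\<in>verts G - C. {u, v} \<in> edges G"
  using assms
proof (induction p rule: rev_induct)
  case Nil
  then show ?case by (simp add: walk_def)
next
  case (snoc x p)
  show ?case
  proof (cases "p = []")
    case False
    with snoc.prems have *: "walk G p" "hd p \<in> C" "x \<in> verts G - C" "{last p, x} \<in> edges G"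
      by (auto simp: walk_snoc)
    then have "last p \<in> verts G" using False by (auto simp: walk_def)
    with snoc.IH * show ?thesis by blast
  qed (use snoc.prems in auto)
qed

lemma connected_graph_linked:
  assumes "connected_graph H" "edges H \<subseteq> E"
  shows "linked E (verts H)"
  unfolding linked_def
proof (intro allI impI)
  fix C assume "verts H \<inter> C \<noteq> {}" "verts H - C \<noteq> {}"
  then obtain a b where "a \<in> verts H" "a \<in> C" "b \<in> verts H" "b \<notin> C" by blast
  with assms(1) obtain p where "walk H p" "hd p \<in> C" "last p \<notin> C"
    unfolding connected_graph_def by metis
  from walk_crosses[OF this] assms(2)
  show "\<exists>u\<in>verts H \<inter> C. \<exists>v\<in>verts H - C. {u, v} \<in> E" by blast
qed

text \<open>A cut either splits the smaller ball, where induction gives an edge, or leaves that ball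
  on one side. In the latter case a vertex on the other side is new and was added through an edge
  from the smaller ball.\<close>

lemma linked_nball:
  assumes "linked (edges G) A" "A \<noteq> {}"
  shows "linked (edges G) (nball G A r)"
proof (induction r)
  case (Suc r)
  let ?K = "nball G A r" and ?K' = "nball G A (Suc r)"
  have ne: "?K \<noteq> {}" using nball_self[of A G r] assms(2) by blast
  show ?case
    unfolding linked_def
  proof (intro allI impI)
    fix C assume C: "?K' \<inter> C \<noteq> {}" "?K' - C \<noteq> {}"
    consider "?K \<inter> C \<noteq> {}" "?K - C \<noteq> {}" | "?K \<subseteq> C" | "?K \<inter> C = {}" by blast
    then show "\<exists>u\<in>?K' \<inter> C. \<exists>v\<in>?K' - C. {u, v} \<in> edges G"
    proof cases
      case 1
      with Suc.IH obtain u v where "u \<in> ?K \<inter> C" "v \<in> ?K - C" "{u, v} \<in> edges G"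
        unfolding linked_def by blast
      then show ?thesis by auto
    next
      case 2
      from C(2) obtain b where b: "b \<in> ?K'" "b \<notin> C" by blast
      with 2 obtain u where "u \<in> ?K" "{u, b} \<in> edges G" by auto
      with 2 b show ?thesis by (intro bexI[of _ u] bexI[of _ b]) auto
    next
      case 3
      from C(1) obtain b where b: "b \<in> ?K'" "b \<in> C" by blast
      with 3 obtain u where "u \<in> ?K" "{u, b} \<in> edges G" by auto
      with 3 b show ?thesis
        by (intro bexI[of _ b] bexI[of _ u]) (auto simp: insert_commute)
    qed
  qed
qed (simp add: assms(1))

text \<open>The nodes whose bags contain one fixed vertex are connected, so an uncrossed cut
  \<open>C\<close> has them all on one side. It thereby sorts the vertices of \<open>B\<close> into
  two classes. An edge of \<open>G\<close> between the classes lies in some bag, whose node would be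
  on both sides.\<close>

lemma linked_nodes:
  assumes td: "tree_decomposition G T X" and B: "linked (edges G) B" "B \<subseteq> verts G"
  shows "linked (edges T) {t \<in> verts T. X t \<inter> B \<noteq> {}}"
  unfolding linked_def
proof (intro allI impI, rule ccontr)
  let ?K = "{t \<in> verts T. X t \<inter> B \<noteq> {}}"
  let ?Kv = "\<lambda>v. {t \<in> verts T. v \<in> X t}"
  fix C assume C: "?K \<inter> C \<noteq> {}" "?K - C \<noteq> {}"
    and no: "\<not> (\<exists>u\<in>?K \<inter> C. \<exists>v\<in>?K - C. {u, v} \<in> edges T)"
  have Kv: "?Kv v \<subseteq> C \<or> ?Kv v \<inter> C = {}" if "v \<in> B" for v
  proof -
    have "linked (edges T) (verts (induced T (?Kv v)))"
      using td that B(2) unfolding tree_decomposition_def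
      by (intro connected_graph_linked) (auto simp: induced_def)
    moreover have "verts (induced T (?Kv v)) = ?Kv v" by (auto simp: induced_def)
    ultimately have "linked (edges T) (?Kv v)" by simp
    show ?thesis
    proof (rule ccontr)
      assume "\<not> ?thesis"
      then have "?Kv v \<inter> C \<noteq> {}" "?Kv v - C \<noteq> {}" by blast+
      with \<open>linked (edges T) (?Kv v)\<close> obtain u u'
        where "u \<in> ?Kv v \<inter> C" "u' \<in> ?Kv v - C" "{u, u'} \<in> edges T"
        unfolding linked_def by meson
      moreover from this that have "u \<in> ?K \<inter> C" "u' \<in> ?K - C" by auto
      ultimately show False using no by meson
    qed
  qed
  from C obtain t1 t2 v1 v2 where "t1 \<in> verts T \<inter> C" "v1 \<in> X t1 \<inter> B" "t2 \<in> verts T - C" "v2 \<in> X t2 \<inter> B"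
    by blast
  with Kv[of v2] have "v1 \<in> B \<inter> {v. ?Kv v \<inter> C \<noteq> {}}" "v2 \<in> B - {v. ?Kv v \<inter> C \<noteq> {}}"
    by blast+
  then have "B \<inter> {v. ?Kv v \<inter> C \<noteq> {}} \<noteq> {}" "B - {v. ?Kv v \<inter> C \<noteq> {}} \<noteq> {}"
    by blast+
  with B(1)[unfolded linked_def, rule_format, of "{v. ?Kv v \<inter> C \<noteq> {}}"] obtain u v where uv: "u \<in> B" "?Kv u \<inter> C \<noteq> {}" "v \<in> B" "?Kv v \<inter> C = {}" "{u, v} \<in> edges G"
    by blast
  from td uv(5) obtain t where "t \<in> verts T" "{u, v} \<subseteq> X t"
    unfolding tree_decomposition_def by blast
  with uv Kv[of u] show False by blast
qed

section \<open>Search orders of a tree and their parent edges\<close>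

lemma distinct_path_of_rtrancl:
  assumes "(a, b) \<in> r\<^sup>*"
  shows "\<exists>p. p \<noteq> [] \<and> hd p = a \<and> last p = b \<and> distinct p \<and> successively (\<lambda>x y. (x, y) \<in> r) p"
  using assms
proof (induction rule: rtrancl_induct)
  case base
  show ?case by (intro exI[of _ "[a]"]) simp
next
  case (step y z)
  then obtain p where p: "p \<noteq> []" "hd p = a" "last p = y" "distinct p" "successively (\<lambda>x y. (x, y) \<in> r) p"
    by blast
  show ?case
  proof (cases "z \<in> set p")
    case True
    then obtain xs ys where xs: "p = (xs @ [z]) @ ys" using split_list by fastforce
    with p have "successively (\<lambda>x y. (x, y) \<in> r) (xs @ [z])"
      by (subst (asm) xs, subst (asm) successively_append_iff) simp
    moreover have "hd (xs @ [z]) = hd p" using xs by (cases xs) auto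
    ultimately show ?thesis using p xs
      by (intro exI[of _ "xs @ [z]"]) auto
  next
    case False
    with p step(2) show ?thesis
      by (intro exI[of _ "p @ [z]"]) (auto simp: successively_append_iff)
  qed
qed

locale search_order =
  fixes T :: "'b graph" and m :: nat and ord :: "nat \<Rightarrow> 'b" and par :: "nat \<Rightarrow> nat"
  assumes tree: "is_tree T"
    and ord: "bij_betw ord {1..m} (verts T)"
    and par: "\<And>i. 2 \<le> i \<Longrightarrow> i \<le> m \<Longrightarrow> 1 \<le> par i \<and> par i < i \<and> {ord i, ord (par i)} \<in> edges T"
begin

text \<open>The parent edges alone join every node to \<open>ord 1\<close>. A further edge
  \<open>e\<close> would close a cycle together with a repetition-free path of parent edges between
  its ends.\<close>

lemma tree_edge_is_parent_edge:
  assumes "e \<in> edges T"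
  shows "\<exists>i. 2 \<le> i \<and> i \<le> m \<and> e = {ord i, ord (par i)}"
proof (rule ccontr)
  assume no: "\<not> ?thesis"
  define r where "r = {(u, v). \<exists>i. 2 \<le> i \<and> i \<le> m \<and> {u, v} = {ord i, ord (par i)}}"
  have sym: "sym r" by (auto simp: r_def sym_def insert_commute)
  from tree assms have "e \<subseteq> verts T" "card e = 2" by (auto simp: is_tree_def fin_graph_def)
  then obtain a b where e: "e = {a, b}" "a \<noteq> b" "a \<in> verts T" "b \<in> verts T"
    by (auto simp: card_2_iff)
  have root: "(ord i, ord 1) \<in> r\<^sup>*" if "1 \<le> i" "i \<le> m" for i
    using that
  proof (induction i rule: less_induct)
    case (less i)
    show ?case
    proof (cases "i = 1")
      case False
      with less.prems par[of i] have *: "1 \<le> par i" "par i < i" by auto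
      have "2 \<le> i" using False less.prems by simp
      then have "(ord i, ord (par i)) \<in> r" using less.prems by (auto simp: r_def)
      moreover have "(ord (par i), ord 1) \<in> r\<^sup>*" using less * by simp
      ultimately show ?thesis by (rule converse_rtrancl_into_rtrancl)
    qed simp
  qed
  have "a \<in> ord ` {1..m}" "b \<in> ord ` {1..m}" using e ord by (simp_all add: bij_betw_def)
  then obtain i l where "a = ord i" "b = ord l" "1 \<le> i" "i \<le> m" "1 \<le> l" "l \<le> m"
    by auto
  with root[of i] root[of l] have "(a, ord 1) \<in> r\<^sup>*" "(ord 1, b) \<in> r\<^sup>*"
    using sym_rtrancl[OF sym] by (auto dest: symD)
  then have "(a, b) \<in> r\<^sup>*" by (rule rtrancl_trans)
  from distinct_path_of_rtrancl[OF this] obtain p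
    where p: "p \<noteq> []" "hd p = a" "last p = b" "distinct p" "successively (\<lambda>x y. (x, y) \<in> r) p" by blast
  have r: "{u, v} \<in> edges T \<and> u \<in> verts T \<and> v \<in> verts T" if "(u, v) \<in> r" for u v
  proof -
    have "{u, v} \<in> edges T" using that par by (auto simp: r_def)
    with tree show ?thesis by (auto simp: is_tree_def fin_graph_def)
  qed
  have step: "(p ! i, p ! Suc i) \<in> r" if "Suc i < length p" for i
    using p(5) that by (simp add: successively_conv_nth)
  have "p ! i \<in> verts T" if "i < length p" for i
  proof (cases i)
    case 0
    with p e show ?thesis by (simp add: hd_conv_nth)
  next
    case (Suc n)
    with step[of n] that r show ?thesis by blast
  qed
  then have walk: "walk T p" using p(1) step r by (fastforce simp: walk_def in_set_conv_nth)
  have "(a, b) \<notin> r" using no e by (auto simp: r_def)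
  \<comment> \<open>A path on at most two nodes would make the ends of \<open>e\<close> equal, or
    \<open>e\<close> itself a parent edge.\<close>
  have "3 \<le> length p"
  proof (rule ccontr)
    assume "\<not> 3 \<le> length p"
    then consider "length p = 0" | "length p = 1" | "length p = 2" by linarith
    then show False
    proof cases
      case 2
      then show False using p e by (cases p) auto
    next
      case 3
      then obtain x y where "p = [x, y]" by (metis length_0_conv length_Suc_conv numeral_2_eq_2)
      with p \<open>(a, b) \<notin> r\<close> show False by simp
    qed (use p in simp)
  qed
  with walk p e assms have "is_cycle T p" by (auto simp: is_cycle_def insert_commute)
  with tree show False by (auto simp: is_tree_def)
qed

text \<open>Each ordered pair of neighbours is a node with its parent or the reverse. This bounds
  the total length of the adjacency lists of \<open>T\<close> and so keeps the search linear in
  \<open>m\<close>.\<close>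

lemma degree_sum: "(\<Sum>t\<in>verts T. card (neighbours T t)) \<le> 2 * m"
proof -
  have fin: "finite (verts T)" using tree by (simp add: is_tree_def fin_graph_def)
  have nb: "neighbours T t \<subseteq> verts T" for t
    using tree by (auto simp: neighbours_def is_tree_def fin_graph_def)
  have "(\<Sum>t\<in>verts T. card (neighbours T t)) = card (Sigma (verts T) (neighbours T))"
    using fin finite_subset[OF nb fin] by (subst card_SigmaI) auto
  also have "\<dots> \<le> card ((\<lambda>i. (ord i, ord (par i))) ` {1..m} \<union> (\<lambda>i. (ord (par i), ord i)) ` {1..m})"
  proof (rule card_mono)
    show "Sigma (verts T) (neighbours T) \<subseteq>
        (\<lambda>i. (ord i, ord (par i))) ` {1..m} \<union> (\<lambda>i. (ord (par i), ord i)) ` {1..m}"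
    proof (rule subsetI)
      fix x assume "x \<in> Sigma (verts T) (neighbours T)"
      then obtain t u where x: "x = (t, u)" "{u, t} \<in> edges T" by (auto simp: neighbours_def)
      from tree_edge_is_parent_edge[OF x(2)] obtain i where "2 \<le> i" "i \<le> m" "{u, t} = {ord i, ord (par i)}" by blast
      with x(1) show "x \<in> (\<lambda>i. (ord i, ord (par i))) ` {1..m} \<union> (\<lambda>i. (ord (par i), ord i)) ` {1..m}"
        by (force simp: doubleton_eq_iff)
    qed
  qed simp
  also have "\<dots> \<le> card {1..m} + card {1..m}"
    by (meson add_mono card_Un_le card_image_le finite_atLeastAtMost le_trans)
  finally show ?thesis by simp
qed

text \<open>\<open>D\<close> is the subtree hanging at position \<open>i\<close>. Position
  \<open>l\<close> is outside, since descendants come after \<open>i\<close>, so the linked set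
  \<open>K\<close> contains both ends of a tree edge leaving \<open>D\<close>. The only such edge
  joins \<open>ord i\<close> to its parent.\<close>

lemma parent_in_linked:
  assumes K: "linked (edges T) K" "K \<subseteq> verts T"
    and i: "i \<le> m" "1 \<le> l" "l < i" "ord i \<in> K" "ord l \<in> K"
  shows "ord (par i) \<in> K"
proof -
  define P where "P = {(x, y). 2 \<le> x \<and> x \<le> m \<and> y = par x}"
  define D where "D = ord ` {x. 1 \<le> x \<and> x \<le> m \<and> (x, i) \<in> P\<^sup>*}"
  have inj: "x = y" if "ord x = ord y" "1 \<le> x" "x \<le> m" "1 \<le> y" "y \<le> m" for x y
    using inj_onD[OF bij_betw_imp_inj_on[OF ord] that(1)] that by simp
  have ge: "i \<le> x" if "(x, i) \<in> P\<^sup>*" for x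
    using that
  proof (induction rule: converse_rtrancl_induct)
    case (step y z)
    then show ?case using par[of y] by (auto simp: P_def)
  qed simp
  have "ord i \<in> K \<inter> D" using i by (auto simp: D_def)
  moreover have "ord l \<notin> D"
  proof
    assume "ord l \<in> D"
    then obtain x where "ord l = ord x" "1 \<le> x" "x \<le> m" "(x, i) \<in> P\<^sup>*" by (auto simp: D_def)
    with inj[of l x] i ge[of x] show False by auto
  qed
  ultimately obtain u v where uv: "u \<in> K" "u \<in> D" "v \<in> K" "v \<notin> D" "{u, v} \<in> edges T"
    using K(1) i unfolding linked_def by blast
  from tree_edge_is_parent_edge[OF uv(5)] obtain j
    where j: "2 \<le> j" "j \<le> m" "{u, v} = {ord j, ord (par j)}" by blast
  note pj = par[OF j(1,2)]
  have D: "ord x \<in> D \<longleftrightarrow> (x, i) \<in> P\<^sup>*" if "1 \<le> x" "x \<le> m" for x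
    using inj[OF _ that] that by (auto simp: D_def)
  have jP: "(j, par j) \<in> P" using j by (simp add: P_def)
  from j(3) consider "u = ord j" "v = ord (par j)" | "u = ord (par j)" "v = ord j"
    by (auto simp: doubleton_eq_iff)
  then show ?thesis
  proof cases
    case 1
    with uv D[of j] j have "(j, i) \<in> P\<^sup>*" by simp
    then show ?thesis
    proof (cases rule: converse_rtranclE)
      case base
      with 1 uv show ?thesis by simp
    next
      case (step y)
      then have "(par j, i) \<in> P\<^sup>*" by (simp add: P_def)
      with 1 uv D[of "par j"] pj j show ?thesis by simp
    qed
  next
    case 2
    with uv D[of "par j"] pj j have "(par j, i) \<in> P\<^sup>*" by simp
    with jP have "(j, i) \<in> P\<^sup>*" by (rule converse_rtrancl_into_rtrancl)
    with 2 uv D[of j] j show ?thesis by simp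
  qed
qed

end

section \<open>Independent sets inside a bag\<close>

lemma card_le_independence_number:
  assumes "fin_graph G" "independent_set (induced G S) I"
  shows "card I \<le> independence_number (induced G S)"
proof -
  have "{I. independent_set (induced G S) I} \<subseteq> Pow (verts G)"
    by (auto simp: independent_set_def induced_def)
  moreover have "finite (Pow (verts G))" using assms(1) by (simp add: fin_graph_def)
  ultimately have "finite {I. independent_set (induced G S) I}" by (rule finite_subset)
  then show ?thesis unfolding independence_number_def using assms(2) by (intro Max_ge) auto
qed

lemma card_pairwise_far_le:
  assumes G: "fin_graph G" and X: "X \<subseteq> verts G" and S: "finite S"
    and meet: "\<And>j. j \<in> S \<Longrightarrow> B j \<inter> X \<noteq> {}"
    and far: "\<And>i j x y. i \<in> S \<Longrightarrow> j \<in> S \<Longrightarrow> i \<noteq> j \<Longrightarrow> x \<in> B i \<Longrightarrow> y \<in> B j \<Longrightarrow> x \<noteq> y \<and> {x, y} \<notin> edges G"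
  shows "card S \<le> independence_number (induced G X)"
proof -
  from meet have "\<forall>j\<in>S. \<exists>x. x \<in> B j \<inter> X" by blast
  then obtain f where f: "\<And>j. j \<in> S \<Longrightarrow> f j \<in> B j \<inter> X" by metis
  have "inj_on f S" using f far unfolding inj_on_def by (metis IntD1)
  then have "card S = card (f ` S)" by (simp add: card_image)
  also have "\<dots> \<le> independence_number (induced G X)"
  proof (rule card_le_independence_number[OF G])
    have "{u, v} \<notin> edges G" if uv: "u \<in> f ` S" "v \<in> f ` S" for u v
    proof (cases "u = v")
      case True
      then show ?thesis using G by (auto simp: fin_graph_def)
    next
      case False
      with uv obtain i j where "i \<in> S" "j \<in> S" "u = f i" "v = f j" "i \<noteq> j" by blast
      with f far show ?thesis by blast
    qed
    then show "independent_set (induced G X) (f ` S)"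
      using f X by (auto simp: independent_set_def induced_def)
  qed
  finally show ?thesis .
qed

section \<open>Dynamic programming along a sequence of bags\<close>

text \<open>Bags are numbered so that every bag comes after its parent \<open>par i\<close>; \<open>Y 0\<close> is an empty
  auxiliary root. A message \<open>Msg i R\<close> is sent from bag \<open>i\<close> to its parent for every trace \<open>R\<close> of a
  solution on both bags.\<close>

locale bag_sequence =
  fixes m :: nat and Y :: "nat \<Rightarrow> 'j set" and par :: "nat \<Rightarrow> nat" and J :: "'j set"
    and confl :: "'j \<Rightarrow> 'j \<Rightarrow> bool" and w :: "'j \<Rightarrow> rat"
  assumes fin: "finite J"
    and Y0: "Y 0 = {}"
    and par_less: "\<And>i. 1 \<le> i \<Longrightarrow> i \<le> m \<Longrightarrow> par i < i"
    and rip: "\<And>i l. 1 \<le> i \<Longrightarrow> i \<le> m \<Longrightarrow> l < i \<Longrightarrow> Y i \<inter> Y l \<subseteq> Y (par i)"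
    and cover: "J = (\<Union>i\<le>m. Y i)"
    and cover_confl: "\<And>u v. u \<in> J \<Longrightarrow> v \<in> J \<Longrightarrow> confl u v \<Longrightarrow> \<exists>i\<le>m. u \<in> Y i \<and> v \<in> Y i"
begin

definition indep :: "'j set \<Rightarrow> bool" where
  "indep S \<longleftrightarrow> (\<forall>u\<in>S. \<forall>v\<in>S. u \<noteq> v \<longrightarrow> \<not> confl u v)"

definition before :: "nat \<Rightarrow> 'j set" where
  "before i = (\<Union>l<i. Y l)"

lemma indep_subset: "indep S \<Longrightarrow> R \<subseteq> S \<Longrightarrow> indep R"
  by (auto simp: indep_def)

lemma before_Suc: "before (Suc i) = before i \<union> Y i"
  by (auto simp: before_def less_Suc_eq)

lemma before_all: "before (Suc m) = J"
  by (simp add: before_def cover lessThan_Suc_atMost)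

lemma rip_before: "1 \<le> i \<Longrightarrow> i \<le> m \<Longrightarrow> Y i \<inter> before i \<subseteq> Y (par i)"
  using rip unfolding before_def by blast

lemma finite_Y: "i \<le> m \<Longrightarrow> finite (Y i)"
  using fin cover by (auto intro: finite_subset)

text \<open>Some bag \<open>l\<close> contains both. If \<open>l\<close> is not below
  \<open>i\<close>, then \<open>u\<close> and \<open>v\<close> also occurred before
  \<open>l\<close>, and the running intersection property moves them to the parent of
  \<open>l\<close>. The bag number drops until it is below \<open>i\<close>.\<close>

lemma confl_in_earlier_bag:
  assumes "i \<le> Suc m" "u \<in> before i" "v \<in> before i" "confl u v"
  shows "\<exists>l<i. u \<in> Y l \<and> v \<in> Y l"
proof -
  have "before i \<subseteq> J" using assms(1) by (auto simp: before_def cover) (metis atMost_iff less_Suc_eq_le less_le_trans)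
  with assms cover_confl obtain l where "u \<in> Y l" "v \<in> Y l" "l \<le> m" by blast
  then show ?thesis
  proof (induction l rule: less_induct)
    case (less l)
    show ?case
    proof (cases "l < i")
      case False
      have l: "1 \<le> l" using less.prems Y0 by (cases l) auto
      have "before i \<subseteq> before l" using False unfolding before_def by (intro UN_mono) auto
      then have "u \<in> Y (par l)" "v \<in> Y (par l)"
        using rip_before[OF l less.prems(3)] less.prems assms by auto
      with less.IH[of "par l"] par_less[OF l less.prems(3)] less.prems(3) show ?thesis by simp
    qed (use less.prems in blast)
  qed
qed

definition children :: "nat \<Rightarrow> nat \<Rightarrow> nat set" where
  "children i l = {c. i \<le> c \<and> c \<le> m \<and> par c = l}"

lemma finite_children: "finite (children i l)"
  by (rule finite_subset[of _ "{..m}"]) (auto simp: children_def)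

lemma children_step:
  "1 \<le> i \<Longrightarrow> i \<le> m \<Longrightarrow> children i l = (if l = par i then {i} else {}) \<union> children (Suc i) l"
  using le_less[of i] by (auto simp: children_def Suc_le_eq)

lemma notin_children_Suc: "i \<notin> children (Suc i) l"
  by (auto simp: children_def)

text \<open>The potential of bag \<open>l\<close> once the bags \<open>i, \<dots>, m\<close> have sent their messages.\<close>

definition pot :: "(nat \<Rightarrow> 'j set \<Rightarrow> rat) \<Rightarrow> nat \<Rightarrow> nat \<Rightarrow> 'j set \<Rightarrow> rat" where
  "pot Msg i l S = sum w (S - Y (par l)) + (\<Sum>c\<in>children i l. Msg c (S \<inter> Y c))"

lemma pot_step:
  assumes "1 \<le> i" "i \<le> m"
  shows "pot Msg i l S = pot Msg (Suc i) l S + (if l = par i then Msg i (S \<inter> Y i) else 0)"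
  using children_step[OF assms, of l]
  by (simp add: pot_def finite_children notin_children_Suc)

text \<open>By running intersection \<open>Y i - Y (par i)\<close> consists of the members not seen
  before bag \<open>i\<close>, so every weight is counted in exactly one bag. Bag 0 contributes
  nothing as \<open>Y 0\<close> is empty, and at stage \<open>Suc m\<close> no messages enter,
  whatever \<open>Msg\<close> is.\<close>

lemma weight_eq_pot:
  assumes "I \<subseteq> J"
  shows "sum w I = (\<Sum>l<Suc m. pot Msg (Suc m) l (I \<inter> Y l))"
proof -
  have "sum w (I \<inter> before i) = (\<Sum>l<i. sum w (I \<inter> Y l - Y (par l)))" if "i \<le> Suc m" for i
    using that
  proof (induction i)
    case (Suc i)
    have eq: "I \<inter> Y i - before i = I \<inter> Y i - Y (par i)"
    proof (cases "i = 0")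
      case False
      with Suc.prems rip_before[of i] par_less[of i] show ?thesis
        by (auto simp: before_def)
    qed (simp add: Y0)
    have "I \<inter> before (Suc i) = (I \<inter> before i) \<union> (I \<inter> Y i - before i)"
      by (auto simp: before_Suc)
    moreover have "finite I" using assms fin finite_subset by blast
    ultimately have "sum w (I \<inter> before (Suc i)) = sum w (I \<inter> before i) + sum w (I \<inter> Y i - before i)"
      by (subst sum.union_disjoint[symmetric]) (auto intro: arg_cong[of _ _ "sum w"])
    with Suc eq show ?case by simp
  qed (simp add: before_def)
  from this[of "Suc m"] have "sum w I = (\<Sum>l<Suc m. sum w (I \<inter> Y l - Y (par l)))"
    using assms before_all by (simp add: Int_absorb2)
  moreover have "children (Suc m) l = {}" for l by (auto simp: children_def)
  ultimately show ?thesis by (simp add: pot_def)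
qed

text \<open>Sending the message of bag \<open>i\<close> changes only the potential of its parent.
  Two sets are allowed so that one identity serves both the upper bound, with \<open>K = I\<close>,
  and the reconstruction, where \<open>K\<close> extends \<open>I\<close> by the choice made in bag
  \<open>i\<close>.\<close>

lemma pot_sum_step:
  assumes "1 \<le> i" "i \<le> m"
    and "\<And>l. l < i \<Longrightarrow> K \<inter> Y l = I \<inter> Y l"
    and "(I \<inter> Y (par i)) \<inter> Y i = R"
  shows "(\<Sum>l<i. pot Msg i l (I \<inter> Y l)) + pot Msg (Suc i) i (K \<inter> Y i) =
    (\<Sum>l<Suc i. pot Msg (Suc i) l (K \<inter> Y l)) + Msg i R"
proof -
  have "(\<Sum>l<i. pot Msg i l (I \<inter> Y l)) =
      (\<Sum>l<i. pot Msg (Suc i) l (I \<inter> Y l) + (if l = par i then Msg i R else 0))"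
    using assms(4) by (intro sum.cong) (auto simp: pot_step[OF assms(1,2)])
  also have "\<dots> = (\<Sum>l<i. pot Msg (Suc i) l (I \<inter> Y l)) + Msg i R"
    using par_less[OF assms(1,2)] by (simp add: sum.distrib sum.delta)
  finally show ?thesis using assms(3) by simp
qed

text \<open>Messages only have to dominate the potentials of independent sets with the given trace.
  When bags are eliminated from the last one downwards, the total then never decreases.\<close>

lemma weight_le_root_pot:
  assumes Msg: "\<And>i S. 1 \<le> i \<Longrightarrow> i \<le> m \<Longrightarrow> S \<subseteq> Y i \<Longrightarrow> indep S \<Longrightarrow>
      pot Msg (Suc i) i S \<le> Msg i (S \<inter> Y (par i))"
    and I: "I \<subseteq> J" "indep I"
  shows "sum w I \<le> pot Msg 1 0 {}"
proof -
  have "sum w I \<le> (\<Sum>l<Suc i. pot Msg (Suc i) l (I \<inter> Y l))" if "i \<le> m" for i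
    using that
  proof (induction i rule: inc_induct)
    case base
    then show ?case using weight_eq_pot[OF I(1)] by simp
  next
    case (step i)
    have "pot Msg (Suc (Suc i)) (Suc i) (I \<inter> Y (Suc i)) \<le> Msg (Suc i) (I \<inter> Y (Suc i) \<inter> Y (par (Suc i)))"
      using step.hyps I(2) by (intro Msg) (auto intro: indep_subset)
    with step pot_sum_step[of "Suc i" I I "I \<inter> Y (Suc i) \<inter> Y (par (Suc i))" Msg]
    show ?case by (simp add: Int_ac)
  qed
  from this[of 0] show ?thesis by (simp add: Y0)
qed

text \<open>\<open>ch i R\<close> extends the trace \<open>R\<close> to bag \<open>i\<close>.\<close>

fun recon :: "(nat \<Rightarrow> 'j set \<Rightarrow> 'j set) \<Rightarrow> nat \<Rightarrow> 'j set" where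
  "recon ch 0 = {}"
| "recon ch (Suc i) = recon ch i \<union> ch (Suc i) (recon ch i \<inter> Y (Suc i))"

context
  fixes ch :: "nat \<Rightarrow> 'j set \<Rightarrow> 'j set" and Msg :: "nat \<Rightarrow> 'j set \<Rightarrow> rat"
  assumes ch: "\<And>i R. 1 \<le> i \<Longrightarrow> i \<le> m \<Longrightarrow> R \<subseteq> Y i \<inter> Y (par i) \<Longrightarrow> indep R \<Longrightarrow>
      ch i R \<subseteq> Y i \<and> indep (ch i R) \<and> ch i R \<inter> Y (par i) = R \<and> pot Msg (Suc i) i (ch i R) = Msg i R"
begin

text \<open>As \<open>ch\<close> attains the message exactly, the total potential keeps the value at
  the root. Independence is checked bag by bag: a conflict lies within one bag, and on each bag the
  new set is either the old one or the choice \<open>S\<close>.\<close>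

lemma recon_invariant:
  "i \<le> m \<Longrightarrow> recon ch i \<subseteq> before (Suc i) \<and> indep (recon ch i) \<and>
      (\<Sum>l<Suc i. pot Msg (Suc i) l (recon ch i \<inter> Y l)) = pot Msg 1 0 {}"
proof (induction i)
  case (Suc i)
  define I where "I = recon ch i"
  define R where "R = I \<inter> Y (Suc i)"
  define S where "S = ch (Suc i) R"
  have Suc1: "1 \<le> Suc i" by simp
  have I: "I \<subseteq> before (Suc i)" "indep I"
    "(\<Sum>l<Suc i. pot Msg (Suc i) l (I \<inter> Y l)) = pot Msg 1 0 {}"
    using Suc by (auto simp: I_def)
  have Rp: "R \<subseteq> Y (Suc i) \<inter> Y (par (Suc i))"
    using rip_before[OF Suc1 Suc.prems] I(1) by (auto simp: R_def)
  have "indep R" using I(2) by (auto simp: R_def intro: indep_subset)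
  from ch[OF Suc1 Suc.prems Rp this]
  have S: "S \<subseteq> Y (Suc i)" "indep S" "S \<inter> Y (par (Suc i)) = R"
    "pot Msg (Suc (Suc i)) (Suc i) S = Msg (Suc i) R"
    by (auto simp: S_def)
  have SR: "S \<inter> before (Suc i) \<subseteq> R"
    using rip_before[OF Suc1 Suc.prems] S(1,3) by blast
  \<comment> \<open>Members of \<open>S\<close> seen in an earlier bag belong to the trace
    \<open>R\<close>, hence already to \<open>I\<close>.\<close>
  have old: "(I \<union> S) \<inter> Y l = I \<inter> Y l" if "l < Suc i" for l
    using SR that by (fastforce simp: before_def R_def)
  have new: "(I \<union> S) \<inter> Y (Suc i) = S"
    using S(1,3) Rp by (auto simp: R_def)
  have sub: "I \<union> S \<subseteq> before (Suc (Suc i))"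
    using I(1) S(1) by (auto simp: before_Suc)
  have "indep (I \<union> S)"
    unfolding indep_def
  proof (intro ballI impI notI)
    fix u v assume uv: "u \<in> I \<union> S" "v \<in> I \<union> S" "u \<noteq> v" "confl u v"
    with sub confl_in_earlier_bag[of "Suc (Suc i)" u v] Suc.prems
    obtain l where l: "l < Suc (Suc i)" "u \<in> Y l" "v \<in> Y l" by auto
    show False
    proof (cases "l = Suc i")
      case True
      with new uv l have "u \<in> S" "v \<in> S" by blast+
      with S(2) uv show False by (auto simp: indep_def)
    next
      case False
      with l(1) have "l < Suc i" by simp
      from old[OF this] uv l have "u \<in> I" "v \<in> I" by blast+
      with I(2) uv show False by (auto simp: indep_def)
    qed
  qed
  moreover have "I \<inter> Y (par (Suc i)) \<inter> Y (Suc i) = R" using Rp by (auto simp: R_def)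
  from pot_sum_step[OF Suc1 Suc.prems old this, of Msg]
  have "(\<Sum>l<Suc (Suc i). pot Msg (Suc (Suc i)) l ((I \<union> S) \<inter> Y l)) = pot Msg 1 0 {}"
    using I(3) S(4) new by simp
  moreover have "recon ch (Suc i) = I \<union> S" by (simp add: I_def S_def R_def)
  ultimately show ?case using sub by simp
qed (simp add: indep_def Y0)

text \<open>Ensures that the trace looked up at bag \<open>Suc i\<close> meets the hypotheses on
  \<open>ch\<close>; correctness of the extraction loop needs this at every lookup.\<close>

lemma recon_trace:
  assumes "Suc i \<le> m"
  shows "recon ch i \<inter> Y (Suc i) \<subseteq> Y (Suc i) \<inter> Y (par (Suc i))" "indep (recon ch i \<inter> Y (Suc i))"
proof -
  have inv: "recon ch i \<subseteq> before (Suc i)" "indep (recon ch i)" using recon_invariant[of i] assms by auto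
  show "recon ch i \<inter> Y (Suc i) \<subseteq> Y (Suc i) \<inter> Y (par (Suc i))"
    using rip_before[OF _ assms] inv(1) by auto
  show "indep (recon ch i \<inter> Y (Suc i))" using inv(2) by (auto intro: indep_subset)
qed

lemma recon_optimal:
  "recon ch m \<subseteq> J \<and> indep (recon ch m) \<and> sum w (recon ch m) = pot Msg 1 0 {}"
  using recon_invariant[of m] weight_eq_pot[of "recon ch m" Msg] before_all by simp

end

end

section \<open>Enumerating small subsets\<close>

definition NEq :: "nexp \<Rightarrow> nexp \<Rightarrow> bexp" where
  "NEq a b = BAnd (BNot (NLess a b)) (BNot (NLess b a))"

definition BOr :: "bexp \<Rightarrow> bexp \<Rightarrow> bexp" where
  "BOr a b = BNot (BAnd (BNot a) (BNot b))"

definition NPos :: "nexp \<Rightarrow> bexp" where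
  "NPos e = NLess n0 e"

lemma bval_derived [simp]:
  "bval (NEq a b) s \<longleftrightarrow> nval a s = nval b s"
  "bval (BOr p q) s \<longleftrightarrow> bval p s \<or> bval q s"
  "bval (NPos a) s \<longleftrightarrow> 0 < nval a s"
  by (auto simp: NEq_def BOr_def NPos_def)

text \<open>The set of the last \<open>k\<close> digits of \<open>q\<close> in base \<open>n + 1\<close>, where the digit \<open>n\<close> stands for no element.\<close>

fun subset_of :: "nat \<Rightarrow> nat \<Rightarrow> nat \<Rightarrow> nat set" where
  "subset_of n 0 q = {}"
| "subset_of n (Suc k) q = ({q mod Suc n} \<inter> {..<n}) \<union> subset_of n k (q div Suc n)"

lemma subset_of_subset: "subset_of n k q \<subseteq> {..<n}"
  by (induction k arbitrary: q) auto

lemma subset_of_surj: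
  assumes "S \<subseteq> {..<n}" "card S \<le> k"
  shows "\<exists>q<Suc n ^ k. subset_of n k q = S"
  using assms
proof (induction k arbitrary: S)
  case 0
  then have "S = {}" using finite_subset[OF 0(1)] by simp
  then show ?case by simp
next
  case (Suc k)
  have fin: "finite S" using Suc.prems(1) finite_subset by blast
  \<comment> \<open>Small sets are padded: once no element is left, the digit is \<open>n\<close>,
    which encodes none.\<close>
  obtain a S' where a: "a \<le> n" "S' \<subseteq> {..<n}" "card S' \<le> k" "({a} \<inter> {..<n}) \<union> S' = S"
  proof (cases "S = {}")
    case True
    with that[of n "{}"] show ?thesis by simp
  next
    case False
    then obtain a where "a \<in> S" by blast
    with that[of a "S - {a}"] Suc.prems fin show ?thesis by force
  qed
  from Suc.IH[OF a(2,3)] obtain q where q: "q < Suc n ^ k" "subset_of n k q = S'" by blast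
  have "q * Suc n + a < Suc n ^ k * Suc n"
  proof -
    have "q * Suc n + a < Suc q * Suc n" using a(1) by simp
    also have "\<dots> \<le> Suc n ^ k * Suc n" using q(1) by (intro mult_le_mono1) simp
    finally show ?thesis .
  qed
  moreover have "(q * Suc n + a) mod Suc n = a" "(q * Suc n + a) div Suc n = q"
    using a(1) by (simp_all only: mod_mult_self3 div_mult_self3 mod_less div_less less_Suc_eq_le)
  ultimately show ?case using q(2) a(4)
    by (intro exI[of _ "q * Suc n + a"]) (simp add: mult.commute)
qed

text \<open>An unrolled expression rather than a loop; its size depends on \<open>k\<close> only. A
  digit is the remainder \<open>q - (q div Suc n) * Suc n\<close>, read off the tables
  \<open>dv\<close> and \<open>mS\<close>.\<close>

fun digit_cond :: "nat \<Rightarrow> nexp \<Rightarrow> bexp" where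
  "digit_cond 0 e = NLess n0 n0"
| "digit_cond (Suc k) e = BOr (NEq (NMinus e (NArr ''mS'' (NArr ''dv'' e))) (NVar ''y''))
     (digit_cond k (NArr ''dv'' e))"

lemma bval_digit_cond:
  assumes "nval e s = q" "q < N" "nvar s ''y'' < n"
    and "\<And>q. q < N \<Longrightarrow> narr s ''dv'' q = q div Suc n" "\<And>q. q < N \<Longrightarrow> narr s ''mS'' q = q * Suc n"
  shows "bval (digit_cond k e) s \<longleftrightarrow> nvar s ''y'' \<in> subset_of n k q"
  using assms(1,2)
proof (induction k arbitrary: e q)
  case (Suc k)
  have "q div Suc n \<le> q" by (rule div_le_dividend)
  with Suc.prems have lt: "q div Suc n < N" by linarith
  have "q - q div Suc n * Suc n = q mod Suc n" by (rule minus_div_mult_eq_mod)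
  with Suc.IH[of "NArr ''dv'' e" "q div Suc n"] Suc.prems lt assms(3-5) show ?case
    by auto
qed simp

section \<open>Powers, multiples and quotients by addition and truncated subtraction\<close>

fun PowN :: "nat \<Rightarrow> com" where
  "PowN 0 = NAssign ''N'' n1"
| "PowN (Suc k) = Seq (PowN k) (Seq
     (SumL n0 n0 (NPlus (NVar ''nJ'') n1) (NPos n1) (NVar ''N''))
     (NAssign ''N'' (NVar ''acc'')))"

lemma nvars_of_PowN: "nvars_of (PowN k) \<subseteq> {''acc'', ''z'', ''N''}"
  by (induction k) auto

lemma mods_PowN [simp]:
  "narrs_of (PowN k) = {}"
  "wvars_of (PowN k) = {}" "warrs_of (PowN k) = {}"
  by (induction k) auto

lemma PowN_keeps [simp]: "x \<notin> {''acc'', ''z'', ''N''} \<Longrightarrow> x \<notin> nvars_of (PowN k)"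
  using nvars_of_PowN by blast

lemma runs_PowN:
  assumes "nvar s ''nJ'' = n"
  shows "runs (PowN k) s (k * (n * 4 + 8) + 1) (\<lambda>s'. nvar s' ''N'' = Suc n ^ k)"
proof (induction k)
  case (Suc k)
  let ?S = "SumL n0 n0 (NPlus (NVar ''nJ'') n1) (NPos n1) (NVar ''N'')"
  show ?case
    unfolding PowN.simps
  proof (rule runs_Seq[OF Suc.IH])
    fix s1 assume s1: "framed (PowN k) s s1" "nvar s1 ''N'' = Suc n ^ k"
    have nJ: "nvar s1 ''nJ'' = n" using s1(1) assms by (simp add: framed_def)
    show "runs (Seq ?S (NAssign ''N'' (NVar ''acc''))) s1 (n * 4 + 8) (\<lambda>s'. nvar s' ''N'' = Suc n ^ Suc k)"
    proof (rule runs_Seq)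
      show "runs ?S s1 (n * 4 + 7) (\<lambda>s'. nvar s' ''acc'' = 0 + (\<Sum>z\<in>{0..<Suc n}. if True then Suc n ^ k else 0))"
        by (rule runs_SumL) (use s1 nJ in \<open>simp_all add: eq_off_def\<close>)
    qed (auto intro: runs_NAssign)
  qed simp
qed (auto intro: runs_NAssign)

abbreviation "pw_tab \<equiv> IterTab ''pw'' n1 (NPlus (NPlus (NVar ''nJ'') (NVar ''nT'')) n1)
       (NPlus (NVar ''acc'') (NVar ''acc''))"

abbreviation "mV_tab \<equiv> IterTab ''mV'' n0 (NVar ''nJ'') (NPlus (NVar ''acc'') (NVar ''nV''))"

abbreviation "mn_tab \<equiv> IterTab ''mn'' n0 (NPlus (NPlus (NPlus (NVar ''nJ'') (NVar ''nT'')) (NVar ''N'')) n1)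
       (NPlus (NVar ''acc'') (NVar ''nJ''))"

abbreviation "mN_tab \<equiv> IterTab ''mN'' n0 (NPlus (NVar ''nT'') n1) (NPlus (NVar ''acc'') (NVar ''N''))"

abbreviation "mS_tab \<equiv> IterTab ''mS'' n0 (NPlus (NVar ''N'') n1)
       (NPlus (NVar ''acc'') (NPlus (NVar ''nJ'') n1))"

abbreviation "dv_tab \<equiv> IterTab ''dv'' n0 (NVar ''N'')
       (NPlus (NVar ''acc'') (NMinus n1
         (NMinus (NArr ''mS'' (NPlus (NVar ''acc'') n1)) (NPlus (NVar ''x'') n1))))"

definition Tables :: "nat \<Rightarrow> com" where
  "Tables k = Seq (PowN k) (Seq pw_tab (Seq mV_tab (Seq mn_tab (Seq mN_tab (Seq mS_tab dv_tab)))))"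

lemma nvars_of_Tables: "nvars_of (Tables k) \<subseteq> {''acc'', ''z'', ''x'', ''N''}"
  using nvars_of_PowN[of k] by (auto simp: Tables_def)

lemma mods_Tables [simp]:
  "narrs_of (Tables k) = {''pw'', ''mV'', ''mn'', ''mN'', ''mS'', ''dv''}"
  "wvars_of (Tables k) = {}" "warrs_of (Tables k) = {}"
  by (auto simp: Tables_def)

lemma Tables_keeps [simp]: "x \<notin> {''acc'', ''z'', ''x'', ''N''} \<Longrightarrow> x \<notin> nvars_of (Tables k)"
  using nvars_of_Tables by blast

text \<open>The lengths fit the later lookups: \<open>pw\<close> is read at \<open>n + i\<close> for
  bags \<open>i \<le> m\<close>, and \<open>mn\<close> serves rows indexed by members, by bags and
  by subsets.\<close>

definition tables_ok :: "nat \<Rightarrow> nat \<Rightarrow> nat \<Rightarrow> nat \<Rightarrow> state \<Rightarrow> bool" where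
  "tables_ok n V m N s \<longleftrightarrow> nvar s ''N'' = N \<and> (\<forall>i<n + m + 1. narr s ''pw'' i = 2 ^ i) \<and>
     (\<forall>i<n. narr s ''mV'' i = i * V) \<and> (\<forall>i<n + m + N + 1. narr s ''mn'' i = i * n) \<and>
     (\<forall>i<m + 1. narr s ''mN'' i = i * N) \<and> (\<forall>i<N + 1. narr s ''mS'' i = i * Suc n) \<and>
     (\<forall>i<N. narr s ''dv'' i = i div Suc n)"

text \<open>The quotient moves up exactly when \<open>Suc q\<close> reaches the next multiple of
  \<open>Suc n\<close>, and truncated subtraction from 1 turns this comparison into 0 or 1. This is
  the step that fills the table of quotients.\<close>

lemma div_Suc_truncated:
  "Suc q div Suc n = q div Suc n + (1 - (Suc (q div Suc n) * Suc n - Suc q))"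
proof -
  let ?a = "q div Suc n"
  have 1: "?a * Suc n \<le> q" by (rule div_times_less_eq_dividend)
  have 2: "q < Suc ?a * Suc n" using dividend_less_div_times[of "Suc n" q] by simp
  show ?thesis
  proof (cases "Suc ?a * Suc n \<le> Suc q")
    case True
    with 2 have "Suc q = Suc ?a * Suc n" by simp
    then have "Suc q div Suc n = Suc ?a" by (metis nonzero_mult_div_cancel_right nat.distinct(1))
    with True show ?thesis by simp
  next
    case False
    then have "Suc q div Suc n = ?a" using 1 by (intro div_nat_eqI) (auto simp: mult.commute)
    with False show ?thesis by simp
  qed
qed

lemma runsE:
  assumes "runs c s t Q"
  obtains t' s' where "exec c s t' s'" "t' \<le> t" "Q s'" "framed c s s'"
  using assms exec_framed unfolding runs_def by blast

lemma runs_Tables: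
  assumes n: "nvar s ''nJ'' = n" "nvar s ''nV'' = V" "nvar s ''nT'' = m" and N: "N = Suc n ^ k"
  shows "runs (Tables k) s (k * (n * 4 + 8) + 12 * (n + m + N) + 40) (tables_ok n V m N)"
proof -
  obtain t1 s1 where 1: "exec (PowN k) s t1 s1" "t1 \<le> k * (n * 4 + 8) + 1" "nvar s1 ''N'' = N"
    and f1: "framed (PowN k) s s1"
    using runs_PowN[OF n(1), of k, folded N] by (rule runsE)
  have v1: "nvar s1 ''nJ'' = n" "nvar s1 ''nV'' = V" "nvar s1 ''nT'' = m" "nvar s1 ''N'' = N"
    using f1 1 n by (simp_all add: framed_def)
  have "runs pw_tab s1 (4 * (n + m + 1) + 3) (\<lambda>s'. \<forall>i<n+m+1. narr s' ''pw'' i = 2 ^ i)"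
    by (rule runs_IterTab) (use v1 in \<open>simp_all add: eq_off_def\<close>)
  then obtain t2 s2 where 2: "exec pw_tab s1 t2 s2" "t2 \<le> 4 * (n + m + 1) + 3"
    and r2: "\<forall>i<n+m+1. narr s2 ''pw'' i = 2 ^ i"
    and f2: "framed pw_tab s1 s2"
    by (rule runsE)
  have v2: "nvar s2 ''nJ'' = n" "nvar s2 ''nV'' = V" "nvar s2 ''nT'' = m" "nvar s2 ''N'' = N"
    using f2 v1 by (simp_all add: framed_def)
  have "runs mV_tab s2
      (4 * n + 3) (\<lambda>s'. \<forall>i<n. narr s' ''mV'' i = i * V)"
    by (rule runs_IterTab) (use v2 in \<open>simp_all add: eq_off_def\<close>)
  then obtain t3 s3 where 3: "exec mV_tab s2 t3 s3"
      "t3 \<le> 4 * n + 3"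
    and r3: "\<forall>i<n. narr s3 ''mV'' i = i * V"
    and f3: "framed mV_tab s2 s3"
    by (rule runsE)
  have v3: "nvar s3 ''nJ'' = n" "nvar s3 ''nV'' = V" "nvar s3 ''nT'' = m" "nvar s3 ''N'' = N"
    using f3 v2 by (simp_all add: framed_def)
  have "runs mn_tab s3 (4 * (n + m + N + 1) + 3) (\<lambda>s'. \<forall>i<n+m+N+1. narr s' ''mn'' i = i * n)"
    by (rule runs_IterTab) (use v3 in \<open>simp_all add: eq_off_def\<close>)
  then obtain t4 s4 where 4: "exec mn_tab s3 t4 s4" "t4 \<le> 4 * (n + m + N + 1) + 3"
    and r4: "\<forall>i<n+m+N+1. narr s4 ''mn'' i = i * n"
    and f4: "framed mn_tab s3 s4"
    by (rule runsE)
  have v4: "nvar s4 ''nJ'' = n" "nvar s4 ''nV'' = V" "nvar s4 ''nT'' = m" "nvar s4 ''N'' = N"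
    using f4 v3 by (simp_all add: framed_def)
  have "runs mN_tab s4
      (4 * (m + 1) + 3) (\<lambda>s'. \<forall>i<m+1. narr s' ''mN'' i = i * N)"
    by (rule runs_IterTab) (use v4 in \<open>simp_all add: eq_off_def\<close>)
  then obtain t5 s5 where 5: "exec mN_tab s4 t5 s5"
      "t5 \<le> 4 * (m + 1) + 3"
    and r5: "\<forall>i<m+1. narr s5 ''mN'' i = i * N"
    and f5: "framed mN_tab s4 s5"
    by (rule runsE)
  have v5: "nvar s5 ''nJ'' = n" "nvar s5 ''nV'' = V" "nvar s5 ''nT'' = m" "nvar s5 ''N'' = N"
    using f5 v4 by (simp_all add: framed_def)
  have "runs mS_tab s5
      (4 * (N + 1) + 3) (\<lambda>s'. \<forall>i<N+1. narr s' ''mS'' i = i * Suc n)"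
    by (rule runs_IterTab) (use v5 in \<open>simp_all add: eq_off_def\<close>)
  then obtain t6 s6 where 6: "exec mS_tab s5 t6 s6"
      "t6 \<le> 4 * (N + 1) + 3"
    and r6: "\<forall>i<N+1. narr s6 ''mS'' i = i * Suc n"
    and f6: "framed mS_tab s5 s6"
    by (rule runsE)
  have v6: "nvar s6 ''nJ'' = n" "nvar s6 ''nV'' = V" "nvar s6 ''nT'' = m" "nvar s6 ''N'' = N"
    using f6 v5 by (simp_all add: framed_def)
  have "runs dv_tab s6 (4 * N + 3) (\<lambda>s'. \<forall>i<N. narr s' ''dv'' i = i div Suc n)"
  proof (rule runs_IterTab)
    fix s' q assume s': "eq_off {''x'', ''acc''} {''dv''} {} {} s6 s'" "nvar s' ''x'' = q" "q < N"
      "nvar s' ''acc'' = q div Suc n"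
    \<comment> \<open>The multiple is looked up one place beyond the quotient, which is why
      \<open>mS\<close> has \<open>N + 1\<close> entries.\<close>
    have "q div Suc n \<le> q" by (rule div_le_dividend)
    with s'(3) have "Suc (q div Suc n) < N + 1" by linarith
    with r6 have "narr s6 ''mS'' (Suc (q div Suc n)) = Suc (q div Suc n) * Suc n" by blast
    moreover have "narr s' ''mS'' = narr s6 ''mS''" using s'(1) by (simp add: eq_off_def)
    ultimately have "narr s' ''mS'' (Suc (q div Suc n)) = Suc (q div Suc n) * Suc n" by simp
    with s' show "nval (NPlus (NVar ''acc'') (NMinus n1
         (NMinus (NArr ''mS'' (NPlus (NVar ''acc'') n1)) (NPlus (NVar ''x'') n1)))) s' = Suc q div Suc n"
      by (simp only: div_Suc_truncated nval.simps add_0_right add_Suc_right One_nat_def)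
  qed (use v6 in \<open>simp_all add: eq_off_def\<close>)
  then obtain t7 s7 where 7: "exec dv_tab s6 t7 s7" "t7 \<le> 4 * N + 3"
    and r7: "\<forall>i<N. narr s7 ''dv'' i = i div Suc n" and f7: "framed dv_tab s6 s7"
    by (rule runsE)
  have "nvar s7 ''N'' = N" using f7 v6 by (simp add: framed_def)
  moreover have "narr s7 ''pw'' = narr s2 ''pw''" "narr s7 ''mV'' = narr s3 ''mV''"
    "narr s7 ''mn'' = narr s4 ''mn''" "narr s7 ''mN'' = narr s5 ''mN''" "narr s7 ''mS'' = narr s6 ''mS''"
    using f3 f4 f5 f6 f7 by (simp_all add: framed_def)
  ultimately have ok: "tables_ok n V m N s7"
    using r2 r3 r4 r5 r6 r7 by (simp only: tables_ok_def simp_thms)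
  have t: "t1 + (t2 + (t3 + (t4 + (t5 + (t6 + t7))))) \<le> k * (n * 4 + 8) + 12 * (n + m + N) + 40"
    using 1(2) 2(2) 3(2) 4(2) 5(2) 6(2) 7(2) by simp
  from exec.Seq[OF 1(1) exec.Seq[OF 2(1) exec.Seq[OF 3(1) exec.Seq[OF 4(1) exec.Seq[OF 5(1)
    exec.Seq[OF 6(1) 7(1)]]]]]] t ok
  show ?thesis unfolding runs_def Tables_def by blast
qed

section \<open>Conflicts between members of the family\<close>

text \<open>One array per radius, with names of different lengths, so their number depends on
  \<open>d\<close> only. The names of all other arrays start with a letter other than b, and
  \<open>reach_neq\<close> uses this to tell them apart.\<close>

definition reach :: "nat \<Rightarrow> string" where
  "reach r = CHR ''b'' # replicate r CHR ''b''"

lemma reach_inj [simp]: "reach r = reach r' \<longleftrightarrow> r = r'"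
  unfolding reach_def by (metis length_replicate list.inject)

lemma reach_neq [simp]: "hd x \<noteq> CHR ''b'' \<Longrightarrow> reach r \<noteq> x" "hd x \<noteq> CHR ''b'' \<Longrightarrow> x \<noteq> reach r"
  by (auto simp: reach_def)

definition cell :: "string \<Rightarrow> string \<Rightarrow> string \<Rightarrow> nexp \<Rightarrow> nexp" where
  "cell A base i e = NArr A (NPlus (NArr base (NVar i)) e)"

lemma nval_cell [simp]: "nval (cell A base i e) s = narr s A (narr s base (nvar s i) + nval e s)"
  by (simp add: cell_def)

definition next_of :: "string \<Rightarrow> nexp \<Rightarrow> nexp" where
  "next_of a e = NArr a (NPlus e n1)"

lemma nval_next_of [simp]: "nval (next_of a e) s = narr s a (Suc (nval e s))"
  by (simp add: next_of_def)

lemma stores_blocks_block: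
  assumes "stores_blocks n off dat F" "i < n"
  shows "off i \<le> off (Suc i)" "off (Suc i) - off i = card (F i)"
    "(\<exists>z. off i \<le> z \<and> z < off (Suc i) \<and> P (dat z)) \<longleftrightarrow> (\<exists>x\<in>F i. P x)"
    "off i \<le> z \<Longrightarrow> z < off (Suc i) \<Longrightarrow> dat z \<in> F i"
proof -
  from assms have *: "off i \<le> off (Suc i)" "bij_betw dat {off i..<off (Suc i)} (F i)"
    by (auto simp: stores_blocks_def)
  from *(1) show "off i \<le> off (Suc i)" .
  from bij_betw_same_card[OF *(2)] show "off (Suc i) - off i = card (F i)" by simp
  from *(2) have F: "F i = dat ` {off i..<off (Suc i)}" by (simp add: bij_betw_def)
  show "(\<exists>z. off i \<le> z \<and> z < off (Suc i) \<and> P (dat z)) \<longleftrightarrow> (\<exists>x\<in>F i. P x)"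
    unfolding F by auto
  show "off i \<le> z \<Longrightarrow> z < off (Suc i) \<Longrightarrow> dat z \<in> F i" unfolding F by simp
qed

definition Reach0 :: com where
  "Reach0 = Tab (reach 0) ''mV'' (NVar ''nJ'') (NVar ''nV'') n0
     (NArr ''HV_off'' (NVar ''x'')) (next_of ''HV_off'' (NVar ''x''))
     (NEq (NArr ''HV_dat'' (NVar ''z'')) (NVar ''y'')) n1"

definition ReachS :: "nat \<Rightarrow> com" where
  "ReachS q = Tab (reach (Suc q)) ''mV'' (NVar ''nJ'') (NVar ''nV'') (cell (reach q) ''mV'' ''x'' (NVar ''y''))
     (NArr ''G_off'' (NVar ''y'')) (next_of ''G_off'' (NVar ''y''))
     (NPos (cell (reach q) ''mV'' ''x'' (NArr ''G_adj'' (NVar ''z'')))) n1"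

text \<open>Conflicts are read directly from the definition of distance: the ball of radius
  \<open>d - 1\<close> around one member against the vertices of the other. The half radius
  \<open>r\<close> serves the bags; \<open>nball_meets_iff\<close> reconciles the two views.\<close>

definition Conf :: "nat \<Rightarrow> com" where
  "Conf d = Tab ''conf'' ''mn'' (NVar ''nJ'') (NVar ''nJ'') n0 n0 (NVar ''nV'')
     (BAnd (NPos (cell (reach (d - 1)) ''mV'' ''x'' (NVar ''z''))) (NPos (cell (reach 0) ''mV'' ''y'' (NVar ''z''))))
     n1"

section \<open>A fixed nonempty instance: balls and the conflict table\<close>

locale packing_instance =
  fixes d k r :: nat and G :: "nat graph" and H :: "nat \<Rightarrow> nat graph" and w :: "nat \<Rightarrow> rat"
    and T :: "nat graph" and X :: "nat \<Rightarrow> nat set" and n V m N :: nat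
  assumes d: "d = 2 * r + 2"
    and G: "fin_graph G" and vG: "verts G = {..<V}" and vT: "verts T = {..<m}"
    and H: "\<And>j. j < n \<Longrightarrow> subgraph (H j) G \<and> connected_graph (H j) \<and> verts (H j) \<noteq> {}"
    and td: "tree_decomposition G T X" and alpha: "td_independence_number G T X \<le> k"
    and n: "0 < n" and N: "N = Suc n ^ k"
begin

abbreviation enc :: "state \<Rightarrow> bool" where
  "enc s \<equiv> encodes_instance s G {..<n} H w T X"

abbreviation reached :: "nat \<Rightarrow> nat \<Rightarrow> nat set" where
  "reached q j \<equiv> nball G (verts (H j)) q"

lemma tree_T: "is_tree T"
  using td by (simp add: tree_decomposition_def)

lemma m: "0 < m"
  using tree_T vT by (auto simp: is_tree_def lessThan_empty_iff)

lemma HV: "j < n \<Longrightarrow> verts (H j) \<subseteq> {..<V}"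
  using H vG by (auto simp: subgraph_def)

lemma V: "0 < V"
  using H[OF n] HV[OF n] by fastforce

lemma neighbours_G: "neighbours G v \<subseteq> {..<V}"
  using G vG by (auto simp: neighbours_def fin_graph_def)

lemma X_sub: "t < m \<Longrightarrow> X t \<subseteq> {..<V}"
  using td vG vT by (auto simp: tree_decomposition_def)

lemma card_le_V: "A \<subseteq> {..<V} \<Longrightarrow> card A \<le> V"
  using card_mono[of "{..<V}" A] by simp

lemma enc_vars:
  assumes "enc s"
  shows "nvar s ''nV'' = V" "nvar s ''nJ'' = n" "nvar s ''nT'' = m"
  using assms vG vT by (simp_all add: encodes_instance_def)

lemma enc_blocks:
  assumes "enc s"
  shows "stores_blocks V (narr s ''G_off'') (narr s ''G_adj'') (neighbours G)"
    "stores_blocks m (narr s ''T_off'') (narr s ''T_adj'') (neighbours T)"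
    "stores_blocks m (narr s ''X_off'') (narr s ''X_dat'') X"
    "stores_blocks n (narr s ''HV_off'') (narr s ''HV_dat'') (\<lambda>j. verts (H j))"
  using assms enc_vars[OF assms] by (simp_all add: encodes_instance_def)

lemma enc_weight: "enc s \<Longrightarrow> j < n \<Longrightarrow> warr s ''w'' j = w j"
  by (simp add: encodes_instance_def)

definition input_vars :: "string set" where
  "input_vars = {''nV'', ''nJ'', ''nT''}"

definition input_arrs :: "string set" where
  "input_arrs = {''G_off'', ''G_adj'', ''T_off'', ''T_adj'', ''X_off'', ''X_dat'',
     ''HV_off'', ''HV_dat'', ''HE_off'', ''HE_fst'', ''HE_snd''}"

lemma enc_framed:
  assumes "enc s" "framed c s s'" "nvars_of c \<inter> input_vars = {}" "narrs_of c \<inter> input_arrs = {}"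
    "''w'' \<notin> warrs_of c"
  shows "enc s'"
proof -
  have v: "nvar s' x = nvar s x" if "x \<in> input_vars" for x
    using assms(2,3) that by (auto simp: framed_def)
  have a: "narr s' x = narr s x" if "x \<in> input_arrs" for x
    using assms(2,4) that by (auto simp: framed_def)
  have "warr s' ''w'' = warr s ''w''" using assms(2,5) by (auto simp: framed_def)
  then show ?thesis using assms(1) v a
    unfolding encodes_instance_def input_vars_def input_arrs_def by simp
qed

definition tabs :: "state \<Rightarrow> bool" where
  "tabs = tables_ok n V m N"

lemma tabs_framed:
  assumes "tabs s" "framed c s s'" "''N'' \<notin> nvars_of c"
    "narrs_of c \<inter> {''pw'', ''mV'', ''mn'', ''mN'', ''mS'', ''dv''} = {}"
  shows "tabs s'"
proof -
  have "narr s' x = narr s x" if "x \<in> {''pw'', ''mV'', ''mn'', ''mN'', ''mS'', ''dv''}" for x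
    using assms(2,4) that by (auto simp: framed_def)
  moreover have "nvar s' ''N'' = nvar s ''N''" using assms(2,3) by (auto simp: framed_def)
  ultimately show ?thesis using assms(1) unfolding tabs_def tables_ok_def by simp
qed

lemma tabsD:
  assumes "tabs s"
  shows "nvar s ''N'' = N" "i < n + m + 1 \<Longrightarrow> narr s ''pw'' i = 2 ^ i" "i < n \<Longrightarrow> narr s ''mV'' i = i * V"
    "i < n + m + N + 1 \<Longrightarrow> narr s ''mn'' i = i * n" "i < m + 1 \<Longrightarrow> narr s ''mN'' i = i * N"
    "i < N + 1 \<Longrightarrow> narr s ''mS'' i = i * Suc n" "i < N \<Longrightarrow> narr s ''dv'' i = i div Suc n"
  using assms by (auto simp: tabs_def tables_ok_def)

definition reach_ok :: "nat \<Rightarrow> state \<Rightarrow> bool" where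
  "reach_ok q s \<longleftrightarrow> (\<forall>j<n. \<forall>v<V. 0 < narr s (reach q) (j * V + v) \<longleftrightarrow> v \<in> reached q j)"

lemma reach_ok_framed:
  "reach_ok q s \<Longrightarrow> framed c s s' \<Longrightarrow> reach q \<notin> narrs_of c \<Longrightarrow> reach_ok q s'"
  by (simp add: reach_ok_def framed_def)

lemma reach_okD: "reach_ok q s \<Longrightarrow> j < n \<Longrightarrow> v < V \<Longrightarrow> 0 < narr s (reach q) (j * V + v) \<longleftrightarrow> v \<in> reached q j"
  by (simp add: reach_ok_def)

abbreviation "reach_time \<equiv> n * (V * (V * 4 + 6) + 4) + 2"

lemma runs_Reach0:
  assumes s: "enc s" "tabs s"
  shows "runs Reach0 s reach_time (reach_ok 0)"
  unfolding Reach0_def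
proof (rule runs_mono[OF runs_Tab_ex[where R = n and C = V and D = V and v = "\<lambda>_ _. 0" and L = V
        and P = "\<lambda>i j z. narr s ''HV_dat'' z = j" and l = "\<lambda>i j. narr s ''HV_off'' i"
        and h = "\<lambda>i j. narr s ''HV_off'' (Suc i)"] order.refl])
  note b = stores_blocks_block[OF enc_blocks(4)[OF s(1)]]
  show "\<And>i j. i < n \<Longrightarrow> narr s ''HV_off'' i \<le> narr s ''HV_off'' (Suc i) \<and>
      narr s ''HV_off'' (Suc i) - narr s ''HV_off'' i \<le> V"
    using b(1,2) HV card_le_V by simp
  fix s' :: state
  assume "\<forall>i<n. \<forall>j<V. 0 < narr s' (reach 0) (i * V + j) \<longleftrightarrow>
      0 < (0::nat) \<or> (\<exists>z. narr s ''HV_off'' i \<le> z \<and> z < narr s ''HV_off'' (Suc i) \<and> narr s ''HV_dat'' z = j)"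
  then show "reach_ok 0 s'" using b(3)[of _ "\<lambda>x. x = _"] by (simp add: reach_ok_def)
qed (use enc_vars[OF s(1)] tabsD[OF s(2)] in \<open>simp_all add: eq_off_def\<close>)

lemma runs_ReachS:
  assumes s: "enc s" "tabs s" "reach_ok q s"
  shows "runs (ReachS q) s reach_time (reach_ok (Suc q))"
  unfolding ReachS_def
proof (rule runs_mono[OF runs_Tab_ex[where R = n and C = V and D = V and L = V
        and v = "\<lambda>i j. narr s (reach q) (i * V + j)"
        and P = "\<lambda>i j z. narr s ''G_adj'' z \<in> reached q i" and l = "\<lambda>i j. narr s ''G_off'' j"
        and h = "\<lambda>i j. narr s ''G_off'' (Suc j)"] order.refl])
  note b = stores_blocks_block[OF enc_blocks(1)[OF s(1)]]
  show "\<And>i j. j < V \<Longrightarrow> narr s ''G_off'' j \<le> narr s ''G_off'' (Suc j) \<and>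
      narr s ''G_off'' (Suc j) - narr s ''G_off'' j \<le> V"
    using b(1,2) neighbours_G card_le_V by simp
  fix s' i j z
  assume "tab_eq (reach (Suc q)) s s'" "nvar s' ''x'' = i" "i < n" "j < V" "nvar s' ''z'' = z"
    "narr s ''G_off'' j \<le> z" "z < narr s ''G_off'' (Suc j)"
  moreover have "narr s ''G_adj'' z < V" using b(4) calculation neighbours_G by blast
  ultimately show "bval (NPos (cell (reach q) ''mV'' ''x'' (NArr ''G_adj'' (NVar ''z'')))) s' \<longleftrightarrow>
      narr s ''G_adj'' z \<in> reached q i"
    using tabsD(3)[OF s(2)] reach_okD[OF s(3)] by (simp add: eq_off_def)
next
  note b = stores_blocks_block[OF enc_blocks(1)[OF s(1)]]
  fix s' :: state
  assume *: "\<forall>i<n. \<forall>j<V. 0 < narr s' (reach (Suc q)) (i * V + j) \<longleftrightarrow>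
      0 < narr s (reach q) (i * V + j) \<or>
      (\<exists>z. narr s ''G_off'' j \<le> z \<and> z < narr s ''G_off'' (Suc j) \<and> narr s ''G_adj'' z \<in> reached q i)"
  show "reach_ok (Suc q) s'"
    unfolding reach_ok_def
  proof (intro allI impI)
    fix i v assume "i < n" "v < V"
    with * b(3)[OF \<open>v < V\<close>, of "\<lambda>x. x \<in> reached q i"] reach_okD[OF s(3)]
    show "0 < narr s' (reach (Suc q)) (i * V + v) \<longleftrightarrow> v \<in> reached (Suc q) i"
      by (auto simp: neighbours_def)
  qed
qed (use enc_vars[OF s(1)] tabsD(3)[OF s(2)] in \<open>simp_all add: eq_off_def\<close>)

definition confl :: "nat \<Rightarrow> nat \<Rightarrow> bool" where
  "confl i j \<longleftrightarrow> reached (d - 1) i \<inter> verts (H j) \<noteq> {}"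

definition confl_ok :: "state \<Rightarrow> bool" where
  "confl_ok s \<longleftrightarrow> (\<forall>i<n. \<forall>j<n. 0 < narr s ''conf'' (i * n + j) \<longleftrightarrow> confl i j)"

lemma confl_ok_framed: "confl_ok s \<Longrightarrow> framed c s s' \<Longrightarrow> ''conf'' \<notin> narrs_of c \<Longrightarrow> confl_ok s'"
  by (simp add: confl_ok_def framed_def)

lemma runs_Conf:
  assumes s: "enc s" "tabs s" "reach_ok 0 s" "reach_ok (d - 1) s"
  shows "runs (Conf d) s (n * (n * (V * 4 + 6) + 4) + 2) confl_ok"
  unfolding Conf_def
proof (rule runs_mono[OF runs_Tab_ex[where R = n and C = n and D = n and L = V
        and v = "\<lambda>i j. 0" and P = "\<lambda>i j z. z \<in> reached (d - 1) i \<and> z \<in> verts (H j)"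
        and l = "\<lambda>i j. 0" and h = "\<lambda>i j. V"] order.refl])
  fix s' :: state
  assume *: "\<forall>i<n. \<forall>j<n. 0 < narr s' ''conf'' (i * n + j) \<longleftrightarrow>
      0 < (0::nat) \<or> (\<exists>z. 0 \<le> z \<and> z < V \<and> z \<in> reached (d - 1) i \<and> z \<in> verts (H j))"
  show "confl_ok s'"
    unfolding confl_ok_def confl_def
  proof (intro allI impI)
    fix i j assume ij: "i < n" "j < n"
    then have "0 < narr s' ''conf'' (i * n + j) \<longleftrightarrow> (\<exists>z. z < V \<and> z \<in> reached (d - 1) i \<and> z \<in> verts (H j))"
      using * by simp
    also have "\<dots> \<longleftrightarrow> reached (d - 1) i \<inter> verts (H j) \<noteq> {}" using HV[OF ij(2)] by blast
    finally show "0 < narr s' ''conf'' (i * n + j) \<longleftrightarrow> reached (d - 1) i \<inter> verts (H j) \<noteq> {}" .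
  qed
qed (use enc_vars[OF s(1)] tabsD(3,4)[OF s(2)] reach_okD[OF s(3)] reach_okD[OF s(4)] in \<open>simp_all add: eq_off_def\<close>)

end

section \<open>Searching the tree\<close>

text \<open>The array \<open>ord\<close> is both the queue of the search and its result:
  \<open>h\<close> is the head of the queue and \<open>cnt\<close> the first free position.\<close>

definition Visit :: com where
  "Visit = Seq (NStore ''ord'' (NVar ''cnt'') (NArr ''T_adj'' (NVar ''z'')))
    (Seq (NStore ''pp'' (NVar ''cnt'') (NVar ''h''))
    (Seq (NStore ''seen'' (NArr ''T_adj'' (NVar ''z'')) n1)
      (NAssign ''cnt'' (NPlus (NVar ''cnt'') n1))))"

definition Scan :: com where
  "Scan = For ''z'' (NArr ''T_off'' (NArr ''ord'' (NVar ''h''))) (next_of ''T_off'' (NArr ''ord'' (NVar ''h'')))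
     (Cond (NPos (NArr ''seen'' (NArr ''T_adj'' (NVar ''z'')))) Skip Visit)"

text \<open>The search starts at node 0 in position 1. Position 0 is the auxiliary root:
  \<open>ord 0 = 0\<close> merely gives lookups a legal node, and the parent of positions 0 and 1 is
  0.\<close>

abbreviation search_start :: com where
  "search_start \<equiv> Seq (NStore ''ord'' n0 n0) (Seq (NStore ''ord'' n1 n0)
    (Seq (NStore ''pp'' n0 n0) (Seq (NStore ''pp'' n1 n0)
    (Seq (NStore ''seen'' n0 n1) (Seq (NAssign ''cnt'' (NConst 2)) (NAssign ''h'' n1))))))"

definition SearchInit :: com where
  "SearchInit = Seq (For ''x'' n0 (NVar ''nT'') (NStore ''seen'' (NVar ''x'') n0))
    search_start"

definition Search :: com where
  "Search = Seq SearchInit (While (NLess (NVar ''h'') (NPlus (NVar ''nT'') n1))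
     (Seq Scan (NAssign ''h'' (NPlus (NVar ''h'') n1))))"

lemma mods_Scan [unfolded mods_def prod.inject, simp]:
  "mods Scan = ({''z'', ''cnt''}, {''ord'', ''pp'', ''seen''}, {}, {})"
  by (auto simp: mods_def Scan_def Visit_def)

lemma mods_SearchInit [unfolded mods_def prod.inject, simp]:
  "mods SearchInit = ({''x'', ''cnt'', ''h''}, {''ord'', ''pp'', ''seen''}, {}, {})"
  by (auto simp: mods_def SearchInit_def)

lemma mods_Search [unfolded mods_def prod.inject, simp]:
  "mods Search = ({''x'', ''z'', ''cnt'', ''h''}, {''ord'', ''pp'', ''seen''}, {}, {})"
  by (auto simp: mods_def Search_def)

lemma runs_Seq_NStore:
  assumes "runs c (s\<lparr>narr := (narr s)(a := (narr s a)(nval i s := nval e s))\<rparr>) t Q" "Suc t \<le> t'"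
  shows "runs (Seq (NStore a i e) c) s t' Q"
  by (rule runs_Seq[OF runs_NStore[where Q = "\<lambda>s'. s' = s\<lparr>narr := (narr s)(a := (narr s a)(nval i s := nval e s))\<rparr>" and t = 1]])
    (use assms in auto)

lemma runs_Seq_NAssign:
  assumes "runs c (setn s x (nval e s)) t Q" "Suc t \<le> t'"
  shows "runs (Seq (NAssign x e) c) s t' Q"
  by (rule runs_Seq[OF runs_NAssign[where Q = "\<lambda>s'. s' = setn s x (nval e s)" and t = 1]])
    (use assms in auto)

lemma runs_Seq_WStore:
  assumes "runs c (s\<lparr>warr := (warr s)(a := (warr s a)(nval i s := wval e s))\<rparr>) t Q" "Suc t \<le> t'"
  shows "runs (Seq (WStore a i e) c) s t' Q"
  by (rule runs_Seq[OF runs_WStore[where Q = "\<lambda>s'. s' = s\<lparr>warr := (warr s)(a := (warr s a)(nval i s := wval e s))\<rparr>" and t = 1]])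
    (use assms in auto)

context packing_instance
begin

text \<open>Positions \<open>1, \<dots>, c - 1\<close> have been discovered and positions below \<open>h\<close> have been scanned.\<close>

definition search_inv :: "(nat \<Rightarrow> nat) \<Rightarrow> (nat \<Rightarrow> nat) \<Rightarrow> (nat \<Rightarrow> nat) \<Rightarrow> nat \<Rightarrow> nat \<Rightarrow> bool" where
  "search_inv ord p seen c h \<longleftrightarrow> 2 \<le> c \<and> 1 \<le> h \<and> h \<le> c \<and> inj_on ord {1..<c} \<and>
     ord ` {1..<c} = {t. t < m \<and> 0 < seen t} \<and> ord 0 = 0 \<and> ord 1 = 0 \<and> p 0 = 0 \<and> p 1 = 0 \<and>
     (\<forall>x. 2 \<le> x \<longrightarrow> x < c \<longrightarrow> 1 \<le> p x \<and> p x < x \<and> {ord x, ord (p x)} \<in> edges T) \<and>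
     (\<forall>x. 1 \<le> x \<longrightarrow> x < h \<longrightarrow> neighbours T (ord x) \<subseteq> ord ` {1..<c})"

lemma neighbours_T: "neighbours T t \<subseteq> {..<m}"
  using tree_T vT by (auto simp: neighbours_def is_tree_def fin_graph_def)

lemma search_inv_visit:
  assumes "search_inv ord p seen c h" "h < c" "u \<in> neighbours T (ord h)" "\<not> 0 < seen u"
  shows "search_inv (ord(c := u)) (p(c := h)) (seen(u := 1)) (Suc c) h"
proof -
  have um: "u < m" using assms(3) neighbours_T by blast
  have c: "2 \<le> c" "1 \<le> h" using assms(1) by (simp_all add: search_inv_def)
  have img: "ord ` {1..<c} = {t. t < m \<and> 0 < seen t}" and inj: "inj_on ord {1..<c}"
    using assms(1) by (simp_all add: search_inv_def)
  have eq: "{1..<Suc c} = insert c {1..<c}" using c by auto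
  have same: "(ord(c := u)) ` {1..<c} = ord ` {1..<c}" by (rule image_cong) auto
  have img': "(ord(c := u)) ` {1..<Suc c} = insert u (ord ` {1..<c})"
    unfolding eq image_insert same by simp
  have "inj_on (ord(c := u)) {1..<Suc c}"
    unfolding eq inj_on_insert
  proof
    show "inj_on (ord(c := u)) {1..<c}" using inj by (subst inj_on_cong[of _ _ ord]) auto
    have "{1..<c} - {c} = {1..<c}" by auto
    then show "(ord(c := u)) c \<notin> (ord(c := u)) ` ({1..<c} - {c})"
      using img assms(4) same by simp
  qed
  moreover have "(ord(c := u)) ` {1..<Suc c} = {t. t < m \<and> 0 < (seen(u := 1)) t}"
    unfolding img' img using um by auto
  moreover have "{u, ord h} \<in> edges T" using assms(3) by (simp add: neighbours_def)
  ultimately show ?thesis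
  proof -
    have o: "(ord(c := u)) x = ord x" "(p(c := h)) x = p x" if "x < c" for x using that by simp_all
    have "1 \<le> (p(c := h)) x \<and> (p(c := h)) x < x \<and> {(ord(c := u)) x, (ord(c := u)) ((p(c := h)) x)} \<in> edges T"
      if "2 \<le> x" "x < Suc c" for x
    proof (cases "x = c")
      case True
      then show ?thesis using c assms(2) \<open>{u, ord h} \<in> edges T\<close> by simp
    next
      case False
      with that have "x < c" by simp
      moreover have "1 \<le> p x \<and> p x < x \<and> {ord x, ord (p x)} \<in> edges T"
        using assms(1) that(1) \<open>x < c\<close> unfolding search_inv_def by blast
      ultimately show ?thesis using o by simp
    qed
    moreover have "neighbours T ((ord(c := u)) x) \<subseteq> (ord(c := u)) ` {1..<Suc c}" if "1 \<le> x" "x < h" for x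
    proof -
      have "neighbours T (ord x) \<subseteq> ord ` {1..<c}"
        using assms(1) that unfolding search_inv_def by blast
      then show ?thesis unfolding img' using that assms(2) by auto
    qed
    ultimately show ?thesis
      using assms(1,2) c \<open>inj_on (ord(c := u)) {1..<Suc c}\<close>
        \<open>(ord(c := u)) ` {1..<Suc c} = {t. t < m \<and> 0 < (seen(u := 1)) t}\<close>
      unfolding search_inv_def by simp
  qed
qed

lemma search_inv_scanned:
  assumes "search_inv ord p seen c h" "h < c" "neighbours T (ord h) \<subseteq> {t. t < m \<and> 0 < seen t}"
  shows "search_inv ord p seen c (Suc h)"
proof -
  have "neighbours T (ord x) \<subseteq> ord ` {1..<c}" if "1 \<le> x" "x < Suc h" for x
  proof (cases "x = h")
    case True
    with assms show ?thesis by (simp add: search_inv_def)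
  next
    case False
    with that have "x < h" by simp
    with assms(1) that(1) show ?thesis unfolding search_inv_def by blast
  qed
  then show ?thesis using assms(1,2) unfolding search_inv_def by simp
qed

text \<open>An exhausted queue would mean that the discovered nodes are closed under taking
  neighbours. They include node 0 but number only \<open>c - 1 < m\<close>, which contradicts the
  connectedness of the tree.\<close>

lemma search_inv_frontier:
  assumes "search_inv ord p seen c h" "h \<le> m"
  shows "h < c"
proof (rule ccontr)
  assume "\<not> h < c"
  with assms(1) have hc: "h = c" by (simp add: search_inv_def)
  define A where "A = ord ` {1..<c}"
  have A: "A \<subseteq> {..<m}" "inj_on ord {1..<c}" using assms(1) by (auto simp: search_inv_def A_def)
  have "1 \<in> {1..<c}" "ord 1 = 0" using assms(1) by (auto simp: search_inv_def)
  then have "0 \<in> A" unfolding A_def by (metis image_eqI)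
  have "card A = c - 1" using A(2) by (simp add: A_def card_image)
  then have "A \<noteq> {..<m}" using assms hc by (auto simp: search_inv_def)
  then obtain t where "t < m" "t \<notin> A" using A(1) by blast
  moreover have "linked (edges T) {..<m}"
    using connected_graph_linked[of T "edges T"] tree_T vT by (simp add: is_tree_def)
  moreover have "0 \<in> {..<m} \<inter> A" using \<open>0 \<in> A\<close> m by simp
  ultimately obtain u v where uv: "u \<in> A" "v \<notin> A" "{u, v} \<in> edges T"
    unfolding linked_def by (blast dest!: spec[of _ A])
  then obtain x where x: "1 \<le> x" "x < c" "u = ord x" by (auto simp: A_def)
  with uv have "v \<in> neighbours T (ord x)" by (simp add: neighbours_def insert_commute)
  with x assms(1) hc uv show False unfolding search_inv_def A_def by blast
qed

abbreviation "sinv s h \<equiv> search_inv (narr s ''ord'') (narr s ''pp'') (narr s ''seen'') (nvar s ''cnt'') h"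

lemma runs_Scan:
  assumes s: "enc s" "sinv s h" "h < nvar s ''cnt''" "nvar s ''h'' = h"
  shows "runs Scan s (card (neighbours T (narr s ''ord'' h)) * 7 + 2)
    (\<lambda>s'. sinv s' (Suc h) \<and> (\<forall>x\<le>h. narr s' ''ord'' x = narr s ''ord'' x))"
proof -
  define t where "t = narr s ''ord'' h"
  have h1: "1 \<le> h" using s(2) by (simp add: search_inv_def)
  then have "t \<in> narr s ''ord'' ` {1..<nvar s ''cnt''}" using s(3) by (simp add: t_def)
  with s(2) have tm: "t < m" by (simp add: search_inv_def)
  note b = stores_blocks_block[OF enc_blocks(2)[OF s(1)] tm]
  let ?l = "narr s ''T_off'' t" and ?h = "narr s ''T_off'' (Suc t)"
  let ?adj = "narr s ''T_adj''"
  let ?I = "\<lambda>i s'. sinv s' h \<and> h < nvar s' ''cnt'' \<and> (\<forall>x\<le>h. narr s' ''ord'' x = narr s ''ord'' x) \<and>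
      (\<forall>z. ?l \<le> z \<longrightarrow> z < i \<longrightarrow> 0 < narr s' ''seen'' (?adj z))"
  let ?c = "Cond (NPos (NArr ''seen'' (NArr ''T_adj'' (NVar ''z'')))) Skip Visit"
  have fr: "narr s' ''T_off'' = narr s ''T_off''" "narr s' ''T_adj'' = ?adj" "nvar s' ''h'' = h"
    if "framed Scan s s'" for s'
    using that s(4) by (simp_all add: framed_def)
  have "runs Scan s (card (neighbours T t) * 7 + 2) (?I ?h)"
    unfolding Scan_def
  proof (rule runs_For[where u = 5 and l = ?l and h = ?h])
    show "nval (NArr ''T_off'' (NArr ''ord'' (NVar ''h''))) s = ?l" by (simp add: s(4) t_def)
    show "?l \<le> ?h" by (rule b(1))
    show "?I ?l (setn s ''z'' ?l)" using s(2,3) by simp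
    show "''z'' \<notin> nvars_of ?c" by (simp add: Visit_def)
    show "(?h - ?l) * (5 + 2) + 2 \<le> card (neighbours T t) * 7 + 2" by (simp add: b(2))
  next
    fix i s' assume "?I i s'" and f: "framed (For ''z'' (NArr ''T_off'' (NArr ''ord'' (NVar ''h'')))
          (next_of ''T_off'' (NArr ''ord'' (NVar ''h''))) ?c) s s'"
    with fr[OF f[folded Scan_def]] show "nval (next_of ''T_off'' (NArr ''ord'' (NVar ''h''))) s' = ?h"
      by (simp add: t_def)
  next
    fix i s' assume i: "?l \<le> i" "i < ?h" and I: "?I i s'" and z: "nvar s' ''z'' = i"
      and f: "framed (For ''z'' (NArr ''T_off'' (NArr ''ord'' (NVar ''h'')))
          (next_of ''T_off'' (NArr ''ord'' (NVar ''h''))) ?c) s s'"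
    note f' = fr[OF f[folded Scan_def]]
    define u where "u = ?adj i"
    have u: "u \<in> neighbours T t" using b(4)[OF i] by (simp add: u_def)
    show "runs ?c s' 5 (\<lambda>s''. ?I (Suc i) (setn s'' ''z'' (Suc i)))"
    proof (rule runs_Cond[where u = 4])
      assume "bval (NPos (NArr ''seen'' (NArr ''T_adj'' (NVar ''z'')))) s'"
      then show "runs Skip s' 4 (\<lambda>s''. ?I (Suc i) (setn s'' ''z'' (Suc i)))"
        using I z f' by (intro runs_Skip) (auto simp: less_Suc_eq)
    next
      assume "\<not> bval (NPos (NArr ''seen'' (NArr ''T_adj'' (NVar ''z'')))) s'"
      then have nu: "\<not> 0 < narr s' ''seen'' u" using z f' by (simp add: u_def)
      let ?C = "nvar s' ''cnt''"
      have "narr s' ''ord'' h = t" using I by (simp add: t_def)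
      with search_inv_visit[of _ _ _ ?C h u] I u nu
      have sv: "search_inv ((narr s' ''ord'')(?C := u)) ((narr s' ''pp'')(?C := h)) ((narr s' ''seen'')(u := 1)) (Suc ?C) h"
        by blast
      show "runs Visit s' 4 (\<lambda>s''. ?I (Suc i) (setn s'' ''z'' (Suc i)))"
        unfolding Visit_def
        apply (rule runs_Seq_NStore[where t = 3], simp only: nval.simps)
         apply (rule runs_Seq_NStore[where t = 2], simp only: nval.simps)
          apply (rule runs_Seq_NStore[where t = 1], simp only: nval.simps)
           apply (rule runs_NAssign, simp only: nval.simps)
        subgoal using sv I z f' by (auto simp: less_Suc_eq u_def)
        by simp_all
    qed simp
  qed
  then show ?thesis
    unfolding t_def[symmetric]
  proof (rule runs_mono[OF _ order.refl])
    fix s' assume I: "?I ?h s'"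
    have "neighbours T t \<subseteq> {u. u < m \<and> 0 < narr s' ''seen'' u}"
    proof
      fix u assume "u \<in> neighbours T t"
      with b(3)[of "\<lambda>x. x = u"] obtain z where "?l \<le> z" "z < ?h" "?adj z = u" by auto
      with I \<open>u \<in> neighbours T t\<close> neighbours_T show "u \<in> {u. u < m \<and> 0 < narr s' ''seen'' u}" by auto
    qed
    moreover have "narr s' ''ord'' h = t" using I by (simp add: t_def)
    ultimately have "sinv s' (Suc h)" using I by (intro search_inv_scanned) auto
    then show "sinv s' (Suc h) \<and> (\<forall>x\<le>h. narr s' ''ord'' x = narr s ''ord'' x)"
      using I by blast
  qed
qed

lemma runs_SearchInit:
  assumes "enc s"
  shows "runs SearchInit s (m * 3 + 10) (\<lambda>s'. sinv s' 1 \<and> nvar s' ''h'' = 1)"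
  unfolding SearchInit_def
proof (rule runs_Seq)
  show "runs (For ''x'' n0 (NVar ''nT'') (NStore ''seen'' (NVar ''x'') n0)) s (m * 3 + 2)
     (\<lambda>s'. \<forall>t<m. narr s' ''seen'' t = 0)"
    by (rule runs_For[where u = 1 and l = 0 and h = m])
      (use enc_vars[OF assms] in \<open>auto simp: framed_def less_Suc_eq intro!: runs_NStore\<close>)
  fix s1 :: state assume s1: "\<forall>t<m. narr s1 ''seen'' t = 0"
  have sv: "search_inv (o1(0 := 0, 1 := 0)) (p1(0 := 0, 1 := 0)) ((narr s1 ''seen'')(0 := 1)) 2 1" for o1 p1
    unfolding search_inv_def using s1 m by (auto simp: numeral_2_eq_2)
  show "runs search_start
    s1 7 (\<lambda>s'. sinv s' 1 \<and> nvar s' ''h'' = 1)"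
    apply (rule runs_Seq_NStore[where t = 6], simp only: nval.simps)
     apply (rule runs_Seq_NStore[where t = 5], simp only: nval.simps)
      apply (rule runs_Seq_NStore[where t = 4], simp only: nval.simps)
       apply (rule runs_Seq_NStore[where t = 3], simp only: nval.simps)
        apply (rule runs_Seq_NStore[where t = 2], simp only: nval.simps)
         apply (rule runs_Seq_NAssign[where t = 1], simp only: nval.simps)
          apply (rule runs_NAssign, simp only: nval.simps)
    subgoal using sv by simp
    by simp_all
qed simp

definition order_ok :: "state \<Rightarrow> bool" where
  "order_ok s \<longleftrightarrow> search_order T m (narr s ''ord'') (narr s ''pp'') \<and>
     narr s ''ord'' 0 = 0 \<and> narr s ''pp'' 0 = 0 \<and> narr s ''pp'' 1 = 0"

text \<open>Injectivity into \<open>m\<close> nodes gives \<open>c - 1 \<le> m\<close>. With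
  \<open>m < h \<le> c\<close> this forces \<open>c = Suc m\<close>, so every node has received a
  position.\<close>

lemma search_inv_final:
  assumes "search_inv ord p seen c h" "m < h"
  shows "search_order T m ord p"
proof -
  have inj: "inj_on ord {1..<c}" and img: "ord ` {1..<c} \<subseteq> {..<m}" and hc: "h \<le> c"
    using assms(1) by (auto simp: search_inv_def)
  then have "c - 1 \<le> m" using card_mono[OF _ img] by (simp add: card_image)
  with hc assms(2) have c: "c = Suc m" by simp
  have "card (ord ` {1..<c}) = m" using inj c by (simp add: card_image)
  then have "ord ` {1..<c} = {..<m}" using img by (intro card_subset_eq) auto
  moreover have "{1..<c} = {1..m}" using c by auto
  ultimately have "bij_betw ord {1..m} (verts T)" using inj vT by (simp add: bij_betw_def)
  then show ?thesis
    using assms(1) c tree_T unfolding search_inv_def by unfold_locales auto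
qed

lemma runs_Search:
  assumes s: "enc s"
  shows "runs Search s (m * 22 + 11) order_ok"
proof -
  \<comment> \<open>Each node not yet scanned holds 7 per neighbour and 5 for the overhead of its
    round. By \<open>degree_sum\<close> the initial amount is at most
    \<open>7 * (2 * m) + 5 * m\<close>.\<close>
  let ?P = "\<lambda>s'. \<Sum>t\<in>{..<m} - narr s' ''ord'' ` {1..<nvar s' ''h''}. card (neighbours T t) * 7 + 5"
  let ?b = "NLess (NVar ''h'') (NPlus (NVar ''nT'') n1)"
  let ?c = "Seq Scan (NAssign ''h'' (NPlus (NVar ''h'') n1))"
  let ?W = "While ?b ?c"
  from runs_SearchInit[OF s] obtain t1 s1 where 1: "exec SearchInit s t1 s1" "t1 \<le> m * 3 + 10"
    and s1: "sinv s1 1" "nvar s1 ''h'' = 1" and f1: "framed SearchInit s s1"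
    by (auto elim: runsE)
  have e1: "enc s1" using enc_framed[OF s f1] by (simp add: input_vars_def input_arrs_def)
  have "runs ?W s1 (?P s1 + 1) (\<lambda>s'. sinv s' (nvar s' ''h'') \<and> \<not> bval ?b s')"
  proof (rule runs_While)
    show "sinv s1 (nvar s1 ''h'')" using s1 by simp
  next
    fix s' assume I: "sinv s' (nvar s' ''h'')" and f: "framed ?c s1 s'" and "bval ?b s'"
    have e: "enc s'" using enc_framed[OF e1 f] by (simp add: input_vars_def input_arrs_def)
    define h where "h = nvar s' ''h''"
    define t where "t = narr s' ''ord'' h"
    have hm: "h \<le> m" using \<open>bval ?b s'\<close> enc_vars[OF e] by (simp add: h_def)
    have hc: "h < nvar s' ''cnt''" using search_inv_frontier[OF I] hm by (simp add: h_def)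
    have h1: "1 \<le> h" using I by (simp add: search_inv_def h_def)
    have inj: "inj_on (narr s' ''ord'') {1..<nvar s' ''cnt''}"
      and img: "narr s' ''ord'' ` {1..<nvar s' ''cnt''} \<subseteq> {..<m}"
      using I by (auto simp: search_inv_def)
    have "h \<in> {1..<nvar s' ''cnt''}" using h1 hc by simp
    with img have tm: "t < m" unfolding t_def by blast
    have new: "t \<notin> narr s' ''ord'' ` {1..<h}"
    proof
      assume "t \<in> narr s' ''ord'' ` {1..<h}"
      then obtain x where "1 \<le> x" "x < h" "narr s' ''ord'' x = narr s' ''ord'' h" by (auto simp: t_def)
      with inj_onD[OF inj, of x h] h1 hc show False by simp
    qed
    have "runs ?c s' (card (neighbours T t) * 7 + 3)
      (\<lambda>s''. sinv s'' (nvar s'' ''h'') \<and> ?P s'' + (card (neighbours T t) * 7 + 3) + 1 \<le> ?P s')"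
    proof (rule runs_Seq[OF runs_Scan[OF e I[folded h_def] hc h_def[symmetric], folded t_def]])
      fix s2 assume s2: "sinv s2 (Suc h) \<and> (\<forall>x\<le>h. narr s2 ''ord'' x = narr s' ''ord'' x)"
        and f2: "framed Scan s' s2"
      have h2: "nvar s2 ''h'' = h" using f2 by (simp add: framed_def h_def)
      have "narr s2 ''ord'' ` {1..<Suc h} = narr s' ''ord'' ` {1..<Suc h}"
        using s2 by (intro image_cong) auto
      also have "\<dots> = insert t (narr s' ''ord'' ` {1..<h})"
        using h1 by (simp add: t_def atLeastLessThanSuc)
      finally have img2: "narr s2 ''ord'' ` {1..<Suc h} = insert t (narr s' ''ord'' ` {1..<h})" .
      then have "{..<m} - narr s' ''ord'' ` {1..<h} = insert t ({..<m} - narr s2 ''ord'' ` {1..<Suc h})"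
        using tm new by auto
      moreover have "t \<notin> {..<m} - narr s2 ''ord'' ` {1..<Suc h}"
        using img2 by simp
      ultimately have "(\<Sum>t\<in>{..<m} - narr s' ''ord'' ` {1..<h}. card (neighbours T t) * 7 + 5) =
          card (neighbours T t) * 7 + 5 +
          (\<Sum>t\<in>{..<m} - narr s2 ''ord'' ` {1..<Suc h}. card (neighbours T t) * 7 + 5)"
        by simp
      then show "runs (NAssign ''h'' (NPlus (NVar ''h'') n1)) s2 1
          (\<lambda>s''. sinv s'' (nvar s'' ''h'') \<and> ?P s'' + (card (neighbours T t) * 7 + 3) + 1 \<le> ?P s')"
        using s2 h2 by (intro runs_NAssign) (auto simp: h_def)
    qed simp
    then show "\<exists>u. runs ?c s' u (\<lambda>s''. sinv s'' (nvar s'' ''h'') \<and> ?P s'' + u + 1 \<le> ?P s')" by blast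
  qed
  then obtain t2 s2 where 2: "exec ?W s1 t2 s2" "t2 \<le> ?P s1 + 1"
    and s2: "sinv s2 (nvar s2 ''h'')" "\<not> bval ?b s2" and f2: "framed ?W s1 s2"
    by (auto elim: runsE)
  have e2: "enc s2" using enc_framed[OF e1 f2] by (simp add: input_vars_def input_arrs_def)
  have "m < nvar s2 ''h''" using s2(2) enc_vars[OF e2] by simp
  from search_inv_final[OF s2(1) this]
  interpret search_order T m "narr s2 ''ord''" "narr s2 ''pp''" .
  have "?P s1 = (\<Sum>t\<in>verts T. card (neighbours T t)) * 7 + 5 * m"
    using s1(2) vT by (simp add: sum.distrib sum_distrib_right)
  then have "?P s1 \<le> 19 * m" using degree_sum by simp
  then have "t1 + t2 \<le> m * 22 + 11" using 1(2) 2(2) by simp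
  moreover have "order_ok s2"
    using s2(1) search_order_axioms by (simp add: order_ok_def search_inv_def)
  ultimately show ?thesis
    unfolding runs_def Search_def using exec.Seq[OF 1(1) 2(1)] by blast
qed

end

section \<open>Bags of members\<close>

text \<open>The test \<open>NPos (NVar ''x'')\<close> empties row 0, the auxiliary root. Rows follow
  the search order, so the bag is found through the node \<open>ord\<close> assigns to the
  row.\<close>

definition Bags :: "nat \<Rightarrow> com" where
  "Bags r = Tab ''Y'' ''mn'' (NPlus (NVar ''nT'') n1) (NVar ''nJ'') n0
     (NArr ''X_off'' (NArr ''ord'' (NVar ''x''))) (next_of ''X_off'' (NArr ''ord'' (NVar ''x'')))
     (BAnd (NPos (NVar ''x'')) (NPos (cell (reach r) ''mV'' ''y'' (NArr ''X_dat'' (NVar ''z'')))))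
     n1"

definition Mem :: "nat \<Rightarrow> com" where
  "Mem k = Tab ''mem'' ''mn'' (NVar ''N'') (NVar ''nJ'') n0 n0 n1
     (digit_cond k (NVar ''x'')) n1"

text \<open>A \<open>Tab\<close> has only three indices, so conflicts inside a subset are detected
  in two stages: the present table fixes one member and looks for a partner, \<open>Dep\<close> then
  quantifies over the member. This costs about \<open>|J|^2\<close> per subset, independently of the
  bags. Partners are taken larger because every member conflicts with itself.\<close>

definition Later :: com where
  "Later = Tab ''cs'' ''mn'' (NVar ''N'') (NVar ''nJ'') n0 n0 (NVar ''nJ'')
     (BAnd (NLess (NVar ''y'') (NVar ''z'')) (BAnd (NPos (cell ''mem'' ''mn'' ''x'' (NVar ''z'')))
       (NPos (cell ''conf'' ''mn'' ''y'' (NVar ''z'')))))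
     n1"

text \<open>A single column, stored with row stride \<open>n\<close> so that the multiples in
  \<open>mn\<close> can be reused.\<close>

definition Dep :: com where
  "Dep = Tab ''dep'' ''mn'' (NVar ''N'') n1 n0 n0 (NVar ''nJ'')
     (BAnd (NPos (cell ''mem'' ''mn'' ''x'' (NVar ''z''))) (NPos (cell ''cs'' ''mn'' ''x'' (NVar ''z''))))
     n1"

definition NSub :: com where
  "NSub = Tab ''nsub'' ''mN'' (NPlus (NVar ''nT'') n1) (NVar ''N'') n0 n0 (NVar ''nJ'')
     (BAnd (NPos (cell ''mem'' ''mn'' ''y'' (NVar ''z''))) (BNot (NPos (cell ''Y'' ''mn'' ''x'' (NVar ''z'')))))
     n1"

definition Code :: com where
  "Code = Tab ''code'' ''mN'' (NPlus (NVar ''nT'') n1) (NVar ''N'') n0 n0 (NVar ''nJ'')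
     (BAnd (NPos (cell ''mem'' ''mn'' ''y'' (NVar ''z''))) (NPos (cell ''Y'' ''mn'' ''x'' (NVar ''z''))))
     (NArr ''pw'' (NVar ''z''))"

text \<open>The potentials before any message: a member also present in the parent bag is left out,
  as its weight is counted closer to the root.\<close>

definition Phi :: com where
  "Phi = WTab ''phi'' ''mN'' (NPlus (NVar ''nT'') n1) (NVar ''N'') (NVar ''nJ'')
     (BAnd (NPos (cell ''mem'' ''mn'' ''y'' (NVar ''z'')))
       (BNot (NPos (NArr ''Y'' (NPlus (NArr ''mn'' (NArr ''pp'' (NVar ''x''))) (NVar ''z''))))))
     (WArr ''w'' (NVar ''z''))"

section \<open>The family as a bag sequence, and the tables over its subsets\<close>

locale ordered_instance = packing_instance +
  fixes nd p :: "nat \<Rightarrow> nat"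
  assumes order: "search_order T m nd p" and o0: "nd 0 = 0" and p0: "p 0 = 0" and p1: "p 1 = 0"
begin

lemma o_less: "i \<le> m \<Longrightarrow> nd i < m"
proof (cases "i = 0")
  case False
  assume "i \<le> m"
  with False have "nd i \<in> nd ` {1..m}" by auto
  also have "\<dots> = {..<m}" using order vT by (simp add: search_order_def bij_betw_def)
  finally show ?thesis by simp
qed (use o0 m in simp)

lemma p_less:
  assumes "1 \<le> i" "i \<le> m"
  shows "p i < i"
proof (cases "i = 1")
  case True
  with p1 show ?thesis by simp
next
  case False
  with assms(1) have "2 \<le> i" by simp
  from search_order.par[OF order this assms(2)] show ?thesis by blast
qed

lemma p_le: "i \<le> m \<Longrightarrow> p i \<le> m"
  using p_less[of i] p0 by (cases "i = 0") auto

lemma p_less_Suc: "i < Suc m \<Longrightarrow> p i < Suc m" "i < Suc m \<Longrightarrow> p i < Suc (n + m + N)"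
  using p_le[of i] by simp_all

definition Y :: "nat \<Rightarrow> nat set" where
  "Y i = (if i = 0 then {} else {j. j < n \<and> reached r j \<inter> X (nd i) \<noteq> {}})"

lemma Y_subset: "Y i \<subseteq> {..<n}"
  by (auto simp: Y_def)

lemma confl_iff:
  "confl i j \<longleftrightarrow> (\<exists>x\<in>reached r i. \<exists>y\<in>reached r j. x = y \<or> {x, y} \<in> edges G)"
  unfolding confl_def using nball_meets_iff[of G "verts (H i)" r "verts (H j)"] d by simp

lemma confl_sym: "confl i j \<longleftrightarrow> confl j i"
proof -
  have "confl j i" if "confl i j" for i j
  proof -
    from that obtain x y where "x \<in> reached r i" "y \<in> reached r j" "x = y \<or> {y, x} \<in> edges G"
      unfolding confl_iff insert_commute[of _ _ "{}"] by blast
    then show ?thesis unfolding confl_iff by metis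
  qed
  then show ?thesis by blast
qed

lemma reached_subset: "j < n \<Longrightarrow> reached q j \<subseteq> {..<V}"
  using nball_subset_verts[OF G] HV vG by simp

lemma o_onto: "t < m \<Longrightarrow> \<exists>i. 1 \<le> i \<and> i \<le> m \<and> nd i = t"
proof -
  assume "t < m"
  then have "t \<in> nd ` {1..m}" using order vT by (simp add: search_order_def bij_betw_def)
  then obtain i where "i \<in> {1..m}" "t = nd i" by blast
  then show ?thesis by (intro exI[of _ i]) simp
qed

sublocale bag_sequence m Y p "{..<n}" confl w
proof
  show "finite {..<n}" by simp
  show "Y 0 = {}" by (simp add: Y_def)
  show "\<And>i. 1 \<le> i \<Longrightarrow> i \<le> m \<Longrightarrow> p i < i" by (rule p_less)
next
  fix i l assume il: "1 \<le> i" "i \<le> m" "l < i"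
  show "Y i \<inter> Y l \<subseteq> Y (p i)"
  proof
    fix j assume "j \<in> Y i \<inter> Y l"
    then have j: "j < n" "l \<noteq> 0" "reached r j \<inter> X (nd i) \<noteq> {}" "reached r j \<inter> X (nd l) \<noteq> {}"
      by (auto simp: Y_def split: if_splits)
    have "linked (edges G) (verts (H j))"
      using H[OF j(1)] by (intro connected_graph_linked) (auto simp: subgraph_def)
    then have "linked (edges G) (reached r j)" using H[OF j(1)] by (intro linked_nball) auto
    then have "linked (edges T) {t \<in> verts T. X t \<inter> reached r j \<noteq> {}}"
      using reached_subset[OF j(1)] vG by (intro linked_nodes[OF td]) auto
    from search_order.parent_in_linked[OF order this _ il(2) _ il(3)] il j o_less vT
    have "nd (p i) \<in> {t \<in> verts T. X t \<inter> reached r j \<noteq> {}}" by auto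
    \<comment> \<open>\<open>Y l\<close> is nonempty, so \<open>l\<close> is not the auxiliary root
      and \<open>i\<close> is not the root of the tree. Its parent is then a genuine node, for which
      \<open>Y\<close> is given by the bag.\<close>
    moreover have "2 \<le> i" using il j(2) by linarith
    then have "p i \<noteq> 0" using search_order.par[OF order _ il(2)] by fastforce
    ultimately show "j \<in> Y (p i)" using j(1) by (auto simp: Y_def)
  qed
next
  have "\<exists>i\<le>m. j \<in> Y i" if "j < n" for j
  proof -
    from H[OF that] obtain v where v: "v \<in> verts (H j)" by blast
    then have "v \<in> verts G" using HV[OF that] vG by blast
    with td have "\<exists>t\<in>verts T. v \<in> X t" unfolding tree_decomposition_def by simp
    then obtain t where "t < m" "v \<in> X t" using vT by auto
    moreover from o_onto[OF this(1)] obtain i where "1 \<le> i" "i \<le> m" "nd i = t" by blast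
    moreover have "v \<in> reached r j" using v nball_self[of "verts (H j)" G r] by (rule rev_subsetD)
    ultimately show ?thesis using that by (intro exI[of _ i]) (auto simp: Y_def)
  qed
  then show "{..<n} = (\<Union>i\<le>m. Y i)" using Y_subset by blast
next
  fix u v assume uv: "u \<in> {..<n}" "v \<in> {..<n}" "confl u v"
  then obtain x y where xy: "x \<in> reached r u" "y \<in> reached r v" "x = y \<or> {x, y} \<in> edges G"
    unfolding confl_iff by blast
  have "x \<in> verts G" using xy(1) uv(1) reached_subset vG by blast
  \<comment> \<open>A conflict is a common vertex of two balls or an edge between them. Either lies
    in some bag, and that bag meets both balls.\<close>
  have "\<exists>t\<in>verts T. {x, y} \<subseteq> X t"
  proof (cases "x = y")
    case True
    with td \<open>x \<in> verts G\<close> show ?thesis unfolding tree_decomposition_def by simp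
  next
    case False
    with xy(3) have "{x, y} \<in> edges G" by simp
    moreover have "\<forall>e\<in>edges G. \<exists>t\<in>verts T. e \<subseteq> X t"
      using td unfolding tree_decomposition_def by (elim conjE)
    ultimately show ?thesis by (rule bspec[rotated])
  qed
  then obtain t where "t \<in> verts T" "x \<in> X t" "y \<in> X t" by auto
  moreover from this(1) o_onto vT obtain i where "1 \<le> i" "i \<le> m" "nd i = t" by auto
  ultimately show "\<exists>i\<le>m. u \<in> Y i \<and> v \<in> Y i"
    using xy uv by (intro exI[of _ i]) (auto simp: Y_def)
qed

lemma card_indep_bag:
  assumes "i \<le> m" "S \<subseteq> Y i" "indep S"
  shows "card S \<le> k"
proof (cases "i = 0")
  case False
  have t: "nd i \<in> verts T" using o_less[OF assms(1)] vT by simp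
  have far: "x \<noteq> y \<and> {x, y} \<notin> edges G"
    if "u \<in> S" "v \<in> S" "u \<noteq> v" "x \<in> reached r u" "y \<in> reached r v" for u v x y
    using assms(3) that unfolding indep_def confl_iff by blast
  have "card S \<le> independence_number (induced G (X (nd i)))"
  proof (rule card_pairwise_far_le[OF G _ _ _ far])
    show "X (nd i) \<subseteq> verts G" using X_sub[OF o_less[OF assms(1)]] vG by simp
    show "finite S" using assms(1,2) finite_Y finite_subset by blast
    show "\<And>j. j \<in> S \<Longrightarrow> reached r j \<inter> X (nd i) \<noteq> {}" using assms(2) False by (auto simp: Y_def)
  qed
  also have "\<dots> \<le> td_independence_number G T X"
    unfolding td_independence_number_def using t vT by (intro Max_ge) auto
  finally show ?thesis using alpha by simp
qed (use assms in \<open>simp add: Y_def\<close>)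

abbreviation Sq :: "nat \<Rightarrow> nat set" where
  "Sq \<equiv> subset_of n k"

definition admissible :: "nat \<Rightarrow> nat \<Rightarrow> bool" where
  "admissible i q \<longleftrightarrow> indep (Sq q) \<and> Sq q \<subseteq> Y i"

text \<open>Ties the abstract sets to the program: an independent part of a bag has at most
  \<open>k\<close> elements and is therefore enumerated by some number below
  \<open>N\<close>.\<close>

lemma indep_bag_subset:
  assumes "i \<le> m" "S \<subseteq> Y i" "indep S"
  obtains q where "q < N" "Sq q = S" "admissible i q"
  using subset_of_surj[of S n k] card_indep_bag[OF assms] Y_subset[of i] assms N
  unfolding admissible_def by blast

definition order_is :: "state \<Rightarrow> bool" where
  "order_is s \<longleftrightarrow> narr s ''ord'' = nd \<and> narr s ''pp'' = p"

lemma order_is_framed: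
  "order_is s \<Longrightarrow> framed c s s' \<Longrightarrow> narrs_of c \<inter> {''ord'', ''pp''} = {} \<Longrightarrow> order_is s'"
  by (auto simp: order_is_def framed_def)

definition bags_ok :: "state \<Rightarrow> bool" where
  "bags_ok s \<longleftrightarrow> (\<forall>i<m + 1. \<forall>j<n. 0 < narr s ''Y'' (i * n + j) \<longleftrightarrow> j \<in> Y i)"

definition mem_ok :: "state \<Rightarrow> bool" where
  "mem_ok s \<longleftrightarrow> (\<forall>q<N. \<forall>j<n. 0 < narr s ''mem'' (q * n + j) \<longleftrightarrow> j \<in> Sq q)"

definition later_ok :: "state \<Rightarrow> bool" where
  "later_ok s \<longleftrightarrow> (\<forall>q<N. \<forall>j<n. 0 < narr s ''cs'' (q * n + j) \<longleftrightarrow> (\<exists>z\<in>Sq q. j < z \<and> confl j z))"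

definition dep_ok :: "state \<Rightarrow> bool" where
  "dep_ok s \<longleftrightarrow> (\<forall>q<N. 0 < narr s ''dep'' (q * n) \<longleftrightarrow> \<not> indep (Sq q))"

definition nsub_ok :: "state \<Rightarrow> bool" where
  "nsub_ok s \<longleftrightarrow> (\<forall>i<m + 1. \<forall>q<N. 0 < narr s ''nsub'' (i * N + q) \<longleftrightarrow> \<not> Sq q \<subseteq> Y i)"

definition code_ok :: "state \<Rightarrow> bool" where
  "code_ok s \<longleftrightarrow> (\<forall>i<m + 1. \<forall>q<N. narr s ''code'' (i * N + q) = set_encode (Sq q \<inter> Y i))"

definition phi_ok :: "state \<Rightarrow> bool" where
  "phi_ok s \<longleftrightarrow> (\<forall>i<m + 1. \<forall>q<N. warr s ''phi'' (i * N + q) = sum w (Sq q - Y (p i)))"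

lemma bags_ok_framed: "bags_ok s \<Longrightarrow> framed c s s' \<Longrightarrow> ''Y'' \<notin> narrs_of c \<Longrightarrow> bags_ok s'"
  by (simp add: bags_ok_def framed_def)

lemma mem_ok_framed: "mem_ok s \<Longrightarrow> framed c s s' \<Longrightarrow> ''mem'' \<notin> narrs_of c \<Longrightarrow> mem_ok s'"
  by (simp add: mem_ok_def framed_def)

lemma dep_ok_framed: "dep_ok s \<Longrightarrow> framed c s s' \<Longrightarrow> ''dep'' \<notin> narrs_of c \<Longrightarrow> dep_ok s'"
  by (simp add: dep_ok_def framed_def)

lemma nsub_ok_framed: "nsub_ok s \<Longrightarrow> framed c s s' \<Longrightarrow> ''nsub'' \<notin> narrs_of c \<Longrightarrow> nsub_ok s'"
  by (simp add: nsub_ok_def framed_def)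

lemma code_ok_framed: "code_ok s \<Longrightarrow> framed c s s' \<Longrightarrow> ''code'' \<notin> narrs_of c \<Longrightarrow> code_ok s'"
  by (simp add: code_ok_def framed_def)

lemma runs_Bags:
  assumes s: "enc s" "tabs s" "reach_ok r s" "order_is s"
  shows "runs (Bags r) s ((m + 1) * (n * (V * 4 + 6) + 4) + 2) bags_ok"
  unfolding Bags_def
proof (rule runs_mono[OF runs_Tab_ex[where R = "m + 1" and C = n and D = n and L = V
        and v = "\<lambda>_ _. 0" and P = "\<lambda>i j z. 0 < i \<and> narr s ''X_dat'' z \<in> reached r j"
        and l = "\<lambda>i j. narr s ''X_off'' (nd i)" and h = "\<lambda>i j. narr s ''X_off'' (Suc (nd i))"] order.refl])
  note b = stores_blocks_block[OF enc_blocks(3)[OF s(1)]]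
  show "\<And>i j. i < m + 1 \<Longrightarrow> narr s ''X_off'' (nd i) \<le> narr s ''X_off'' (Suc (nd i)) \<and>
      narr s ''X_off'' (Suc (nd i)) - narr s ''X_off'' (nd i) \<le> V"
    using b(1,2) X_sub card_le_V o_less by simp
  fix s' i j z
  assume "tab_eq ''Y'' s s'" "nvar s' ''x'' = i" "nvar s' ''y'' = j" "i < m + 1" "j < n" "nvar s' ''z'' = z"
    "narr s ''X_off'' (nd i) \<le> z" "z < narr s ''X_off'' (Suc (nd i))"
  moreover have "narr s ''X_dat'' z < V" using b(4)[of "nd i" z] calculation X_sub[of "nd i"] o_less[of i] by auto
  ultimately show "bval (BAnd (NPos (NVar ''x'')) (NPos (cell (reach r) ''mV'' ''y'' (NArr ''X_dat'' (NVar ''z''))))) s' \<longleftrightarrow>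
      0 < i \<and> narr s ''X_dat'' z \<in> reached r j"
    using tabsD(3)[OF s(2)] reach_okD[OF s(3)] by (simp add: eq_off_def)
next
  note b = stores_blocks_block[OF enc_blocks(3)[OF s(1)]]
  fix s' :: state
  assume *: "\<forall>i<m + 1. \<forall>j<n. 0 < narr s' ''Y'' (i * n + j) \<longleftrightarrow> 0 < (0::nat) \<or>
      (\<exists>z. narr s ''X_off'' (nd i) \<le> z \<and> z < narr s ''X_off'' (Suc (nd i)) \<and> 0 < i \<and> narr s ''X_dat'' z \<in> reached r j)"
  show "bags_ok s'"
    unfolding bags_ok_def
  proof (intro allI impI)
    fix i j assume ij: "i < m + 1" "j < n"
    with * have "0 < narr s' ''Y'' (i * n + j) \<longleftrightarrow> 0 < i \<and>
        (\<exists>z. narr s ''X_off'' (nd i) \<le> z \<and> z < narr s ''X_off'' (Suc (nd i)) \<and> narr s ''X_dat'' z \<in> reached r j)"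
      by auto
    also have "\<dots> \<longleftrightarrow> 0 < i \<and> (\<exists>v\<in>X (nd i). v \<in> reached r j)"
      using b(3)[of "nd i" "\<lambda>v. v \<in> reached r j"] o_less[of i] ij by simp
    also have "\<dots> \<longleftrightarrow> j \<in> Y i" using ij by (auto simp: Y_def)
    finally show "0 < narr s' ''Y'' (i * n + j) \<longleftrightarrow> j \<in> Y i" .
  qed
qed (use enc_vars[OF s(1)] tabsD(4)[OF s(2)] s(4) in \<open>simp_all add: eq_off_def order_is_def\<close>)

lemma runs_Mem:
  assumes s: "enc s" "tabs s"
  shows "runs (Mem k) s (N * (n * 10 + 4) + 2) mem_ok"
  unfolding Mem_def
proof (rule runs_mono[OF runs_Tab_ex[where R = N and C = n and D = n and L = 1
        and v = "\<lambda>_ _. 0" and P = "\<lambda>q j z. j \<in> Sq q" and l = "\<lambda>_ _. 0" and h = "\<lambda>_ _. 1"] order.refl])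
  fix s' q j z
  assume *: "tab_eq ''mem'' s s'" "nvar s' ''x'' = q" "nvar s' ''y'' = j" "q < N" "j < n"
  have "narr s' ''dv'' = narr s ''dv''" "narr s' ''mS'' = narr s ''mS''"
    using *(1) by (simp_all add: eq_off_def)
  then show "bval (digit_cond k (NVar ''x'')) s' \<longleftrightarrow> j \<in> Sq q"
    using bval_digit_cond[of "NVar ''x''" s' q N n k] * tabsD(6,7)[OF s(2)] by simp
qed (use enc_vars[OF s(1)] tabsD[OF s(2)] in \<open>simp_all add: eq_off_def mem_ok_def\<close>)

lemma runs_Later:
  assumes s: "enc s" "tabs s" "mem_ok s" "confl_ok s"
  shows "runs Later s (N * (n * (n * 4 + 6) + 4) + 2) later_ok"
  unfolding Later_def
proof (rule runs_mono[OF runs_Tab_ex[where R = N and C = n and D = n and L = n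
        and v = "\<lambda>_ _. 0" and P = "\<lambda>q j z. j < z \<and> z \<in> Sq q \<and> confl j z"
        and l = "\<lambda>_ _. 0" and h = "\<lambda>_ _. n"] order.refl])
  fix s' :: state
  assume *: "\<forall>q<N. \<forall>j<n. 0 < narr s' ''cs'' (q * n + j) \<longleftrightarrow> 0 < (0::nat) \<or>
      (\<exists>z. 0 \<le> z \<and> z < n \<and> j < z \<and> z \<in> Sq q \<and> confl j z)"
  then show "later_ok s'"
    unfolding later_ok_def using subset_of_subset[of n k] by fastforce
qed (use enc_vars[OF s(1)] tabsD(1,4)[OF s(2)] s(3,4) in \<open>simp_all add: eq_off_def mem_ok_def confl_ok_def\<close>)

lemma runs_Dep:
  assumes s: "enc s" "tabs s" "mem_ok s" "later_ok s"
  shows "runs Dep s (N * (n * 4 + 10) + 2) dep_ok"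
  unfolding Dep_def
proof (rule runs_mono[OF runs_Tab_ex[where R = N and C = 1 and D = n and L = n
        and v = "\<lambda>_ _. 0" and P = "\<lambda>q j z. z \<in> Sq q \<and> (\<exists>z'\<in>Sq q. z < z' \<and> confl z z')"
        and l = "\<lambda>_ _. 0" and h = "\<lambda>_ _. n"] order.refl])
  fix s' :: state
  assume *: "\<forall>q<N. \<forall>j<1. 0 < narr s' ''dep'' (q * n + j) \<longleftrightarrow> 0 < (0::nat) \<or>
      (\<exists>z. 0 \<le> z \<and> z < n \<and> z \<in> Sq q \<and> (\<exists>z'\<in>Sq q. z < z' \<and> confl z z'))"
  show "dep_ok s'"
    unfolding dep_ok_def
  proof (intro allI impI)
    fix q assume "q < N"
    with * have "0 < narr s' ''dep'' (q * n) \<longleftrightarrow>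
        (\<exists>z. z < n \<and> z \<in> Sq q \<and> (\<exists>z'\<in>Sq q. z < z' \<and> confl z z'))" by force
    also have "\<dots> \<longleftrightarrow> (\<exists>z\<in>Sq q. \<exists>z'\<in>Sq q. z < z' \<and> confl z z')"
      using subset_of_subset[of n k q] by blast
    \<comment> \<open>Looking only at larger partners suffices because conflict is
      symmetric.\<close>
    also have "\<dots> \<longleftrightarrow> \<not> indep (Sq q)"
      unfolding indep_def using confl_sym by (metis nat_neq_iff)
    finally show "0 < narr s' ''dep'' (q * n) \<longleftrightarrow> \<not> indep (Sq q)" .
  qed
qed (use enc_vars[OF s(1)] tabsD(1,4)[OF s(2)] s(3,4) n in \<open>simp_all add: eq_off_def mem_ok_def later_ok_def\<close>)

lemma runs_NSub:
  assumes s: "enc s" "tabs s" "mem_ok s" "bags_ok s"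
  shows "runs NSub s ((m + 1) * (N * (n * 4 + 6) + 4) + 2) nsub_ok"
  unfolding NSub_def
proof (rule runs_mono[OF runs_Tab_ex[where R = "m + 1" and C = N and D = N and L = n
        and v = "\<lambda>_ _. 0" and P = "\<lambda>i q z. z \<in> Sq q \<and> z \<notin> Y i"
        and l = "\<lambda>_ _. 0" and h = "\<lambda>_ _. n"] order.refl])
  fix s' :: state
  assume *: "\<forall>i<m + 1. \<forall>q<N. 0 < narr s' ''nsub'' (i * N + q) \<longleftrightarrow> 0 < (0::nat) \<or>
      (\<exists>z. 0 \<le> z \<and> z < n \<and> z \<in> Sq q \<and> z \<notin> Y i)"
  then show "nsub_ok s'"
    unfolding nsub_ok_def using subset_of_subset[of n k] by fastforce
qed (use enc_vars[OF s(1)] tabsD(1,4,5)[OF s(2)] s(3,4) in \<open>simp_all add: eq_off_def mem_ok_def bags_ok_def\<close>)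

lemma runs_Code:
  assumes s: "enc s" "tabs s" "mem_ok s" "bags_ok s"
  shows "runs Code s ((m + 1) * (N * (n * 4 + 6) + 4) + 2) code_ok"
  unfolding Code_def
proof (rule runs_mono[OF runs_Tab[where R = "m + 1" and C = N and D = N and L = n
        and v = "\<lambda>_ _. 0" and P = "\<lambda>i q z. z \<in> Sq q \<and> z \<in> Y i" and f = "\<lambda>_ _ z. 2 ^ z"
        and l = "\<lambda>_ _. 0" and h = "\<lambda>_ _. n"] order.refl])
  fix s' :: state
  assume *: "\<forall>i<m + 1. \<forall>q<N. narr s' ''code'' (i * N + q) =
      0 + (\<Sum>z\<in>{0..<n}. if z \<in> Sq q \<and> z \<in> Y i then 2 ^ z else 0)"
  have "{0..<n} \<inter> {z. z \<in> Sq q \<and> z \<in> Y i} = Sq q \<inter> Y i" for q i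
    using subset_of_subset[of n k q] by auto
  then have "(\<Sum>z\<in>{0..<n}. if z \<in> Sq q \<and> z \<in> Y i then 2 ^ z else 0) = set_encode (Sq q \<inter> Y i)" for q i
    by (simp add: set_encode_def sum.If_cases)
  with * show "code_ok s'" by (simp add: code_ok_def)
qed (use enc_vars[OF s(1)] tabsD(1,2,4,5)[OF s(2)] s(3,4) in \<open>simp_all add: eq_off_def mem_ok_def bags_ok_def\<close>)

lemma runs_Phi:
  assumes s: "enc s" "tabs s" "mem_ok s" "bags_ok s" "order_is s"
  shows "runs Phi s ((m + 1) * (N * (n * 4 + 6) + 4) + 2) phi_ok"
  unfolding Phi_def
proof (rule runs_mono[OF runs_WTab[where R = "m + 1" and C = N and D = N and L = n
        and P = "\<lambda>i q z. z \<in> Sq q \<and> z \<notin> Y (p i)" and f = "\<lambda>_ _ z. w z"] order.refl])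
  fix s' :: state
  assume *: "\<forall>i<m + 1. \<forall>q<N. warr s' ''phi'' (i * N + q) =
      (\<Sum>z<n. if z \<in> Sq q \<and> z \<notin> Y (p i) then w z else 0)"
  have "{z \<in> {..<n}. z \<in> Sq q \<and> z \<notin> Y (p i)} = Sq q - Y (p i)" for q i
    using subset_of_subset[of n k q] by auto
  then have "(\<Sum>z<n. if z \<in> Sq q \<and> z \<notin> Y (p i) then w z else 0) = sum w (Sq q - Y (p i))" for q i
    by (simp add: sum.inter_filter[symmetric])
  with * show "phi_ok s'" by (simp add: phi_ok_def)
qed (use enc_vars[OF s(1)] tabsD(1,4,5)[OF s(2)] s(3,4,5) p_less_Suc enc_weight[OF s(1)] in
    \<open>simp_all add: eq_off_def mem_ok_def bags_ok_def order_is_def\<close>)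

end

section \<open>Messages\<close>

definition Upd :: "nexp \<Rightarrow> wexp \<Rightarrow> com" where
  "Upd key val = Seq (WStore ''M'' key val) (NStore ''ch'' key (NVar ''x''))"

text \<open>The first pass stores some candidate under every key that occurs, so that no initialisation of
  \<open>M\<close> is needed; the second pass improves it to a best one.\<close>

definition Best :: "bexp \<Rightarrow> nexp \<Rightarrow> wexp \<Rightarrow> com" where
  "Best b key val = Seq
     (For ''x'' n0 (NVar ''N'') (Cond b (Upd key val) Skip))
     (For ''x'' n0 (NVar ''N'') (Cond (BAnd b (WLess (WArr ''M'' key) val)) (Upd key val) Skip))"

lemma mods_Best [unfolded mods_def prod.inject, simp]:
  "mods (Best b key val) = ({''x''}, {''ch''}, {}, {''M''})"
  by (auto simp: mods_def Best_def Upd_def)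

lemma runs_Upd:
  assumes ev: "\<And>s'. eq_off {} {''ch''} {} {''M''} s s' \<Longrightarrow> nval key s' = a"
    and "wval val s = v" "nvar s ''x'' = q"
  shows "runs (Upd key val) s 2 (\<lambda>s'. warr s' ''M'' = (warr s ''M'')(a := v) \<and> narr s' ''ch'' = (narr s ''ch'')(a := q))"
  unfolding Upd_def
proof (rule runs_Seq_WStore[where t = 1])
  let ?s = "s\<lparr>warr := (warr s)(''M'' := (warr s ''M'')(nval key s := wval val s))\<rparr>"
  have "nval key s = a" "nval key ?s = a" using ev by (simp_all add: eq_off_def)
  then show "runs (NStore ''ch'' key (NVar ''x'')) ?s 1
      (\<lambda>s'. warr s' ''M'' = (warr s ''M'')(a := v) \<and> narr s' ''ch'' = (narr s ''ch'')(a := q))"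
    using assms(2,3) by (intro runs_NStore) simp_all
qed simp

text \<open>\<open>C\<close> selects the candidates, \<open>A\<close> gives their keys and
  \<open>v\<close> their values. The last conjunct, that cells under other keys keep their contents,
  protects the messages of bags processed before.\<close>

lemma runs_Best:
  fixes N :: nat and A :: "nat \<Rightarrow> nat" and v :: "nat \<Rightarrow> rat"
  assumes N: "nvar s ''N'' = N"
    and ev: "\<And>s' q. eq_off {''x''} {''ch''} {} {''M''} s s' \<Longrightarrow> nvar s' ''x'' = q \<Longrightarrow> q < N \<Longrightarrow>
        (bval b s' \<longleftrightarrow> C q) \<and> nval key s' = A q \<and> wval val s' = v q"
  shows "runs (Best b key val) s (N * 10 + 4) (\<lambda>s'.
    (\<forall>q<N. C q \<longrightarrow> v q \<le> warr s' ''M'' (A q) \<and> narr s' ''ch'' (A q) < N \<and> C (narr s' ''ch'' (A q)) \<and>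
       A (narr s' ''ch'' (A q)) = A q \<and> warr s' ''M'' (A q) = v (narr s' ''ch'' (A q))) \<and>
    (\<forall>a. a \<notin> A ` {..<N} \<longrightarrow> warr s' ''M'' a = warr s ''M'' a \<and> narr s' ''ch'' a = narr s ''ch'' a))"
proof -
  \<comment> \<open>A good cell holds an actual candidate of its key together with the value of that
    candidate. The first pass makes all occurring keys good. The second keeps them good and adds
    that no scanned candidate is better, which persists because overwriting only raises
    \<open>M\<close>.\<close>
  define good where "good = (\<lambda>(s'::state) a. narr s' ''ch'' a < N \<and> C (narr s' ''ch'' a) \<and>
       A (narr s' ''ch'' a) = a \<and> warr s' ''M'' a = v (narr s' ''ch'' a))"
  define keep where "keep = (\<lambda>s'::state. \<forall>a. a \<notin> A ` {..<N} \<longrightarrow> warr s' ''M'' a = warr s ''M'' a \<and> narr s' ''ch'' a = narr s ''ch'' a)"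
  let ?I1 = "\<lambda>i s'. (\<forall>q<i. C q \<longrightarrow> good s' (A q)) \<and> keep s'"
  let ?I2 = "\<lambda>i s'. (\<forall>q<N. C q \<longrightarrow> good s' (A q)) \<and> keep s' \<and> (\<forall>q<i. C q \<longrightarrow> v q \<le> warr s' ''M'' (A q))"
  let ?F1 = "For ''x'' n0 (NVar ''N'') (Cond b (Upd key val) Skip)"
  let ?b2 = "BAnd b (WLess (WArr ''M'' key) val)"
  let ?F2 = "For ''x'' n0 (NVar ''N'') (Cond ?b2 (Upd key val) Skip)"
  have good_indep: "good (s'\<lparr>nvar := f\<rparr>) a = good s' a" "keep (s'\<lparr>nvar := f\<rparr>) = keep s'" for s' f a
    by (simp_all add: good_def keep_def)
  have upd: "runs (Upd key val) s' 2 (\<lambda>s''. warr s'' ''M'' = (warr s' ''M'')(A q := v q) \<and>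
      narr s'' ''ch'' = (narr s' ''ch'')(A q := q))"
    if "eq_off {''x''} {''ch''} {} {''M''} s s'" "nvar s' ''x'' = q" "q < N" for s' q
  proof (rule runs_Upd)
    fix s'' assume "eq_off {} {''ch''} {} {''M''} s' s''"
    then have "eq_off {''x''} {''ch''} {} {''M''} s s''" "nvar s'' ''x'' = q"
      using that by (simp_all add: eq_off_def)
    with ev that(3) show "nval key s'' = A q" by blast
  qed (use ev[OF that] that in simp_all)
  have after: "good s'' a" "keep s' \<Longrightarrow> keep s''"
    if "warr s'' ''M'' = (warr s' ''M'')(A q := v q)" "narr s'' ''ch'' = (narr s' ''ch'')(A q := q)"
      "C q" "q < N" "a = A q \<or> good s' a" for s' s'' :: state and q a
    using that by (auto simp: good_def keep_def)
  have "runs ?F1 s (N * 5 + 2) (?I1 N)"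
  proof (rule runs_For[where u = 3 and l = 0 and h = N])
    fix i s' assume i: "i < N" "nvar s' ''x'' = i" and I: "?I1 i s'" and f: "framed ?F1 s s'"
    have eq: "eq_off {''x''} {''ch''} {} {''M''} s s'" using f by (simp add: framed_def eq_off_def Upd_def)
    show "runs (Cond b (Upd key val) Skip) s' 3 (\<lambda>s''. ?I1 (Suc i) (setn s'' ''x'' (Suc i)))"
    proof (rule runs_Cond[where u = 2])
      assume "bval b s'"
      then have Ci: "C i" using ev[OF eq i(2,1)] by simp
      show "runs (Upd key val) s' 2 (\<lambda>s''. ?I1 (Suc i) (setn s'' ''x'' (Suc i)))"
        unfolding good_indep
        by (rule runs_mono[OF upd[OF eq i(2,1)] order.refl])
          (use after[OF _ _ Ci i(1)] I in \<open>simp add: less_Suc_eq\<close>, blast)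
    next
      assume "\<not> bval b s'"
      then have "\<not> C i" using ev[OF eq i(2,1)] by simp
      then show "runs Skip s' 2 (\<lambda>s''. ?I1 (Suc i) (setn s'' ''x'' (Suc i)))"
        unfolding good_indep using I by (intro runs_Skip) (auto simp: less_Suc_eq)
    qed simp
  next
    fix i s' assume "framed ?F1 s s'"
    then show "nval (NVar ''N'') s' = N" using N by (simp add: framed_def Upd_def)
  qed (simp_all add: Upd_def keep_def)
  moreover have "runs ?F2 s1 (N * 5 + 2) (?I2 N)" if I1: "?I1 N s1" and f1: "framed ?F1 s s1" for s1
  proof (rule runs_For[where u = 3 and l = 0 and h = N and I = ?I2])
    fix i s' assume i: "i < N" "nvar s' ''x'' = i" and I: "?I2 i s'" and f: "framed ?F2 s1 s'"
    have eq: "eq_off {''x''} {''ch''} {} {''M''} s s'" using f f1 by (simp add: framed_def eq_off_def Upd_def)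
    have b2: "bval ?b2 s' \<longleftrightarrow> C i \<and> warr s' ''M'' (A i) < v i" using ev[OF eq i(2,1)] by simp
    show "runs (Cond ?b2 (Upd key val) Skip) s' 3 (\<lambda>s''. ?I2 (Suc i) (setn s'' ''x'' (Suc i)))"
    proof (rule runs_Cond[where u = 2])
      assume "bval ?b2 s'"
      with b2 have Ci: "C i" and lt: "warr s' ''M'' (A i) < v i" by simp_all
      show "runs (Upd key val) s' 2 (\<lambda>s''. ?I2 (Suc i) (setn s'' ''x'' (Suc i)))"
      proof (rule runs_mono[OF upd[OF eq i(2,1)] order.refl])
        fix s'' :: state assume u: "warr s'' ''M'' = (warr s' ''M'')(A i := v i) \<and> narr s'' ''ch'' = (narr s' ''ch'')(A i := i)"
        have "\<forall>q<N. C q \<longrightarrow> good s'' (A q)" "keep s''"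
          using after[OF _ _ Ci i(1), of s'' s'] u I by blast+
        moreover have "v q \<le> warr s'' ''M'' (A q)" if "q < Suc i" "C q" for q
          using u I lt that by (cases "A q = A i") (auto simp: less_Suc_eq dest: order.strict_implies_order order.trans)
        ultimately show "?I2 (Suc i) (setn s'' ''x'' (Suc i))"
          unfolding good_indep
          by simp
      qed
    next
      assume "\<not> bval ?b2 s'"
      then show "runs Skip s' 2 (\<lambda>s''. ?I2 (Suc i) (setn s'' ''x'' (Suc i)))"
        unfolding good_indep b2 using I by (intro runs_Skip) (auto simp: less_Suc_eq)
    qed simp
  next
    fix i s' assume "framed ?F2 s1 s'"
    then show "nval (NVar ''N'') s' = N" using N f1 by (simp add: framed_def Upd_def)
  qed (use I1 in \<open>simp_all add: Upd_def good_indep\<close>)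
  ultimately have "runs (Best b key val) s (N * 10 + 4) (?I2 N)"
    unfolding Best_def by (rule runs_Seq) simp_all
  then show ?thesis
    by (rule runs_mono) (auto simp: good_def keep_def)
qed

abbreviation msg_key :: "string \<Rightarrow> nexp" where
  "msg_key b \<equiv> NPlus (NArr ''pw'' (NPlus (NVar ''nJ'') (NVar ''i''))) (cell ''code'' ''mN'' b (NVar ''x''))"

abbreviation phi_key :: "string \<Rightarrow> nexp" where
  "phi_key b \<equiv> NPlus (NArr ''mN'' (NVar b)) (NVar ''x'')"

abbreviation cand :: bexp where
  "cand \<equiv> BAnd (BNot (NPos (cell ''dep'' ''mn'' ''x'' n0))) (BNot (NPos (cell ''nsub'' ''mN'' ''i'' (NVar ''x''))))"

text \<open>All rows of the parent are updated, even those whose trace belongs to no candidate,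
  where \<open>M\<close> may hold arbitrary memory. Only admissible rows matter, and the trace of
  such a row on bag \<open>i\<close> is an independent subset of both bags, so its message has been
  computed.\<close>

abbreviation push :: com where
  "push \<equiv> WStore ''phi'' (phi_key ''p'') (WPlus (WArr ''phi'' (phi_key ''p'')) (WArr ''M'' (msg_key ''i'')))"

text \<open>A \<open>For\<close> loop only counts upwards; \<open>i\<close> is \<open>nT\<close>
  minus the counter \<open>c\<close>, so bags are processed from \<open>m\<close> down to 1, each
  before its parent.\<close>

definition Process :: com where
  "Process = Seq (NAssign ''i'' (NMinus (NVar ''nT'') (NVar ''c''))) (Seq (NAssign ''p'' (NArr ''pp'' (NVar ''i'')))
    (Seq (Best cand (msg_key ''p'') (WArr ''phi'' (phi_key ''i''))) (For ''x'' n0 (NVar ''N'') push)))"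

definition DP :: com where
  "DP = For ''c'' n0 (NVar ''nT'') Process"

lemma mods_Process [unfolded mods_def prod.inject, simp]:
  "mods Process = ({''i'', ''p'', ''x''}, {''ch''}, {}, {''M'', ''phi''})"
  by (auto simp: mods_def Process_def)

lemma mods_DP [unfolded mods_def prod.inject, simp]:
  "mods DP = ({''c'', ''i'', ''p'', ''x''}, {''ch''}, {}, {''M'', ''phi''})"
  by (auto simp: mods_def DP_def)

context ordered_instance
begin

text \<open>The key \<open>2 ^ (n + i) + set_encode R\<close> is the code of \<open>insert (n + i) R\<close>, hence distinct for
  distinct pairs \<open>(i, R)\<close>.\<close>

definition addr :: "nat \<Rightarrow> nat set \<Rightarrow> nat" where
  "addr i R = 2 ^ (n + i) + set_encode R"

lemma addr_inj:
  assumes "addr i R = addr i' R'" "R \<subseteq> {..<n}" "R' \<subseteq> {..<n}"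
  shows "i = i' \<and> R = R'"
proof -
  have fin: "finite R" "finite R'" using assms finite_subset by blast+
  have nin: "n + i \<notin> R" "n + i' \<notin> R'" using assms by auto
  have "addr i R = set_encode (insert (n + i) R)" "addr i' R' = set_encode (insert (n + i') R')"
    using fin nin by (simp_all add: addr_def set_encode_insert)
  with assms(1) fin have eq: "insert (n + i) R = insert (n + i') R'" by (simp add: set_encode_eq)
  have "n + i \<in> insert (n + i') R'" unfolding eq[symmetric] by simp
  with assms(3) have "i = i'" by auto
  with eq nin show ?thesis by (metis Diff_insert_absorb)
qed

text \<open>Collects what the message phase reads but never overwrites. The potentials in
  \<open>phi\<close> are absent because processing a bag changes those of its parent.\<close>

definition static :: "state \<Rightarrow> bool" where
  "static s \<longleftrightarrow> enc s \<and> tabs s \<and> order_is s \<and> bags_ok s \<and> mem_ok s \<and> dep_ok s \<and> nsub_ok s \<and> code_ok s"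

lemma static_framed:
  assumes "static s" "framed c s s'" "nvars_of c \<inter> insert ''N'' input_vars = {}"
    "narrs_of c \<inter> (input_arrs \<union> {''pw'', ''mV'', ''mn'', ''mN'', ''mS'', ''dv'', ''ord'', ''pp'', ''Y'', ''mem'',
      ''dep'', ''nsub'', ''code''}) = {}" "''w'' \<notin> warrs_of c"
  shows "static s'"
proof -
  note s = assms(1)[unfolded static_def]
  have "enc s'" by (rule enc_framed[OF _ assms(2)]) (use s assms(3-5) in auto)
  moreover have "tabs s'" by (rule tabs_framed[OF _ assms(2)]) (use s assms(3-5) in auto)
  moreover have "order_is s'" by (rule order_is_framed[OF _ assms(2)]) (use s assms(3-5) in auto)
  moreover have "bags_ok s'" by (rule bags_ok_framed[OF _ assms(2)]) (use s assms(3-5) in auto)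
  moreover have "mem_ok s'" by (rule mem_ok_framed[OF _ assms(2)]) (use s assms(3-5) in auto)
  moreover have "dep_ok s'" by (rule dep_ok_framed[OF _ assms(2)]) (use s assms(3-5) in auto)
  moreover have "nsub_ok s'" by (rule nsub_ok_framed[OF _ assms(2)]) (use s assms(3-5) in auto)
  moreover have "code_ok s'" by (rule code_ok_framed[OF _ assms(2)]) (use s assms(3-5) in auto)
  ultimately show ?thesis by (simp add: static_def)
qed

abbreviation msg :: "state \<Rightarrow> nat \<Rightarrow> nat set \<Rightarrow> rat" where
  "msg s \<equiv> \<lambda>i R. warr s ''M'' (addr i R)"

text \<open>The optimality recursion at bag \<open>i\<close> for every trace of an admissible
  subset: an upper bound, and a subset recorded in \<open>ch\<close> that attains it. The potentials
  are evaluated with the array \<open>M\<close> of the same state, of which only entries of bags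
  after \<open>i\<close> enter.\<close>

definition bellman :: "state \<Rightarrow> nat \<Rightarrow> bool" where
  "bellman s i \<longleftrightarrow> (\<forall>q<N. admissible i q \<longrightarrow>
     (let a = addr i (Sq q \<inter> Y (p i)); q' = narr s ''ch'' a in
       pot (msg s) (Suc i) i (Sq q) \<le> warr s ''M'' a \<and> q' < N \<and> admissible i q' \<and>
       Sq q' \<inter> Y (p i) = Sq q \<inter> Y (p i) \<and> warr s ''M'' a = pot (msg s) (Suc i) i (Sq q')))"

definition phi_is :: "state \<Rightarrow> nat \<Rightarrow> bool" where
  "phi_is s i \<longleftrightarrow> (\<forall>l<i. \<forall>q<N. admissible l q \<longrightarrow> warr s ''phi'' (l * N + q) = pot (msg s) i l (Sq q))"

lemma pot_cong:
  assumes "\<And>c. i \<le> c \<Longrightarrow> c \<le> m \<Longrightarrow> Msg c (S \<inter> Y c) = Msg' c (S \<inter> Y c)"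
  shows "pot Msg i l S = pot Msg' i l S"
  unfolding pot_def using assms by (auto simp: children_def intro!: sum.cong)

text \<open>The recursion at \<open>i\<close> reads only entries of bags from \<open>i\<close> on,
  so it survives the processing of bags with smaller numbers.\<close>

lemma bellman_cong:
  assumes "\<And>c R. i \<le> c \<Longrightarrow> c \<le> m \<Longrightarrow> R \<subseteq> {..<n} \<Longrightarrow>
      warr s' ''M'' (addr c R) = warr s ''M'' (addr c R) \<and> narr s' ''ch'' (addr c R) = narr s ''ch'' (addr c R)"
    and "bellman s i" "i \<le> m"
  shows "bellman s' i"
proof -
  have sub: "S \<inter> Y c \<subseteq> {..<n}" for S c using Y_subset by blast
  have 1: "pot (msg s') (Suc i) i S = pot (msg s) (Suc i) i S" for S
    by (rule pot_cong) (use assms(1) sub in auto)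
  have 2: "warr s' ''M'' (addr i (S \<inter> Y c)) = warr s ''M'' (addr i (S \<inter> Y c))"
    "narr s' ''ch'' (addr i (S \<inter> Y c)) = narr s ''ch'' (addr i (S \<inter> Y c))" for S c
    using assms(1)[of i] assms(3) sub by auto
  show ?thesis using assms(2) by (simp only: bellman_def Let_def 1 2)
qed

end

abbreviation sel_code :: com where
  "sel_code \<equiv> SumL n0 n0 (NVar ''nJ'')
     (BAnd (NEq (NArr ''sel'' (NVar ''z'')) n1) (NPos (cell ''Y'' ''mn'' ''i'' (NVar ''z''))))
     (NArr ''pw'' (NVar ''z''))"

abbreviation best_code :: nexp where
  "best_code \<equiv> NArr ''ch'' (NPlus (NArr ''pw'' (NPlus (NVar ''nJ'') (NVar ''i''))) (NVar ''acc''))"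

abbreviation add_member :: com where
  "add_member \<equiv> Cond (NPos (cell ''mem'' ''mn'' ''q'' (NVar ''x''))) (NStore ''sel'' (NVar ''x'') n1) Skip"

definition Extract :: com where
  "Extract = Seq (For ''x'' n0 (NVar ''nJ'') (NStore ''sel'' (NVar ''x'') n0))
    (For ''i'' n1 (NPlus (NVar ''nT'') n1)
      (Seq sel_code (Seq (NAssign ''q'' best_code) (For ''x'' n0 (NVar ''nJ'') add_member))))"

context ordered_instance
begin

text \<open>All keys written carry the tag of bag \<open>i\<close>, so by \<open>addr_inj\<close>
  the messages of later bags stay intact. The final loop realises \<open>pot_step\<close> in the row
  of the parent.\<close>

lemma runs_Process:
  assumes st: "static s" and phi: "phi_is s (Suc i)"
    and bell: "\<And>i'. i < i' \<Longrightarrow> i' \<le> m \<Longrightarrow> bellman s i'"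
    and i: "1 \<le> i" "i \<le> m" and c: "nvar s ''c'' = m - i"
  shows "runs Process s (N * 13 + 8) (\<lambda>s'. phi_is s' i \<and> (\<forall>i'. i \<le> i' \<longrightarrow> i' \<le> m \<longrightarrow> bellman s' i'))"
proof -
  define pi where "pi = p i"
  have pi: "pi < i" using p_less[OF i] by (simp add: pi_def)
  let ?val = "WArr ''phi'' (phi_key ''i'')"
  let ?B = "Best cand (msg_key ''p'') ?val"
  let ?P = "For ''x'' n0 (NVar ''N'') push"
  define s1 where "s1 = setn s ''i'' i"
  define s2 where "s2 = setn s1 ''p'' pi"
  note sd = st[unfolded static_def]
  note nv = enc_vars[OF conjunct1[OF sd]]
  have "m - (m - i) = i" using i by simp
  then have e1: "nval (NMinus (NVar ''nT'') (NVar ''c'')) s = i" using nv c by simp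
  have e2: "nval (NArr ''pp'' (NVar ''i'')) s1 = pi"
    using sd by (simp add: s1_def order_is_def pi_def)
  have st2: "static s2"
    by (rule static_framed[OF st, of "Seq (NAssign ''i'' n0) (NAssign ''p'' n0)"])
      (auto simp: framed_def s1_def s2_def input_vars_def)
  have v2: "nvar s2 ''i'' = i" "nvar s2 ''p'' = pi" "narr s2 = narr s" "warr s2 = warr s"
    by (simp_all add: s1_def s2_def)
  note sd2 = st2[unfolded static_def]
  note enc2 = enc_vars[OF conjunct1[OF sd2]]
  have tabs2: "tabs s2" using sd2 by simp
  define A where "A = (\<lambda>q. addr i (Sq q \<inter> Y pi))"
  define v where "v = (\<lambda>q. warr s ''phi'' (i * N + q))"
  have B: "runs ?B s2 (N * 10 + 4) (\<lambda>s'.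
    (\<forall>q<N. admissible i q \<longrightarrow> v q \<le> warr s' ''M'' (A q) \<and> narr s' ''ch'' (A q) < N \<and> admissible i (narr s' ''ch'' (A q)) \<and>
       A (narr s' ''ch'' (A q)) = A q \<and> warr s' ''M'' (A q) = v (narr s' ''ch'' (A q))) \<and>
    (\<forall>a. a \<notin> A ` {..<N} \<longrightarrow> warr s' ''M'' a = warr s2 ''M'' a \<and> narr s' ''ch'' a = narr s2 ''ch'' a))"
  proof (rule runs_Best)
    show "nvar s2 ''N'' = N" using tabsD(1)[OF tabs2] .
    fix s' q assume eq: "eq_off {''x''} {''ch''} {} {''M''} s2 s'" and q: "nvar s' ''x'' = q" "q < N"
    have ar: "narr s' a = narr s2 a" if "a \<noteq> ''ch''" for a using eq that by (simp add: eq_off_def)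
    have nr: "nvar s' x = nvar s2 x" if "x \<noteq> ''x''" for x using eq that by (simp add: eq_off_def)
    have "warr s' ''phi'' = warr s ''phi''" using eq v2 by (simp add: eq_off_def)
    moreover have "narr s2 ''code'' (pi * N + q) = set_encode (Sq q \<inter> Y pi)"
      using sd2 q pi i by (simp add: code_ok_def)
    moreover have "narr s2 ''pw'' (n + i) = 2 ^ (n + i)" "narr s2 ''mN'' pi = pi * N" "narr s2 ''mN'' i = i * N"
      "narr s2 ''mn'' q = q * n" using tabsD(2,4,5)[OF tabs2] i pi q by simp_all
    moreover have "0 < narr s2 ''dep'' (q * n) \<longleftrightarrow> \<not> indep (Sq q)" "0 < narr s2 ''nsub'' (i * N + q) \<longleftrightarrow> \<not> Sq q \<subseteq> Y i"
      using sd2 q i by (simp_all add: dep_ok_def nsub_ok_def)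
    ultimately show "(bval cand s' \<longleftrightarrow> admissible i q) \<and> nval (msg_key ''p'') s' = A q \<and> wval ?val s' = v q"
      using ar nr v2(1,2) enc2 q by (simp add: A_def v_def addr_def admissible_def)
  qed
  let ?I = "\<lambda>s3 x s'. (\<forall>q<x. warr s' ''phi'' (pi * N + q) = warr s3 ''phi'' (pi * N + q) + warr s3 ''M'' (addr i (Sq q \<inter> Y i))) \<and>
      (\<forall>a. a \<notin> {pi * N..<pi * N + x} \<longrightarrow> warr s' ''phi'' a = warr s3 ''phi'' a) \<and> warr s' ''M'' = warr s3 ''M''"
  have P: "runs ?P s3 (N * 3 + 2) (?I s3 N)" if f3: "framed ?B s2 s3" for s3
  proof (rule runs_For[where u = 1 and l = 0 and h = N and I = "?I s3"])
    have st3: "static s3"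
      by (rule static_framed[OF st2 f3]) (auto simp: input_vars_def input_arrs_def)
    fix q s' assume f: "framed ?P s3 s'"
    have st4: "static s'"
      by (rule static_framed[OF st3 f]) (auto simp: input_vars_def input_arrs_def)
    note sd4 = st4[unfolded static_def]
    note enc4 = enc_vars[OF conjunct1[OF sd4]]
    have tabs4: "tabs s'" using sd4 by simp
    show "nval (NVar ''N'') s' = N" using tabsD(1)[OF tabs4] by simp
    assume q: "q < N" "nvar s' ''x'' = q" and I: "?I s3 q s'"
    have v4: "nvar s' ''i'' = i" "nvar s' ''p'' = pi" using f f3 v2 by (simp_all add: framed_def)
    have "narr s' ''code'' (i * N + q) = set_encode (Sq q \<inter> Y i)"
      using sd4 q i by (simp add: code_ok_def)
    moreover have "narr s' ''pw'' (n + i) = 2 ^ (n + i)" "narr s' ''mN'' pi = pi * N" "narr s' ''mN'' i = i * N"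
      using tabsD(2,5)[OF tabs4] i pi by simp_all
    ultimately have "nval (phi_key ''p'') s' = pi * N + q"
      "nval (msg_key ''i'') s' = addr i (Sq q \<inter> Y i)"
      using v4 enc4 q by (simp_all add: addr_def)
    then show "runs push s' 1 (\<lambda>s''. ?I s3 (Suc q) (setn s'' ''x'' (Suc q)))"
      using I by (intro runs_WStore) (auto simp: less_Suc_eq)
  qed auto
  have fin: "phi_is s4 i \<and> (\<forall>i'. i \<le> i' \<longrightarrow> i' \<le> m \<longrightarrow> bellman s4 i')"
    if f3: "framed ?B s2 s3" and b: "\<forall>q<N. admissible i q \<longrightarrow> v q \<le> warr s3 ''M'' (A q) \<and> narr s3 ''ch'' (A q) < N \<and>
        admissible i (narr s3 ''ch'' (A q)) \<and> A (narr s3 ''ch'' (A q)) = A q \<and> warr s3 ''M'' (A q) = v (narr s3 ''ch'' (A q))"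
      and keep: "\<forall>a. a \<notin> A ` {..<N} \<longrightarrow> warr s3 ''M'' a = warr s2 ''M'' a \<and> narr s3 ''ch'' a = narr s2 ''ch'' a"
      and f4: "framed ?P s3 s4" and I: "?I s3 N s4" for s3 s4
  proof -
    have M4: "warr s4 ''M'' = warr s3 ''M''" "narr s4 ''ch'' = narr s3 ''ch''"
      using I f4 by (simp_all add: framed_def)
    have phi3: "warr s3 ''phi'' = warr s ''phi''" using f3 v2 by (simp add: framed_def)
    have sub: "S \<inter> Y c \<subseteq> {..<n}" for S c using Y_subset by blast
    have old: "warr s4 ''M'' (addr c R) = warr s ''M'' (addr c R) \<and> narr s4 ''ch'' (addr c R) = narr s ''ch'' (addr c R)"
      if "Suc i \<le> c" "R \<subseteq> {..<n}" for c R
    proof -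
      have "addr c R \<notin> A ` {..<N}"
        using addr_inj[OF _ that(2) sub] that(1) by (fastforce simp: A_def)
      then show ?thesis using keep M4 v2 by simp
    qed
    \<comment> \<open>At stage \<open>Suc i\<close> potentials involve only messages of bags after
      \<open>i\<close>, so it makes no difference whether they are evaluated before or after this
      step.\<close>
    have pot_eq: "pot (msg s4) (Suc i) l S = pot (msg s) (Suc i) l S" for l S
      by (rule pot_cong) (use old sub in auto)
    have v_eq: "v q = pot (msg s4) (Suc i) i (Sq q)" if "q < N" "admissible i q" for q
      using phi that by (simp add: phi_is_def v_def pot_eq)
    have "bellman s4 i"
      unfolding bellman_def Let_def
    proof (intro allI impI)
      fix q assume q: "q < N" "admissible i q"
      define q' where "q' = narr s4 ''ch'' (A q)"
      have b': "v q \<le> warr s4 ''M'' (A q)" "q' < N" "admissible i q'" "A q' = A q" "warr s4 ''M'' (A q) = v q'"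
        using b q unfolding q'_def M4 by blast+
      have "Sq q' \<inter> Y pi = Sq q \<inter> Y pi"
        using addr_inj[OF b'(4)[unfolded A_def] sub sub] by simp
      then show "pot (msg s4) (Suc i) i (Sq q) \<le> warr s4 ''M'' (addr i (Sq q \<inter> Y (p i))) \<and>
          narr s4 ''ch'' (addr i (Sq q \<inter> Y (p i))) < N \<and> admissible i (narr s4 ''ch'' (addr i (Sq q \<inter> Y (p i)))) \<and>
          Sq (narr s4 ''ch'' (addr i (Sq q \<inter> Y (p i)))) \<inter> Y (p i) = Sq q \<inter> Y (p i) \<and>
          warr s4 ''M'' (addr i (Sq q \<inter> Y (p i))) =
            pot (msg s4) (Suc i) i (Sq (narr s4 ''ch'' (addr i (Sq q \<inter> Y (p i)))))"
        using b' v_eq[OF q] v_eq[OF b'(2,3)] unfolding q'_def A_def pi_def by simp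
    qed
    moreover have "bellman s4 i'" if "i < i'" "i' \<le> m" for i'
      by (rule bellman_cong[OF _ bell[OF that] that(2)]) (use old that in auto)
    moreover have "phi_is s4 i"
      unfolding phi_is_def
    proof (intro allI impI)
      fix l q assume l: "l < i" "q < N" "admissible l q"
      have ph: "warr s ''phi'' (l * N + q) = pot (msg s4) (Suc i) l (Sq q)"
        using phi l by (simp add: phi_is_def pot_eq)
      have step: "pot (msg s4) i l (Sq q) = pot (msg s4) (Suc i) l (Sq q) + (if l = p i then msg s4 i (Sq q \<inter> Y i) else 0)"
        by (rule pot_step[OF i])
      show "warr s4 ''phi'' (l * N + q) = pot (msg s4) i l (Sq q)"
      proof (cases "l = pi")
        case True
        then show ?thesis using I l(2) ph step phi3 M4 by (simp add: pi_def)
      next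
        case False
        have "l * N + q \<notin> {pi * N..<pi * N + N}"
        proof
          assume "l * N + q \<in> {pi * N..<pi * N + N}"
          then have "l * N + q = pi * N + (l * N + q - pi * N)" "l * N + q - pi * N < N" by auto
          with row_col_inj[of l N q pi "l * N + q - pi * N"] l(2) False show False by blast
        qed
        then show ?thesis using I ph step phi3 False by (simp add: pi_def)
      qed
    qed
    ultimately show ?thesis by (metis le_neq_implies_less)
  qed
  have BP: "runs (Seq ?B ?P) s2 (N * 13 + 6) (\<lambda>s'. phi_is s' i \<and> (\<forall>i'. i \<le> i' \<longrightarrow> i' \<le> m \<longrightarrow> bellman s' i'))"
  proof (rule runs_Seq[OF B])
    fix s3
    assume f3: "framed ?B s2 s3" and b: "(\<forall>q<N. admissible i q \<longrightarrow> v q \<le> warr s3 ''M'' (A q) \<and> narr s3 ''ch'' (A q) < N \<and>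
        admissible i (narr s3 ''ch'' (A q)) \<and> A (narr s3 ''ch'' (A q)) = A q \<and> warr s3 ''M'' (A q) = v (narr s3 ''ch'' (A q))) \<and>
      (\<forall>a. a \<notin> A ` {..<N} \<longrightarrow> warr s3 ''M'' a = warr s2 ''M'' a \<and> narr s3 ''ch'' a = narr s2 ''ch'' a)"
    show "runs ?P s3 (N * 3 + 2) (\<lambda>s'. phi_is s' i \<and> (\<forall>i'. i \<le> i' \<longrightarrow> i' \<le> m \<longrightarrow> bellman s' i'))"
      by (rule runs_mono[OF P[OF f3] order.refl], rule fin[OF f3 conjunct1[OF b] conjunct2[OF b]])
  qed simp
  show ?thesis
    unfolding Process_def
    apply (rule runs_Seq_NAssign[where t = "N * 13 + 7"], unfold e1 s1_def[symmetric])
     apply (rule runs_Seq_NAssign[where t = "N * 13 + 6"], unfold e2 s2_def[symmetric])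
    by (rule BP, simp_all)
qed

lemma runs_DP:
  assumes st: "static s" and phi: "phi_ok s"
  shows "runs DP s (m * (N * 13 + 10) + 2) (\<lambda>s'. \<forall>i. 1 \<le> i \<longrightarrow> i \<le> m \<longrightarrow> bellman s' i)"
proof -
  let ?I = "\<lambda>c s'. phi_is s' (Suc (m - c)) \<and> (\<forall>i. m - c < i \<longrightarrow> i \<le> m \<longrightarrow> bellman s' i)"
  have indep_c: "phi_is (s'\<lparr>nvar := f\<rparr>) = phi_is s'" "bellman (s'\<lparr>nvar := f\<rparr>) = bellman s'" for s' f
    by (simp_all add: phi_is_def bellman_def fun_eq_iff)
  have "runs DP s (m * (N * 13 + 10) + 2) (?I m)"
    unfolding DP_def
  proof (rule runs_For[where u = "N * 13 + 8" and l = 0 and h = m and I = ?I])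
    \<comment> \<open>No bag has sent a message yet, so the potentials are the bare weights computed
      into \<open>phi\<close>.\<close>
    have "children (Suc m) l = {}" for l by (auto simp: children_def)
    then have "phi_is s (Suc m)" using phi by (simp add: phi_is_def phi_ok_def pot_def)
    then show "?I 0 (setn s ''c'' 0)" by (simp add: indep_c)
  next
    fix c s' assume f: "framed (For ''c'' n0 (NVar ''nT'') Process) s s'"
    have st': "static s'"
      by (rule static_framed[OF st f]) (auto simp: input_vars_def input_arrs_def)
    then have nv: "nvar s' ''nT'' = m" using enc_vars(3) by (simp add: static_def)
    then show "nval (NVar ''nT'') s' = m" by simp
    assume c: "c < m" "nvar s' ''c'' = c" and I: "?I c s'"
    have mc: "1 \<le> m - c" "m - c \<le> m" "c = m - (m - c)" "Suc (m - Suc c) = m - c" using c(1) by simp_all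
    have "runs Process s' (N * 13 + 8) (\<lambda>s''. phi_is s'' (m - c) \<and> (\<forall>i'. m - c \<le> i' \<longrightarrow> i' \<le> m \<longrightarrow> bellman s'' i'))"
      by (rule runs_Process[OF st' _ _ mc(1,2)]) (use I c mc in auto)
    then show "runs Process s' (N * 13 + 8) (\<lambda>s''. ?I (Suc c) (setn s'' ''c'' (Suc c)))"
      by (rule runs_mono) (use mc(1,4) in \<open>auto simp: indep_c\<close>)
  qed simp_all
  then show ?thesis by (rule runs_mono) auto
qed

section \<open>Reading off an optimal packing from the messages\<close>

definition choice :: "state \<Rightarrow> nat \<Rightarrow> nat set \<Rightarrow> nat set" where
  "choice s i R = Sq (narr s ''ch'' (addr i R))"

lemma bellman_msg:
  assumes "bellman s i" "i \<le> m" "S \<subseteq> Y i" "indep S"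
  shows "pot (msg s) (Suc i) i S \<le> msg s i (S \<inter> Y (p i))"
proof -
  obtain q where "q < N" "Sq q = S" "admissible i q" using indep_bag_subset[OF assms(2-4)] .
  with assms(1) show ?thesis by (auto simp: bellman_def Let_def)
qed

text \<open>The trace \<open>R\<close> is itself an admissible subset of bag \<open>i\<close> whose
  trace on the parent is \<open>R\<close>. Hence the recursion applies at its key, and the entry of
  \<open>ch\<close> found there is meaningful.\<close>

lemma bellman_choice:
  assumes "bellman s i" "i \<le> m" "R \<subseteq> Y i \<inter> Y (p i)" "indep R"
  shows "narr s ''ch'' (addr i R) < N" "choice s i R \<subseteq> Y i \<and> indep (choice s i R) \<and>
    choice s i R \<inter> Y (p i) = R \<and> pot (msg s) (Suc i) i (choice s i R) = msg s i R"
proof -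
  from assms(3) have "R \<subseteq> Y i" "R \<inter> Y (p i) = R" by auto
  moreover from indep_bag_subset[OF assms(2) this(1) assms(4)]
  obtain q where "q < N" "Sq q = R" "admissible i q" .
  moreover from this assms(1) have "let a = addr i (Sq q \<inter> Y (p i)); q' = narr s ''ch'' a in
       pot (msg s) (Suc i) i (Sq q) \<le> warr s ''M'' a \<and> q' < N \<and> admissible i q' \<and>
       Sq q' \<inter> Y (p i) = Sq q \<inter> Y (p i) \<and> warr s ''M'' a = pot (msg s) (Suc i) i (Sq q')"
    unfolding bellman_def by blast
  ultimately show "narr s ''ch'' (addr i R) < N" "choice s i R \<subseteq> Y i \<and> indep (choice s i R) \<and>
    choice s i R \<inter> Y (p i) = R \<and> pot (msg s) (Suc i) i (choice s i R) = msg s i R"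
    by (simp_all add: choice_def admissible_def Let_def)
qed

text \<open>When bag \<open>i\<close> is reached, \<open>sel\<close> marks
  \<open>recon (choice s) (i - 1)\<close>, and its code on \<open>Y i\<close> completes the key for
  \<open>ch\<close>. No intersection with the parent bag is computed, as \<open>recon_trace\<close>
  shows that the trace already lies there.\<close>

lemma runs_Extract:
  assumes st: "static s" and bell: "\<And>i. 1 \<le> i \<Longrightarrow> i \<le> m \<Longrightarrow> bellman s i"
  shows "runs Extract s (m * (n * 8 + 8) + n * 3 + 4)
    (\<lambda>s'. \<forall>j<n. narr s' ''sel'' j = 1 \<longleftrightarrow> j \<in> recon (choice s) m)"
  unfolding Extract_def
proof (rule runs_Seq)
  let ?F0 = "For ''x'' n0 (NVar ''nJ'') (NStore ''sel'' (NVar ''x'') n0)"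
  have nJ: "nvar s ''nJ'' = n" "nvar s ''nT'' = m" using st enc_vars by (auto simp: static_def)
  show "runs ?F0 s (n * 3 + 2) (\<lambda>s'. \<forall>j<n. narr s' ''sel'' j = 0)"
    by (rule runs_For[where u = 1 and l = 0 and h = n])
      (use nJ in \<open>auto simp: framed_def less_Suc_eq intro!: runs_NStore\<close>)
  fix s1 assume f1: "framed ?F0 s s1" and z: "\<forall>j<n. narr s1 ''sel'' j = 0"
  let ?r = "recon (choice s)"
  let ?F = "For ''x'' n0 (NVar ''nJ'') add_member"
  let ?B = "Seq sel_code (Seq (NAssign ''q'' best_code) ?F)"
  let ?L = "For ''i'' n1 (NPlus (NVar ''nT'') n1) ?B"
  have st1: "static s1" by (rule static_framed[OF st f1]) (auto simp: input_vars_def input_arrs_def)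
  show "runs ?L s1 (m * (n * 8 + 8) + 2) (\<lambda>s'. \<forall>j<n. narr s' ''sel'' j = 1 \<longleftrightarrow> j \<in> ?r m)"
  proof (rule runs_mono[OF runs_For[where u = "n * 8 + 6" and l = 1 and h = "Suc m" and
        I = "\<lambda>i s'. \<forall>j<n. narr s' ''sel'' j = 1 \<longleftrightarrow> j \<in> ?r (i - 1)"] order.refl])
    show "\<forall>j<n. narr (setn s1 ''i'' 1) ''sel'' j = 1 \<longleftrightarrow> j \<in> ?r (1 - 1)"
      using z by simp
  next
    fix i s' assume f: "framed ?L s1 s'"
    have st': "static s'" by (rule static_framed[OF st1 f]) (auto simp: input_vars_def input_arrs_def)
    have nv: "nvar s' ''nT'' = m" "nvar s' ''nJ'' = n" using enc_vars st' by (auto simp: static_def)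
    show "nval (NPlus (NVar ''nT'') n1) s' = Suc m" using nv by simp
    assume i: "1 \<le> i" "i < Suc m" "nvar s' ''i'' = i"
      and I: "\<forall>j<n. narr s' ''sel'' j = 1 \<longleftrightarrow> j \<in> ?r (i - 1)"
    obtain i' where i': "i = Suc i'" using i(1) by (cases i) auto
    then have im: "Suc i' \<le> m" using i by simp
    have ch_spec: "choice s c R \<subseteq> Y c \<and> indep (choice s c R) \<and>
        choice s c R \<inter> Y (p c) = R \<and> pot (msg s) (Suc c) c (choice s c R) = msg s c R"
      if "1 \<le> c" "c \<le> m" "R \<subseteq> Y c \<inter> Y (p c)" "indep R" for c R
      using bellman_choice(2)[OF bell[OF that(1,2)] that(2-4)] .
    define R where "R = ?r i' \<inter> Y i"
    define q where "q = narr s ''ch'' (addr i R)"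
    have R: "R \<subseteq> Y i \<inter> Y (p i)" "indep R"
      using recon_trace[where ch = "choice s" and Msg = "msg s", OF ch_spec im] unfolding R_def i' by blast+
    have q: "q < N" unfolding q_def
      using bellman_choice(1)[OF bell _ R] i by simp
    have recon: "?r i = ?r i' \<union> Sq q" by (simp add: i' R_def q_def choice_def)
    have ch': "narr s' ''ch'' = narr s ''ch''" using f f1 by (simp add: framed_def)
    show "runs ?B s' (n * 8 + 6) (\<lambda>s''. \<forall>j<n. narr (setn s'' ''i'' (Suc i)) ''sel'' j = 1 \<longleftrightarrow> j \<in> ?r (Suc i - 1))"
    proof (rule runs_Seq)
      have tabs': "tabs s'" and bags': "bags_ok s'" using st' by (simp_all add: static_def)
      show "runs sel_code s' (n * 4 + 3) (\<lambda>s'. nvar s' ''acc'' = 0 + (\<Sum>z\<in>{0..<n}. if z \<in> ?r i' \<and> z \<in> Y i then 2 ^ z else 0))"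
      proof (rule runs_SumL)
        have "i - 1 = i'" by (simp add: i')
        with I have *: "\<forall>j<n. narr s' ''sel'' j = 1 \<longleftrightarrow> j \<in> ?r i'" by simp
        have "\<forall>j<n. 0 < narr s' ''Y'' (i * n + j) \<longleftrightarrow> j \<in> Y i" "narr s' ''mn'' i = i * n"
          using bags' i tabsD(4)[OF tabs', of i] by (simp_all add: bags_ok_def)
        note * = * this
        show "\<And>s''. eq_off {''acc'', ''z''} {} {} {} s' s'' \<Longrightarrow> nvar s'' ''z'' < n \<Longrightarrow>
            bval (BAnd (NEq (NArr ''sel'' (NVar ''z'')) n1) (NPos (cell ''Y'' ''mn'' ''i'' (NVar ''z'')))) s'' \<longleftrightarrow>
            nvar s'' ''z'' \<in> ?r i' \<and> nvar s'' ''z'' \<in> Y i"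
          using * i(3) by (simp add: eq_off_def)
      qed (use nv tabsD(2)[OF tabs'] in \<open>simp_all add: eq_off_def\<close>)
      fix s2 assume f2: "framed sel_code s' s2" and "nvar s2 ''acc'' = 0 + (\<Sum>z\<in>{0..<n}. if z \<in> ?r i' \<and> z \<in> Y i then 2 ^ z else 0)"
      moreover have "{0..<n} \<inter> {z. z \<in> ?r i' \<and> z \<in> Y i} = R" using Y_subset[of i] by (auto simp: R_def)
      ultimately have acc: "nvar s2 ''acc'' = set_encode R"
        by (simp add: set_encode_def sum.If_cases)
      define s3 where "s3 = setn s2 ''q'' q"
      have i2: "nvar s2 ''i'' = i" "nvar s2 ''nJ'' = n" "narr s2 = narr s'"
        using f2 i nv by (simp_all add: framed_def fun_eq_iff)
      have qv: "nval best_code s2 = q"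
        using acc i2 ch' tabsD(2)[OF tabs', of "n + i"] i by (simp add: q_def addr_def)
      have "runs ?F s3 (n * 4 + 2) (\<lambda>s''. \<forall>j<n. narr s'' ''sel'' j = 1 \<longleftrightarrow> j \<in> ?r i' \<or> j < n \<and> j \<in> Sq q)"
      proof (rule runs_For[where u = 2 and l = 0 and h = n and
            I = "\<lambda>x s''. \<forall>j<n. narr s'' ''sel'' j = 1 \<longleftrightarrow> j \<in> ?r i' \<or> j < x \<and> j \<in> Sq q"])
        show "\<forall>j<n. narr (setn s3 ''x'' 0) ''sel'' j = 1 \<longleftrightarrow> j \<in> ?r i' \<or> j < 0 \<and> j \<in> Sq q"
          using I i2 by (simp add: s3_def i')
      next
        fix x s4 assume f4: "framed ?F s3 s4"
        then show "nval (NVar ''nJ'') s4 = n" using i2 by (simp add: framed_def s3_def)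
        assume x: "x < n" "nvar s4 ''x'' = x" and J: "\<forall>j<n. narr s4 ''sel'' j = 1 \<longleftrightarrow> j \<in> ?r i' \<or> j < x \<and> j \<in> Sq q"
        have "narr s4 ''mem'' = narr s' ''mem''" "narr s4 ''mn'' = narr s' ''mn''" "nvar s4 ''q'' = q"
          using f4 i2 by (simp_all add: framed_def s3_def)
        moreover have "narr s' ''mn'' q = q * n" using tabsD(4)[OF tabs'] q by simp
        moreover have "0 < narr s' ''mem'' (q * n + x) \<longleftrightarrow> x \<in> Sq q"
          using st' q x by (simp add: static_def mem_ok_def)
        ultimately have b: "bval (NPos (cell ''mem'' ''mn'' ''q'' (NVar ''x''))) s4 \<longleftrightarrow> x \<in> Sq q" using x by simp
        show "runs add_member s4 2 (\<lambda>s''. \<forall>j<n. narr (setn s'' ''x'' (Suc x)) ''sel'' j = 1 \<longleftrightarrow>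
            j \<in> ?r i' \<or> j < Suc x \<and> j \<in> Sq q)"
          by (rule runs_Cond[where u = 1]; (rule runs_NStore runs_Skip)?)
            (use b x J in \<open>auto simp: less_Suc_eq\<close>)
      qed auto
      then have F: "runs ?F s3 (n * 4 + 2) (\<lambda>s''. \<forall>j<n. narr (setn s'' ''i'' (Suc i)) ''sel'' j = 1 \<longleftrightarrow> j \<in> ?r (Suc i - 1))"
        by (rule runs_mono) (auto simp: recon)
      show "runs (Seq (NAssign ''q'' best_code) ?F) s2 (n * 4 + 3) (\<lambda>s''. \<forall>j<n. narr (setn s'' ''i'' (Suc i)) ''sel'' j = 1 \<longleftrightarrow> j \<in> ?r (Suc i - 1))"
        apply (rule runs_Seq_NAssign, unfold qv s3_def[symmetric])
        by (rule F, simp)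
    qed simp
  qed (use nJ in simp_all)
qed simp

end

section \<open>The complete program\<close>

fun ReachAll :: "nat \<Rightarrow> com" where
  "ReachAll 0 = Reach0"
| "ReachAll (Suc q) = Seq (ReachAll q) (ReachS q)"

lemma mods_ReachAll [unfolded mods_def prod.inject, simp]:
  "mods (ReachAll q) = ({''x'', ''y'', ''z'', ''acc''}, reach ` {..q}, {}, {})"
  by (induction q) (auto simp: mods_def Reach0_def ReachS_def atMost_Suc)

definition Front :: "nat \<Rightarrow> nat \<Rightarrow> com" where
  "Front d k = Seq (Tables k) (Seq (ReachAll (d - 1)) (Seq (Conf d) Search))"

definition Back :: "nat \<Rightarrow> nat \<Rightarrow> com" where
  "Back k r = Seq (Bags r) (Seq (Mem k) (Seq Later (Seq Dep (Seq NSub (Seq Code (Seq Phi (Seq DP Extract)))))))"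

section \<open>Composition of the phases and total running time\<close>

context packing_instance
begin

text \<open>The part of the claimed bound governed by the family, with \<open>N\<close> in place of
  \<open>|J| ^ k\<close>.\<close>

definition B :: nat where
  "B = n * V * (n + m + V) + N * n * n * m * V"

text \<open>\<open>n\<close>, \<open>m\<close> and \<open>V\<close> are positive, so missing factors
  can be multiplied in: monomials with \<open>N\<close> grow into \<open>N * n * n * m * V\<close>,
  the others into terms of the first summand.\<close>

lemma monomials_le_B:
  "1 \<le> B" "n \<le> B" "m \<le> B" "N \<le> B" "n * V \<le> B" "n * V * V \<le> B" "n * n \<le> B" "n * n * V \<le> B"
  "m * n \<le> B" "m * n * V \<le> B" "N * n \<le> B" "N * n * n \<le> B" "m * N \<le> B" "m * N * n \<le> B"
proof -
  have ge: "a \<le> a * b" if "0 < b" for a b :: nat using that by simp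
  have U: "n * V * V \<le> B" "n * n * V \<le> B" "m * n * V \<le> B" by (simp_all add: B_def algebra_simps)
  have Z: "N * n * n * (m * V) \<le> B" by (simp add: B_def algebra_simps)
  show "n * V * V \<le> B" "n * n * V \<le> B" "m * n * V \<le> B" by fact+
  show 1: "n * V \<le> B" "n * n \<le> B" "m * n \<le> B"
    using ge[of V "n * V"] ge[of V "n * n"] ge[of V "m * n"] V U by linarith+
  show "n \<le> B" "m \<le> B" using ge[of V n] ge[of n m] V n 1 by linarith+
  then show "1 \<le> B" using n by linarith
  show "N * n * n \<le> B" using ge[of "m * V" "N * n * n"] m V Z by (meson le_trans nat_0_less_mult_iff)
  then show "N * n \<le> B" using ge[of n "N * n"] n by linarith
  then show "N \<le> B" using ge[of n N] n by linarith
  have "m * N * n \<le> m * N * n * (n * V)" using ge[of "n * V" "m * N * n"] n V by simp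
  also have "\<dots> = N * n * n * (m * V)" by (simp add: algebra_simps)
  finally show "m * N * n \<le> B" using Z by linarith
  then show "m * N \<le> B" using ge[of n "m * N"] n by linarith
qed

lemma runs_ReachAll:
  assumes s: "enc s" "tabs s"
  shows "runs (ReachAll q) s (Suc q * reach_time) (\<lambda>s'. \<forall>q'\<le>q. reach_ok q' s')"
proof (induction q)
  case 0
  show ?case using runs_Reach0[OF s] by simp
next
  case (Suc q)
  show ?case
    unfolding ReachAll.simps
  proof (rule runs_Seq[OF Suc.IH])
    fix s1 assume f: "framed (ReachAll q) s s1" and r: "\<forall>q'\<le>q. reach_ok q' s1"
    have "enc s1" by (rule enc_framed[OF s(1) f]) (auto simp: input_vars_def input_arrs_def)
    moreover have "tabs s1" by (rule tabs_framed[OF s(2) f]) auto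
    ultimately have "runs (ReachS q) s1 reach_time (reach_ok (Suc q))"
      using r by (intro runs_ReachS) auto
    then show "runs (ReachS q) s1 reach_time (\<lambda>s'. \<forall>q'\<le>Suc q. reach_ok q' s')"
    proof (rule runs_mono[OF _ order.refl])
      fix s2 assume f2: "framed (ReachS q) s1 s2" and "reach_ok (Suc q) s2"
      moreover have "reach_ok q' s2" if "q' \<le> q" for q'
        by (rule reach_ok_framed[OF _ f2]) (use r that in \<open>auto simp: ReachS_def\<close>)
      ultimately show "\<forall>q'\<le>Suc q. reach_ok q' s2" by (simp add: le_Suc_eq)
    qed
  qed simp
qed

lemma runs_Front:
  assumes e0: "enc s"
  shows "runs (Front d k) s ((12 * k + 16 * d + 200) * B)
    (\<lambda>s'. enc s' \<and> tabs s' \<and> reach_ok r s' \<and> confl_ok s' \<and> order_ok s')"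
proof -
  from runs_Tables[OF enc_vars(2,1,3)[OF e0] N]
  obtain t1 s1 where 1: "exec (Tables k) s t1 s1" "t1 \<le> k * (n * 4 + 8) + 12 * (n + m + N) + 40" "tabs s1"
    and f1: "framed (Tables k) s s1"
    unfolding tabs_def by (rule runsE)
  have e1: "enc s1" by (rule enc_framed[OF e0 f1]) (auto simp: input_vars_def input_arrs_def)
  from runs_ReachAll[OF e1 1(3)] obtain t2 s2
    where 2: "exec (ReachAll (d - 1)) s1 t2 s2" "t2 \<le> Suc (d - 1) * reach_time"
      and r2: "\<forall>q\<le>d - 1. reach_ok q s2" and f2: "framed (ReachAll (d - 1)) s1 s2"
    by (rule runsE)
  have e2: "enc s2" by (rule enc_framed[OF e1 f2]) (auto simp: input_vars_def input_arrs_def)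
  have k2: "tabs s2" by (rule tabs_framed[OF 1(3) f2]) auto
  from runs_Conf[OF e2 k2] r2 have "runs (Conf d) s2 (n * (n * (V * 4 + 6) + 4) + 2) confl_ok" by simp
  then obtain t3 s3 where 3: "exec (Conf d) s2 t3 s3" "t3 \<le> n * (n * (V * 4 + 6) + 4) + 2" "confl_ok s3"
    and f3: "framed (Conf d) s2 s3" by (rule runsE)
  have e3: "enc s3" by (rule enc_framed[OF e2 f3]) (auto simp: input_vars_def input_arrs_def Conf_def)
  have k3: "tabs s3" by (rule tabs_framed[OF k2 f3]) (auto simp: Conf_def)
  have r3: "reach_ok r s3" by (rule reach_ok_framed[OF _ f3]) (use r2 d in \<open>auto simp: Conf_def\<close>)
  from runs_Search[OF e3] obtain t4 s4 where 4: "exec Search s3 t4 s4" "t4 \<le> m * 22 + 11" "order_ok s4"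
    and f4: "framed Search s3 s4" by (rule runsE)
  have e4: "enc s4" by (rule enc_framed[OF e3 f4]) (auto simp: input_vars_def input_arrs_def)
  have k4: "tabs s4" by (rule tabs_framed[OF k3 f4]) auto
  have r4: "reach_ok r s4" by (rule reach_ok_framed[OF r3 f4]) auto
  have c4: "confl_ok s4" by (rule confl_ok_framed[OF 3(3) f4]) auto
  note B = monomials_le_B
  have "k * (n * 4 + 8) \<le> k * (12 * B)"
    using B by (intro mult_le_mono2) linarith
  then have t1: "t1 \<le> (12 * k + 76) * B" using 1(2) B by (simp add: algebra_simps)
  have "Suc (d - 1) * reach_time \<le> d * (16 * B)"
    using B d by (intro mult_le_mono) (simp_all add: algebra_simps)
  then have t2: "t2 \<le> 16 * d * B" using 2(2) by simp
  have t3: "t3 \<le> 16 * B" using 3(2) B by (simp add: algebra_simps)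
  have t4: "t4 \<le> 33 * B" using 4(2) B by simp
  have "t1 + (t2 + (t3 + t4)) \<le> (12 * k + 16 * d + 200) * B"
    using t1 t2 t3 t4 by (simp add: algebra_simps)
  with exec.Seq[OF 1(1) exec.Seq[OF 2(1) exec.Seq[OF 3(1) 4(1)]]] e4 k4 r4 c4 4(3)
  show ?thesis unfolding runs_def Front_def by blast
qed

end

context ordered_instance
begin

lemma distance_packing_iff:
  "distance_packing d G {..<n} H I \<longleftrightarrow> I \<subseteq> {..<n} \<and> indep I"
proof -
  have "enat d \<le> set_dist G (verts (H i)) (verts (H j)) \<longleftrightarrow> \<not> confl i j" if "i < n" for i j
    unfolding confl_def using set_dist_ge_iff[OF G] HV[OF that] vG d by simp
  then show ?thesis unfolding distance_packing_def indep_def by blast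
qed

text \<open>The two halves of \<open>bellman\<close> meet at the root:
  \<open>pot (msg s) 1 0 {}\<close> bounds the weight of every packing and is attained by the
  reconstruction.\<close>

lemma recon_max_weight:
  assumes "\<And>i. 1 \<le> i \<Longrightarrow> i \<le> m \<Longrightarrow> bellman s i"
  shows "max_weight_distance_packing d G {..<n} H w (recon (choice s) m)"
proof -
  have opt: "recon (choice s) m \<subseteq> {..<n} \<and> indep (recon (choice s) m) \<and>
      sum w (recon (choice s) m) = pot (msg s) 1 0 {}"
    by (rule recon_optimal) (rule bellman_choice(2)[OF assms])
  moreover have "sum w I \<le> pot (msg s) 1 0 {}" if "I \<subseteq> {..<n}" "indep I" for I
    by (rule weight_le_root_pot[OF bellman_msg[OF assms] that])
  ultimately show ?thesis
    unfolding max_weight_distance_packing_def distance_packing_iff by simp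
qed

lemma runs_Back:
  assumes e0: "enc s" and k0: "tabs s" and r0: "reach_ok r s" and c0: "confl_ok s" and o0: "order_is s"
  shows "runs (Back k r) s (600 * B) (\<lambda>s'. max_weight_distance_packing d G {..<n} H w (output_set s' {..<n}))"
proof -
  note sets = input_vars_def input_arrs_def
  from runs_Bags[OF e0 k0 r0 o0] obtain t1 s1
    where 1: "exec (Bags r) s t1 s1" "t1 \<le> (m + 1) * (n * (V * 4 + 6) + 4) + 2" "bags_ok s1"
      and f1: "framed (Bags r) s s1" by (rule runsE)
  have k1: "enc s1" "tabs s1" "confl_ok s1" "order_is s1"
    using enc_framed[OF e0 f1] tabs_framed[OF k0 f1] confl_ok_framed[OF c0 f1] order_is_framed[OF o0 f1]
    by (simp_all add: sets Bags_def)
  from runs_Mem[OF k1(1,2)] obtain t2 s2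
    where 2: "exec (Mem k) s1 t2 s2" "t2 \<le> N * (n * 10 + 4) + 2" "mem_ok s2" and f2: "framed (Mem k) s1 s2"
    by (rule runsE)
  have k2: "enc s2" "tabs s2" "confl_ok s2" "order_is s2" "bags_ok s2"
    using enc_framed[OF k1(1) f2] tabs_framed[OF k1(2) f2] confl_ok_framed[OF k1(3) f2]
      order_is_framed[OF k1(4) f2] bags_ok_framed[OF 1(3) f2]
    by (simp_all add: sets Mem_def)
  from runs_Later[OF k2(1,2) 2(3) k2(3)] obtain t3 s3
    where 3: "exec Later s2 t3 s3" "t3 \<le> N * (n * (n * 4 + 6) + 4) + 2" "later_ok s3" and f3: "framed Later s2 s3"
    by (rule runsE)
  have k3: "enc s3" "tabs s3" "order_is s3" "bags_ok s3" "mem_ok s3"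
    using enc_framed[OF k2(1) f3] tabs_framed[OF k2(2) f3] order_is_framed[OF k2(4) f3]
      bags_ok_framed[OF k2(5) f3] mem_ok_framed[OF 2(3) f3]
    by (simp_all add: sets Later_def)
  from runs_Dep[OF k3(1,2,5) 3(3)] obtain t4 s4
    where 4: "exec Dep s3 t4 s4" "t4 \<le> N * (n * 4 + 10) + 2" "dep_ok s4" and f4: "framed Dep s3 s4"
    by (rule runsE)
  have k4: "enc s4" "tabs s4" "order_is s4" "bags_ok s4" "mem_ok s4"
    using enc_framed[OF k3(1) f4] tabs_framed[OF k3(2) f4] order_is_framed[OF k3(3) f4]
      bags_ok_framed[OF k3(4) f4] mem_ok_framed[OF k3(5) f4]
    by (simp_all add: sets Dep_def)
  from runs_NSub[OF k4(1,2,5,4)] obtain t5 s5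
    where 5: "exec NSub s4 t5 s5" "t5 \<le> (m + 1) * (N * (n * 4 + 6) + 4) + 2" "nsub_ok s5" and f5: "framed NSub s4 s5"
    by (rule runsE)
  have k5: "enc s5" "tabs s5" "order_is s5" "bags_ok s5" "mem_ok s5" "dep_ok s5"
    using enc_framed[OF k4(1) f5] tabs_framed[OF k4(2) f5] order_is_framed[OF k4(3) f5]
      bags_ok_framed[OF k4(4) f5] mem_ok_framed[OF k4(5) f5] dep_ok_framed[OF 4(3) f5]
    by (simp_all add: sets NSub_def)
  from runs_Code[OF k5(1,2,5,4)] obtain t6 s6
    where 6: "exec Code s5 t6 s6" "t6 \<le> (m + 1) * (N * (n * 4 + 6) + 4) + 2" "code_ok s6" and f6: "framed Code s5 s6"
    by (rule runsE)
  have k6: "enc s6" "tabs s6" "order_is s6" "bags_ok s6" "mem_ok s6" "dep_ok s6" "nsub_ok s6"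
    using enc_framed[OF k5(1) f6] tabs_framed[OF k5(2) f6] order_is_framed[OF k5(3) f6]
      bags_ok_framed[OF k5(4) f6] mem_ok_framed[OF k5(5) f6] dep_ok_framed[OF k5(6) f6] nsub_ok_framed[OF 5(3) f6]
    by (simp_all add: sets Code_def)
  then have st6: "static s6" using 6(3) by (simp add: static_def)
  from runs_Phi[OF k6(1,2,5,4,3)] obtain t7 s7
    where 7: "exec Phi s6 t7 s7" "t7 \<le> (m + 1) * (N * (n * 4 + 6) + 4) + 2" "phi_ok s7" and f7: "framed Phi s6 s7"
    by (rule runsE)
  have st7: "static s7" using static_framed[OF st6 f7] by (simp add: sets Phi_def)
  from runs_DP[OF st7 7(3)] obtain t8 s8
    where 8: "exec DP s7 t8 s8" "t8 \<le> m * (N * 13 + 10) + 2" "\<forall>i. 1 \<le> i \<longrightarrow> i \<le> m \<longrightarrow> bellman s8 i"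
      and f8: "framed DP s7 s8"
    by (rule runsE)
  have st8: "static s8" using static_framed[OF st7 f8] by (simp add: sets)
  have "\<And>i. 1 \<le> i \<Longrightarrow> i \<le> m \<Longrightarrow> bellman s8 i" using 8(3) by simp
  from runs_Extract[OF st8 this] obtain t9 s9
    where 9: "exec Extract s8 t9 s9" "t9 \<le> m * (n * 8 + 8) + n * 3 + 4"
      "\<forall>j<n. narr s9 ''sel'' j = 1 \<longleftrightarrow> j \<in> recon (choice s8) m"
    by (rule runsE)
  have max: "max_weight_distance_packing d G {..<n} H w (recon (choice s8) m)"
    using 8(3) by (intro recon_max_weight) simp
  then have "recon (choice s8) m \<subseteq> {..<n}"
    by (simp add: max_weight_distance_packing_def distance_packing_iff)
  with 9(3) have "output_set s9 {..<n} = recon (choice s8) m" by (auto simp: output_set_def)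
  with max have res: "max_weight_distance_packing d G {..<n} H w (output_set s9 {..<n})" by simp
  note B = monomials_le_B
  have "t1 \<le> 30 * B" using 1(2) B by (simp add: algebra_simps)
  moreover have "t2 \<le> 16 * B" using 2(2) B by (simp add: algebra_simps)
  moreover have "t3 \<le> 16 * B" using 3(2) B by (simp add: algebra_simps)
  moreover have "t4 \<le> 16 * B" using 4(2) B by (simp add: algebra_simps)
  moreover have "t5 \<le> 30 * B" using 5(2) B by (simp add: algebra_simps)
  moreover have "t6 \<le> 30 * B" using 6(2) B by (simp add: algebra_simps)
  moreover have "t7 \<le> 30 * B" using 7(2) B by (simp add: algebra_simps)
  moreover have "t8 \<le> 30 * B" using 8(2) B by (simp add: algebra_simps)
  moreover have "t9 \<le> 30 * B" using 9(2) B by (simp add: algebra_simps)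
  ultimately have "t1 + (t2 + (t3 + (t4 + (t5 + (t6 + (t7 + (t8 + t9))))))) \<le> 600 * B" by simp
  with exec.Seq[OF 1(1) exec.Seq[OF 2(1) exec.Seq[OF 3(1) exec.Seq[OF 4(1) exec.Seq[OF 5(1)
    exec.Seq[OF 6(1) exec.Seq[OF 7(1) exec.Seq[OF 8(1) 9(1)]]]]]]]] res
  show ?thesis unfolding runs_def Back_def by blast
qed

end

text \<open>The program is split after the search because \<open>nd\<close> and \<open>p\<close> are
  parameters of \<open>ordered_instance\<close>, whereas the order exists only in the state that the
  search leaves behind. The locale is interpreted there.\<close>

lemma (in packing_instance) runs_Front_Back:
  assumes "enc s"
  shows "runs (Seq (Front d k) (Back k r)) s ((12 * k + 16 * d + 800) * B)
    (\<lambda>s'. max_weight_distance_packing d G {..<n} H w (output_set s' {..<n}))"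
proof (rule runs_Seq[OF runs_Front[OF assms]])
  fix s1 assume s1: "enc s1 \<and> tabs s1 \<and> reach_ok r s1 \<and> confl_ok s1 \<and> order_ok s1"
  interpret ordered_instance d k r G H w T X n V m N "narr s1 ''ord''" "narr s1 ''pp''"
    using s1 packing_instance_axioms
    by (simp add: ordered_instance_def ordered_instance_axioms_def order_ok_def)
  show "runs (Back k r) s1 (600 * B) (\<lambda>s'. max_weight_distance_packing d G {..<n} H w (output_set s' {..<n}))"
    using s1 by (intro runs_Back) (simp_all add: order_is_def)
next
  show "(12 * k + 16 * d + 200) * B + 600 * B \<le> (12 * k + 16 * d + 800) * B"
    by (simp add: algebra_simps)
qed

theorem theorem3p10:
  fixes d k :: nat
  assumes "even d" and "0 < d" and "1 \<le> k"
  shows "\<exists>(prog :: com) (c :: nat).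
    \<forall>(G :: nat graph) (J :: nat set) (H :: nat \<Rightarrow> nat graph) (w :: nat \<Rightarrow> rat)
     (T :: nat graph) (X :: nat \<Rightarrow> nat set) (s :: state).
      fin_graph G \<longrightarrow>
      finite J \<longrightarrow>
      (\<forall>j\<in>J. subgraph (H j) G \<and> connected_graph (H j) \<and> verts (H j) \<noteq> {}) \<longrightarrow>
      (\<forall>j\<in>J. 0 \<le> w j) \<longrightarrow>
      tree_decomposition G T X \<longrightarrow>
      td_independence_number G T X \<le> k \<longrightarrow>
      encodes_instance s G J H w T X \<longrightarrow>
      (\<exists>t s'. exec prog s t s' \<and>
         max_weight_distance_packing d G J H w (output_set s' J) \<and>
         t \<le> c * (1 + ((card (verts G) + card (verts T)) * card (edges G)
                     + card J * card (verts G) *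
                         ((card J + card (verts T) + card (verts G))
                          + card J ^ (k + 1) * card (verts T)))))"
proof -
  from assms obtain r where r: "d = 2 * r + 2"
  proof -
    from assms(1) obtain e where "d = 2 * e" by (rule dvdE)
    with assms(2) that[of "e - 1"] show ?thesis by simp
  qed
  define C where "C = 12 * k + 16 * d + 800"
  \<comment> \<open>The guard answers an empty family at once: if in addition \<open>G\<close> has
    no edges, the bound is a constant, whereas searching the tree takes time proportional to
    \<open>m\<close>.\<close>
  define prog where "prog = Cond (NPos (NVar ''nJ'')) (Seq (Front d k) (Back k r)) Skip"
  show ?thesis
  \<comment> \<open>The summand 2 pays for the guard and the \<open>Skip\<close> of the empty case;
    \<open>2 ^ k\<close> pays for replacing \<open>Suc n ^ k\<close> by
    \<open>n ^ k\<close>.\<close>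
  proof (rule exI[of _ prog], rule exI[of _ "2 + C * 2 ^ k"], intro allI impI, goal_cases)
    case (1 G J H w T X s)
    define n V m where "n = nvar s ''nJ''" and "V = nvar s ''nV''" and "m = nvar s ''nT''"
    have dims: "J = {..<n}" "verts G = {..<V}" "verts T = {..<m}"
      using 1(7) by (simp_all add: encodes_instance_def n_def V_def m_def)
    define U where "U = n * V * (n + m + V)"
    define W where "W = n * V * (n ^ (k + 1) * m)"
    have bound: "1 + ((card (verts G) + card (verts T)) * card (edges G) + card J * card (verts G) *
        ((card J + card (verts T) + card (verts G)) + card J ^ (k + 1) * card (verts T))) =
        1 + (V + m) * card (edges G) + U + W"
      by (simp add: dims U_def W_def algebra_simps)
    show ?case
    proof (cases "n = 0")
      case True
      have "exec prog s (1 + 1) s"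
        unfolding prog_def using True by (intro exec.CondFalse exec.Skip) (simp add: n_def)
      moreover have "max_weight_distance_packing d G J H w (output_set s J)"
        using True by (auto simp: dims max_weight_distance_packing_def distance_packing_def output_set_def)
      ultimately show ?thesis unfolding bound
        by (intro exI[of _ "1 + 1"] exI[of _ s] conjI) (assumption+, simp)
    next
      case False
      interpret packing_instance d k r G H w T X n V m "Suc n ^ k"
        by unfold_locales (use r 1 dims False in auto)
      have "enc s" using 1(7) dims by simp
      from runs_Front_Back[OF this] obtain t s'
        where t: "exec (Seq (Front d k) (Back k r)) s t s'" "t \<le> C * B"
          "max_weight_distance_packing d G {..<n} H w (output_set s' {..<n})"
        unfolding C_def by (blast elim: runsE)
      \<comment> \<open>Positivity of \<open>n\<close> gives \<open>Suc n \<le> 2 * n\<close>, so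
        the extra digit for no element costs only a factor depending on \<open>k\<close>.\<close>
      have "Suc n ^ k \<le> (2 * n) ^ k" using n by (intro power_mono) auto
      then have "Suc n ^ k * (n * n * m * V) \<le> 2 ^ k * n ^ k * (n * n * m * V)"
        by (intro mult_le_mono1) (simp add: power_mult_distrib)
      then have "B \<le> U + 2 ^ k * W" by (simp add: B_def U_def W_def algebra_simps)
      also have "\<dots> \<le> 2 ^ k * (U + W)" by (simp add: algebra_simps)
      finally have "C * B \<le> C * 2 ^ k * (U + W)" by (metis mult.assoc mult_le_mono2)
      then have "1 + t \<le> (2 + C * 2 ^ k) * (1 + (V + m) * card (edges G) + U + W)"
        using t(2) by (simp add: algebra_simps)
      moreover have "exec prog s (1 + t) s'"
        unfolding prog_def using t(1) False by (intro exec.CondTrue) (simp_all add: n_def)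
      ultimately show ?thesis unfolding bound using t(3) dims(1) by blast
    qed
  qed
qed

end
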